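(* There exists a constant $\eta_0>0$, depending only on $V$, such that the following holds. Let $\Omega\subset\mathbb R^2$ be a smooth bounded domain, $M_0>0$, $(\varepsilon_n)\subset(0,1]$ a decreasing sequence tending to $0$, and let $u_{\varepsilon_n}:\Omega\to\mathbb R^k$ be solutions of $-\Delta u_{\varepsilon_n}=-\varepsilon_n^{-2}\nabla V(u_{\varepsilon_n})$ in $\Omega$ with $\int_\Omega e_{\varepsilon_n}(u_{\varepsilon_n})\,dx\le M_0$ such that the measures $e_{\varepsilon_n}(u_{\varepsilon_n})\,dx$ converge in the sense of measures on $\Omega$ to a measure $\nu_\star$. Let $x_0\in\Omega$ and $r>0$ be such that $\mathbb D^2(x_0,r)\subset\Omega$. If $$\frac{\nu_\star\big(\overline{\mathbb D^2(x_0,r)}\big)}{r}<\eta_0,\qquad\text{then}\qquad \nu_\star\Big(\overline{\mathbb D^2(x_0,\tfrac r2)}\Big)=0.$$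
   Context: Let $k\ge 1$ and let $V:\mathbb R^k\to\mathbb R$ be smooth with $\inf V=0$ and satisfying: (1) $\Sigma:=\{y\in\mathbb R^k: V(y)=0\}=\{\sigma_1,\dots,\sigma_q\}$ is finite with $q\ge2$; (2) the Hessian $\nabla^2V(\sigma_i)$ is positive definite for every $i$; (3) there are constants $\alpha_\infty>0$, $R_\infty>0$ such that $y\cdot\nabla V(y)\ge\alpha_\infty|y|^2$ if $|y|>R_\infty$, and $V(y)\to+\infty$ as $|y|\to+\infty$. For $\varepsilon>0$, $e_\varepsilon(u)=\varepsilon\frac{|\nabla u|^2}{2}+\frac1\varepsilon V(u)$. Solutions are smooth maps satisfying the equation pointwise. $\mathbb D^2(x,r)$ is the open disc of center $x$ and radius $r$ in $\mathbb R^2$. The measure $\nu_\star$ lives on $\Omega$; $\nu_\star(\overline{\mathbb D^2(x,r)})$ means $\nu_\star(\overline{\mathbb D^2(x,r)}\cap\Omega)$. Convergence in the sense of measures on $\Omega$ means convergence against every continuous function with compact support in $\Omega$. *)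

theory Defs
  imports "HOL-Analysis.Analysis"
begin

definition partial :: "'n::finite \<Rightarrow> (real^'n \<Rightarrow> 'b::real_normed_vector) \<Rightarrow> real^'n \<Rightarrow> 'b" where
  "partial i f x = frechet_derivative f (at x) (axis i 1)"

(* Only used for open S, where differentiability within S is differentiability at each point
   and the partial derivatives depend only on the values of f on S. *)
primrec Ck_on :: "nat \<Rightarrow> (real^'n::finite) set \<Rightarrow> (real^'n \<Rightarrow> 'b::real_normed_vector) \<Rightarrow> bool" where
  "Ck_on 0 S f \<longleftrightarrow> continuous_on S f"
| "Ck_on (Suc m) S f \<longleftrightarrow> f differentiable_on S \<and> (\<forall>i. Ck_on m S (partial i f))"

definition smooth_on :: "(real^'n::finite) set \<Rightarrow> (real^'n \<Rightarrow> 'b::real_normed_vector) \<Rightarrow> bool" where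
  "smooth_on S f \<longleftrightarrow> (\<forall>m. Ck_on m S f)"

definition grad :: "(real^'n::finite \<Rightarrow> real) \<Rightarrow> real^'n \<Rightarrow> real^'n" where
  "grad f x = (\<chi> i. partial i f x)"

definition hessian :: "(real^'n::finite \<Rightarrow> real) \<Rightarrow> real^'n \<Rightarrow> real^'n^'n" where
  "hessian f x = (\<chi> i j. partial i (partial j f) x)"

definition laplacian :: "(real^'n::finite \<Rightarrow> 'b::real_normed_vector) \<Rightarrow> real^'n \<Rightarrow> 'b" where
  "laplacian f x = (\<Sum>i\<in>UNIV. partial i (partial i f) x)"

definition pos_definite :: "real^'n^'n::finite \<Rightarrow> bool" where
  "pos_definite A \<longleftrightarrow> transpose A = A \<and> (\<forall>h. h \<noteq> 0 \<longrightarrow> 0 < h \<bullet> (A *v h))"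

(* The infimum over the reals is unspecified for sets not bounded below,
   hence the explicit boundedness condition. *)
definition multiwell_potential :: "(real^'k::finite \<Rightarrow> real) \<Rightarrow> bool" where
  "multiwell_potential V \<longleftrightarrow>
     smooth_on UNIV V \<and>
     bdd_below (range V) \<and> (INF y. V y) = 0 \<and>
     finite {y. V y = 0} \<and> 2 \<le> card {y. V y = 0} \<and>
     (\<forall>\<sigma>. V \<sigma> = 0 \<longrightarrow> pos_definite (hessian V \<sigma>)) \<and>
     (\<exists>\<alpha>>0. \<exists>R>0. \<forall>y. norm y > R \<longrightarrow> y \<bullet> grad V y \<ge> \<alpha> * (norm y)\<^sup>2) \<and>
     filterlim V at_top at_infinity"

(* The boundary is smooth in the sense of local defining functions: near each boundary point,
   the domain is a strict sublevel set of a smooth function without critical points. *)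
definition smooth_bounded_domain :: "(real^2) set \<Rightarrow> bool" where
  "smooth_bounded_domain \<Omega> \<longleftrightarrow>
     open \<Omega> \<and> connected \<Omega> \<and> \<Omega> \<noteq> {} \<and> bounded \<Omega> \<and>
     (\<forall>p\<in>frontier \<Omega>. \<exists>U (\<rho> :: real^2 \<Rightarrow> real).
        open U \<and> p \<in> U \<and> smooth_on U \<rho> \<and> (\<forall>x\<in>U. grad \<rho> x \<noteq> 0) \<and>
        \<Omega> \<inter> U = {x \<in> U. \<rho> x < 0})"

definition energy_density ::
  "(real^'k::finite \<Rightarrow> real) \<Rightarrow> real \<Rightarrow> (real^2 \<Rightarrow> real^'k) \<Rightarrow> real^2 \<Rightarrow> real" where
  "energy_density V \<epsilon> u x =
     \<epsilon> * ((\<Sum>i\<in>UNIV. (norm (partial i u x))\<^sup>2) / 2) + (1 / \<epsilon>) * V (u x)"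

definition energy_measure ::
  "(real^'k::finite \<Rightarrow> real) \<Rightarrow> (real^2) set \<Rightarrow> real \<Rightarrow> (real^2 \<Rightarrow> real^'k) \<Rightarrow> (real^2) measure" where
  "energy_measure V \<Omega> \<epsilon> u =
     density (restrict_space lborel \<Omega>) (\<lambda>x. ennreal (energy_density V \<epsilon> u x))"

definition solution_on ::
  "(real^'k::finite \<Rightarrow> real) \<Rightarrow> (real^2) set \<Rightarrow> real \<Rightarrow> (real^2 \<Rightarrow> real^'k) \<Rightarrow> bool" where
  "solution_on V \<Omega> \<epsilon> u \<longleftrightarrow>
     smooth_on \<Omega> u \<and> (\<forall>x\<in>\<Omega>. - laplacian u x = - ((1 / \<epsilon>\<^sup>2) *\<^sub>R grad V (u x)))"

(* Local finiteness is needed for the integrals of test functions to be meaningful;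
   on an open subset of the plane it already gives regularity. *)
definition radon_measure_on :: "(real^2) set \<Rightarrow> (real^2) measure \<Rightarrow> bool" where
  "radon_measure_on \<Omega> \<nu> \<longleftrightarrow>
     sets \<nu> = sets (restrict_space borel \<Omega>) \<and>
     (\<forall>K. compact K \<and> K \<subseteq> \<Omega> \<longrightarrow> emeasure \<nu> K < \<infinity>)"

(* Test functions on \<Omega> are represented by their extension by zero to the plane. *)
definition test_function_on :: "(real^2) set \<Rightarrow> (real^2 \<Rightarrow> real) \<Rightarrow> bool" where
  "test_function_on \<Omega> \<phi> \<longleftrightarrow>
     continuous_on UNIV \<phi> \<and> compact (closure {x. \<phi> x \<noteq> 0}) \<and> closure {x. \<phi> x \<noteq> 0} \<subseteq> \<Omega>"

definition converges_as_measures_on ::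
  "(real^2) set \<Rightarrow> (nat \<Rightarrow> (real^2) measure) \<Rightarrow> (real^2) measure \<Rightarrow> bool" where
  "converges_as_measures_on \<Omega> \<mu> \<nu> \<longleftrightarrow>
     (\<forall>\<phi>. test_function_on \<Omega> \<phi> \<longrightarrow>
        (\<lambda>n. integral\<^sup>L (\<mu> n) \<phi>) \<longlonglongrightarrow> integral\<^sup>L \<nu> \<phi>)"

end

theory Submission
  imports Defs
begin

text \<open>
  The key is a decay estimate at a fixed scale: if the energy \<open>E\<close> on a square of half side \<open>R\<close>
  satisfies \<open>E \<le> \<eta> R\<close>, then for small \<open>\<epsilon>\<close> the energy on the square of half side \<open>R/2\<close> is at most
  \<open>\<theta> E + o(1)\<close>, with \<open>\<theta>\<close> as small as we like. In the limit the measure satisfies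
  \<open>\<nu> (S (\<rho>/8)) \<le> \<nu> (S \<rho>) / 128\<close> at every centre and all scales, so \<open>\<nu> (S s)\<close> is of order
  \<open>s\<close> to the power \<open>7/3 > 2\<close>, and covering by about \<open>1/s\<^sup>2\<close> squares gives measure zero.

  For the decay, call a vertical or horizontal line good if its one-dimensional energy is small. On a good
  line \<open>u\<close> stays near a single well; as good lines in the two directions cross, it is the same well \<open>\<sigma>\<close> for
  all of them. The bad lines have total width \<open>O(E)\<close>, and the set where \<open>u\<close> is far from \<open>\<sigma>\<close> lies in the
  product of the two bad sets. Three estimates then close the argument on a rectangle with good sides.
  (1) Testing the equation with a logarithmic cutoff times \<open>u - \<sigma>\<close> bounds the energy near a well by
  \<open>\<delta> E + o(1)\<close>. (2) The maximum principle bounds \<open>|u|\<close> and a barrier argument gives \<open>|\<nabla>u| \<le> C/\<epsilon>\<close>, so away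
  from the wells the energy density is controlled by \<open>V(u)/\<epsilon>\<close>. (3) The stress-energy tensor is divergence
  free, so its flux through each bad line is \<open>O(E/R)\<close>, and its trace is \<open>-2 V(u)/\<epsilon>\<close>; integrating over
  the bad lines bounds the potential energy far from \<open>\<sigma>\<close> by \<open>O(E\<^sup>2/R)\<close> up to terms of type (1).
\<close>

section \<open>Maximum principle and gradient bound on rectangles\<close>

text \<open>For vector-valued maps
  \<open>\<epsilon> |\<nabla>u|\<^sup>2 / 2 - V(u) / \<epsilon>\<close> has no sign, so
  \<open>E / R\<close> is not known to be monotone in \<open>R\<close>, and the gradient energy is
  not controlled by the potential energy. The trace of the stress-energy tensor sees only the
  potential; the gradient part has to be recovered separately, by testing near the wells and by
  \<open>|\<nabla>u| \<le> C / \<epsilon>\<close> far from them. Hence well neighbourhoods are used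
  twice with different cutoffs: a first one fixes the constant \<open>C\<close> comparing energy
  with potential off the wells, and the error \<open>\<delta> E\<close> of the second one is
  multiplied by \<open>C\<close>, so \<open>\<delta>\<close> must be chosen after \<open>C\<close>
  and be as small as needed. Testing leaves a term of size
  \<open>t |\<psi>' t| \<epsilon> |\<nabla>u|\<^sup>2\<close> with
  \<open>t = |u - \<sigma>|\<^sup>2\<close>; for an ordinary cutoff it is comparable with the
  energy, for a logarithmic one it is \<open>O(\<delta>) E\<close>. The factor
  \<open>\<theta>\<close> comes from \<open>E\<^sup>2 / R \<le> \<eta> E\<close>, so
  \<open>\<eta>\<close> is chosen after \<open>\<theta>\<close>. Dividing the radius by 8 multiplies
  the number of covering squares by 64; any \<open>\<theta>\<close> below 1/64 wins against this,
  and 1/128 is used.\<close>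

text \<open>At the maximum \<open>f' a = 0\<close>. If \<open>d > 0\<close>, then \<open>f'\<close>
  is positive just to the right of \<open>a\<close>, and the mean value theorem makes
  \<open>f\<close> exceed \<open>f a\<close> there.\<close>

lemma local_max_second_deriv_nonpos:
  fixes f f' :: "real \<Rightarrow> real"
  assumes "e > 0"
    and f': "\<And>t. \<bar>t - a\<bar> < e \<Longrightarrow> (f has_real_derivative f' t) (at t)"
    and f'': "(f' has_real_derivative d) (at a)"
    and max: "\<And>t. \<bar>t - a\<bar> < e \<Longrightarrow> f t \<le> f a"
  shows "d \<le> 0"
proof (rule ccontr)
  assume "\<not> d \<le> 0"
  then obtain \<delta> where \<delta>: "\<delta> > 0" "\<And>h. h > 0 \<Longrightarrow> h < \<delta> \<Longrightarrow> f' a < f' (a + h)"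
    using DERIV_pos_inc_right[OF f''] by auto
  have "f' a = 0"
    using DERIV_local_max[OF f'[of a] \<open>e > 0\<close>] max \<open>e > 0\<close> by (simp add: abs_minus_commute)
  define h where "h = min \<delta> e / 2"
  have h: "h > 0" "h < \<delta>" "h < e"
    using \<open>e > 0\<close> \<delta> by (auto simp: h_def min_def)
  obtain z where z: "a < z" "z < a + h" "f (a + h) - f a = (a + h - a) * f' z"
    using MVT2[of a "a + h" f f'] f' h by force
  have "f' z > 0"
    using \<delta>(2)[of "z - a"] z h \<open>f' a = 0\<close> by auto
  then have "f (a + h) > f a"
    using z(3) mult_pos_pos[of h "f' z"] h(1) by (simp add: algebra_simps)
  then show False
    using max[of "a + h"] h by auto
qed

text \<open>At an interior maximum both pure second derivatives are nonpositive. The sign of the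
  Laplacian is asked for only where \<open>w > k\<close>: for \<open>|U|\<^sup>2\<close> it is known
  only outside a ball of values.\<close>

lemma max_principle_rectangle:
  fixes w w1 w2 w11 w22 :: "real \<times> real \<Rightarrow> real"
  assumes cont: "continuous_on ({a0..a1} \<times> {b0..b1}) w"
    and d1: "\<And>a b. a \<in> {a0<..<a1} \<Longrightarrow> b \<in> {b0<..<b1} \<Longrightarrow>
      ((\<lambda>t. w (t, b)) has_real_derivative w1 (a, b)) (at a)"
    and d11: "\<And>a b. a \<in> {a0<..<a1} \<Longrightarrow> b \<in> {b0<..<b1} \<Longrightarrow>
      ((\<lambda>t. w1 (t, b)) has_real_derivative w11 (a, b)) (at a)"
    and d2: "\<And>a b. a \<in> {a0<..<a1} \<Longrightarrow> b \<in> {b0<..<b1} \<Longrightarrow>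
      ((\<lambda>t. w (a, t)) has_real_derivative w2 (a, b)) (at b)"
    and d22: "\<And>a b. a \<in> {a0<..<a1} \<Longrightarrow> b \<in> {b0<..<b1} \<Longrightarrow>
      ((\<lambda>t. w2 (a, t)) has_real_derivative w22 (a, b)) (at b)"
    and lap: "\<And>a b. a \<in> {a0<..<a1} \<Longrightarrow> b \<in> {b0<..<b1} \<Longrightarrow> w (a, b) > k \<Longrightarrow>
      w11 (a, b) + w22 (a, b) > 0"
    and bdry: "\<And>a b. a \<in> {a0..a1} \<Longrightarrow> b \<in> {b0..b1} \<Longrightarrow> a = a0 \<or> a = a1 \<or> b = b0 \<or> b = b1 \<Longrightarrow>
      w (a, b) \<le> k"
    and p: "p \<in> {a0..a1} \<times> {b0..b1}"
  shows "w p \<le> k"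
proof (rule ccontr)
  assume *: "\<not> w p \<le> k"
  have "compact ({a0..a1} \<times> {b0..b1})"
    by (intro compact_Times compact_Icc)
  from continuous_attains_sup[OF this _ cont] p
  obtain q where q: "q \<in> {a0..a1} \<times> {b0..b1}" "\<And>y. y \<in> {a0..a1} \<times> {b0..b1} \<Longrightarrow> w y \<le> w q"
    by (metis empty_iff)
  obtain a b where [simp]: "q = (a, b)" by (cases q)
  have "w (a, b) > k"
    using q(2)[OF p] * by auto
  with bdry[of a b] q(1) have ab: "a0 < a" "a < a1" "b0 < b" "b < b1"
    by fastforce+
  have "w11 (a, b) \<le> 0"
  proof (rule local_max_second_deriv_nonpos[where f="\<lambda>t. w (t, b)" and f'="\<lambda>t. w1 (t, b)"])
    show "min (a - a0) (a1 - a) > 0" using ab by auto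
    show "((\<lambda>t. w (t, b)) has_real_derivative w1 (t, b)) (at t)" if "\<bar>t - a\<bar> < min (a - a0) (a1 - a)" for t
      using that ab by (intro d1) auto
    show "((\<lambda>t. w1 (t, b)) has_real_derivative w11 (a, b)) (at a)"
      using ab by (intro d11) auto
    show "w (t, b) \<le> w (a, b)" if "\<bar>t - a\<bar> < min (a - a0) (a1 - a)" for t
      using q(2)[of "(t, b)"] that ab by (simp add: abs_less_iff)
  qed
  moreover have "w22 (a, b) \<le> 0"
  proof (rule local_max_second_deriv_nonpos[where f="\<lambda>t. w (a, t)" and f'="\<lambda>t. w2 (a, t)"])
    show "min (b - b0) (b1 - b) > 0" using ab by auto
    show "((\<lambda>t. w (a, t)) has_real_derivative w2 (a, t)) (at t)" if "\<bar>t - b\<bar> < min (b - b0) (b1 - b)" for t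
      using that ab by (intro d2) auto
    show "((\<lambda>t. w2 (a, t)) has_real_derivative w22 (a, b)) (at b)"
      using ab by (intro d22) auto
    show "w (a, t) \<le> w (a, b)" if "\<bar>t - b\<bar> < min (b - b0) (b1 - b)" for t
      using q(2)[of "(a, t)"] that ab by (simp add: abs_less_iff)
  qed
  ultimately show False
    using lap[of a b] ab \<open>w (a, b) > k\<close> by auto
qed

lemma shift_derivs:
  fixes f :: "real \<Rightarrow> real"
  shows "(f has_real_derivative D) (at (a + x)) \<Longrightarrow> ((\<lambda>x. f (a + x)) has_real_derivative D) (at x)"
    and "(f has_real_derivative D) (at (a - x)) \<Longrightarrow> ((\<lambda>x. f (a - x)) has_real_derivative - D) (at x)"
proof -
  show "((\<lambda>x. f (a + x)) has_real_derivative D) (at x)" if "(f has_real_derivative D) (at (a + x))"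
    using that DERIV_shift[of f D x a] by (simp add: add.commute)
  show "((\<lambda>x. f (a - x)) has_real_derivative - D) (at x)" if "(f has_real_derivative D) (at (a - x))"
    proof -
    have "((-) a has_real_derivative - 1) (at x)"
      by (auto intro!: derivative_eq_intros)
    then show ?thesis
      using DERIV_chain2[of f D "\<lambda>x. a - x" x "-1" UNIV] that by simp
  qed
qed

text \<open>Brandt's barrier argument: compare the odd reflection \<open>v (a + s, b + t) - v (a - s, b + t)\<close>
  with a quadratic supersolution on half of the square.\<close>

lemma brandt_gradient_bound:
  fixes v v1 v2 v11 v22 :: "real \<times> real \<Rightarrow> real"
  assumes "d > 0"
    and cont: "continuous_on ({a - d..a + d} \<times> {b - d..b + d}) v"
    and d1: "\<And>s t. s \<in> {a - d..a + d} \<Longrightarrow> t \<in> {b - d..b + d} \<Longrightarrow>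
      ((\<lambda>s. v (s, t)) has_real_derivative v1 (s, t)) (at s)"
    and d11: "\<And>s t. s \<in> {a - d..a + d} \<Longrightarrow> t \<in> {b - d..b + d} \<Longrightarrow>
      ((\<lambda>s. v1 (s, t)) has_real_derivative v11 (s, t)) (at s)"
    and d2: "\<And>s t. s \<in> {a - d..a + d} \<Longrightarrow> t \<in> {b - d..b + d} \<Longrightarrow>
      ((\<lambda>t. v (s, t)) has_real_derivative v2 (s, t)) (at t)"
    and d22: "\<And>s t. s \<in> {a - d..a + d} \<Longrightarrow> t \<in> {b - d..b + d} \<Longrightarrow>
      ((\<lambda>t. v2 (s, t)) has_real_derivative v22 (s, t)) (at t)"
    and M: "\<And>s t. s \<in> {a - d..a + d} \<Longrightarrow> t \<in> {b - d..b + d} \<Longrightarrow> \<bar>v (s, t)\<bar> \<le> M"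
    and L: "\<And>s t. s \<in> {a - d..a + d} \<Longrightarrow> t \<in> {b - d..b + d} \<Longrightarrow> \<bar>v11 (s, t) + v22 (s, t)\<bar> \<le> L / d\<^sup>2"
  shows "v1 (a, b) \<le> 3 * (2 * M + L + 1) / d"
proof -
  \<comment> \<open>\<open>P > L\<close> makes the barrier strictly beat the Laplacian of the
    reflected difference; \<open>P \<ge> 2 * M\<close> makes it dominate that difference on the
    boundary.\<close>
  define P where "P = 2 * M + L + 1"
  have "M \<ge> 0" "L \<ge> 0"
  proof -
    show "M \<ge> 0"
      using M[of a b] \<open>d > 0\<close> by auto
    have "0 \<le> L / d\<^sup>2"
      using L[of a b] \<open>d > 0\<close> by auto
    then show "L \<ge> 0"
      using \<open>d > 0\<close> by (simp add: zero_le_divide_iff)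
  qed
  then have P: "P > L" "P \<ge> 2 * M" "P \<ge> 0" by (auto simp: P_def)
  \<comment> \<open>The polynomial \<open>t\<^sup>2 + 6 s d - 2 s\<^sup>2\<close> has Laplacian -2,
    is nonnegative on \<open>s = 0\<close>, where the odd difference vanishes, and is at least
    \<open>d\<^sup>2\<close> on the other three sides.\<close>
  define w where "w = (\<lambda>(s, t). v (a + s, b + t) - v (a - s, b + t)
      - P * ((t\<^sup>2 + 6 * s * d - 2 * s\<^sup>2) / d\<^sup>2))"
  define w1 where "w1 = (\<lambda>(s, t). v1 (a + s, b + t) + v1 (a - s, b + t)
      - P * ((6 * d - 4 * s) / d\<^sup>2))"
  define w11 where "w11 = (\<lambda>(s, t). v11 (a + s, b + t) - v11 (a - s, b + t)
      - P * (- 4 / d\<^sup>2))"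
  define w2 where "w2 = (\<lambda>(s, t). v2 (a + s, b + t) - v2 (a - s, b + t) - P * (2 * t / d\<^sup>2))"
  define w22 where "w22 = (\<lambda>(s, t). v22 (a + s, b + t) - v22 (a - s, b + t) - P * (2 / d\<^sup>2))"
  have w_le: "w (s, 0) \<le> 0" if "s \<in> {0..d}" for s
  proof (rule max_principle_rectangle[where ?a0.0=0 and ?a1.0=d and ?b0.0="-d" and ?b1.0=d
        and ?w1.0=w1 and ?w2.0=w2 and ?w11.0=w11 and ?w22.0=w22])
    show "continuous_on ({0..d} \<times> {-d..d}) w"
      unfolding w_def case_prod_beta
      using \<open>d > 0\<close>
      by (intro continuous_intros continuous_on_compose2[OF cont]) auto
    show "(s, 0) \<in> {0..d} \<times> {-d..d}"
      using that by auto
  next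
    fix s t assume st: "s \<in> {0<..<d}" "t \<in> {-d<..<d}"
    have ran: "a + s \<in> {a - d..a + d}" "a - s \<in> {a - d..a + d}" "b + t \<in> {b - d..b + d}"
      using st by auto
    note r1 = shift_derivs(1)[where f="\<lambda>s. v (s, b + t)", OF d1[OF ran(1,3)]]
      shift_derivs(2)[where f="\<lambda>s. v (s, b + t)", OF d1[OF ran(2,3)]]
    note r11 = shift_derivs(1)[where f="\<lambda>s. v1 (s, b + t)", OF d11[OF ran(1,3)]]
      shift_derivs(2)[where f="\<lambda>s. v1 (s, b + t)", OF d11[OF ran(2,3)]]
    note r2 = shift_derivs(1)[where f="\<lambda>t. v (a + s, t)", OF d2[OF ran(1,3)]]
      shift_derivs(1)[where f="\<lambda>t. v (a - s, t)", OF d2[OF ran(2,3)]]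
    note r22 = shift_derivs(1)[where f="\<lambda>t. v2 (a + s, t)", OF d22[OF ran(1,3)]]
      shift_derivs(1)[where f="\<lambda>t. v2 (a - s, t)", OF d22[OF ran(2,3)]]
    have [simp]: "d \<noteq> 0" using \<open>d > 0\<close> by simp
    show "((\<lambda>s. w (s, t)) has_real_derivative w1 (s, t)) (at s)"
      unfolding w_def w1_def prod.case
      by (rule DERIV_cong, (rule r1 derivative_intros refl)+; simp)
        (simp add: field_simps power2_eq_square power4_eq_xxxx)
    show "((\<lambda>s. w1 (s, t)) has_real_derivative w11 (s, t)) (at s)"
      unfolding w11_def w1_def prod.case
      by (rule DERIV_cong, (rule r11 derivative_intros refl)+; simp)
        (simp add: field_simps power2_eq_square power4_eq_xxxx)?
    show "((\<lambda>t. w (s, t)) has_real_derivative w2 (s, t)) (at t)"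
      unfolding w_def w2_def prod.case
      by (rule DERIV_cong, (rule r2 derivative_intros refl)+; simp)
        (simp add: field_simps power2_eq_square power4_eq_xxxx)?
    show "((\<lambda>t. w2 (s, t)) has_real_derivative w22 (s, t)) (at t)"
      unfolding w22_def w2_def prod.case
      by (rule DERIV_cong, (rule r22 derivative_intros refl)+; simp)
        (simp add: field_simps power2_eq_square power4_eq_xxxx)?
    have "w11 (s, t) + w22 (s, t) = (v11 (a + s, b + t) + v22 (a + s, b + t))
        - (v11 (a - s, b + t) + v22 (a - s, b + t)) + 2 * P / d\<^sup>2"
      by (simp add: w11_def w22_def field_simps)
    moreover have "2 * P / d\<^sup>2 > 2 * (L / d\<^sup>2)"
      using P \<open>d > 0\<close> by (simp add: divide_strict_right_mono)
    ultimately show "w11 (s, t) + w22 (s, t) > 0"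
      using L[OF ran(1,3)] L[OF ran(2,3)] by linarith
  next
    fix s t assume st: "s \<in> {0..d}" "t \<in> {-d..d}" "s = 0 \<or> s = d \<or> t = - d \<or> t = d"
    have ran: "a + s \<in> {a - d..a + d}" "a - s \<in> {a - d..a + d}" "b + t \<in> {b - d..b + d}"
      using st by auto
    have q: "s * (6 * d - 2 * s) \<ge> 0"
      using st \<open>d > 0\<close> by (intro mult_nonneg_nonneg) auto
    show "w (s, t) \<le> 0"
    proof (cases "s = 0")
      case True
      then show ?thesis using P by (simp add: w_def)
    next
      case False
      then have "t\<^sup>2 + 6 * s * d - 2 * s\<^sup>2 \<ge> d\<^sup>2"
        using st q zero_le_power2[of t] by (auto simp: power2_eq_square algebra_simps)
      then have "(t\<^sup>2 + 6 * s * d - 2 * s\<^sup>2) / d\<^sup>2 \<ge> 1"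
        using \<open>d > 0\<close> by simp
      then have "P * ((t\<^sup>2 + 6 * s * d - 2 * s\<^sup>2) / d\<^sup>2) \<ge> P * 1"
        using P by (intro mult_left_mono)
      then show ?thesis
        using M[OF ran(1,3)] M[OF ran(2,3)] P by (simp add: w_def)
    qed
  qed
  \<comment> \<open>On the axis \<open>g \<le> w \<le> 0\<close>, and \<open>g 0 = 0\<close>, so the
    slope of \<open>g\<close> at 0 is nonpositive. That slope is
    \<open>2 * v1 (a, b) - 6 * P / d\<close>, whence the factor 3.\<close>
  define g where "g = (\<lambda>s. v (a + s, b) - v (a - s, b) - 6 * P * s / d)"
  have "g s \<le> 0" if "s \<in> {0..d}" for s
  proof -
    have "w (s, 0) = g s + P * (2 * s\<^sup>2 / d\<^sup>2)"
      using \<open>d > 0\<close> by (simp add: w_def g_def field_simps power2_eq_square)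
    moreover have "P * (2 * s\<^sup>2 / d\<^sup>2) \<ge> 0"
      using P by simp
    ultimately show ?thesis using w_le[OF that] by linarith
  qed
  have ran: "a \<in> {a - d..a + d}" "b \<in> {b - d..b + d}"
    using \<open>d > 0\<close> by auto
  have "((\<lambda>s. v (a + s, b)) has_real_derivative v1 (a, b)) (at 0)"
       "((\<lambda>s. v (a - s, b)) has_real_derivative - v1 (a, b)) (at 0)"
    using shift_derivs[where f="\<lambda>s. v (s, b)" and D="v1 (a, b)" and a=a and x=0] d1[OF ran] by simp_all
  then have g': "(g has_real_derivative (2 * v1 (a, b) - 6 * P / d)) (at 0)"
    unfolding g_def using \<open>d > 0\<close> by (auto intro!: derivative_eq_intros)
  have "2 * v1 (a, b) - 6 * P / d \<le> 0"
  proof (rule ccontr)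
    assume "\<not> ?thesis"
    then obtain \<delta> where "\<delta> > 0" "\<And>h. h > 0 \<Longrightarrow> h < \<delta> \<Longrightarrow> g 0 < g (0 + h)"
      using DERIV_pos_inc_right[OF g'] by auto
    moreover have "min \<delta> d / 2 > 0" "min \<delta> d / 2 < \<delta>"
      using \<open>d > 0\<close> \<open>\<delta> > 0\<close> by (auto simp: min_def)
    ultimately have "g 0 < g (min \<delta> d / 2)"
      by (metis add_0)
    moreover have "g (min \<delta> d / 2) \<le> 0"
      using \<open>\<delta> > 0\<close> \<open>d > 0\<close> by (intro \<open>\<And>s. s \<in> {0..d} \<Longrightarrow> g s \<le> 0\<close>) auto
    ultimately show False by (simp add: g_def)
  qed
  then have "v1 (a, b) \<le> 3 * P / d"
    by simp
  then show ?thesis by (simp add: P_def)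
qed

section \<open>Divergence theorem and one-dimensional energy\<close>

text \<open>Fubini, with each term integrated first in its own variable, and the fundamental theorem
  of calculus on each segment.\<close>

lemma integral_divergence_rectangle:
  fixes F G F1 G2 :: "real \<times> real \<Rightarrow> real"
  assumes "a0 \<le> a1" "b0 \<le> b1"
    and F1: "\<And>a b. a \<in> {a0..a1} \<Longrightarrow> b \<in> {b0..b1} \<Longrightarrow>
      ((\<lambda>t. F (t, b)) has_vector_derivative F1 (a, b)) (at a)"
    and G2: "\<And>a b. a \<in> {a0..a1} \<Longrightarrow> b \<in> {b0..b1} \<Longrightarrow>
      ((\<lambda>t. G (a, t)) has_vector_derivative G2 (a, b)) (at b)"
    and cont: "continuous_on (cbox (a0, b0) (a1, b1)) F1" "continuous_on (cbox (a0, b0) (a1, b1)) G2"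
  shows "integral (cbox (a0, b0) (a1, b1)) (\<lambda>p. F1 p + G2 p) =
    integral {b0..b1} (\<lambda>b. F (a1, b) - F (a0, b)) + integral {a0..a1} (\<lambda>a. G (a, b1) - G (a, b0))"
proof -
  have "integral (cbox (a0, b0) (a1, b1)) F1 = integral {b0..b1} (\<lambda>b. integral {a0..a1} (\<lambda>a. F1 (a, b)))"
    using integral_prod_continuous[OF cont(1)] integral_swap_continuous[of a0 b0 a1 b1 "\<lambda>a b. F1 (a, b)"] cont(1)
    by (simp add: case_prod_unfold)
  also have "\<dots> = integral {b0..b1} (\<lambda>b. F (a1, b) - F (a0, b))"
    by (intro integral_cong integral_unique
        fundamental_theorem_of_calculus[OF \<open>a0 \<le> a1\<close>] has_vector_derivative_at_within[OF F1])
  finally have 1: "integral (cbox (a0, b0) (a1, b1)) F1 = \<dots>" .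
  have "integral (cbox (a0, b0) (a1, b1)) G2 = integral {a0..a1} (\<lambda>a. integral {b0..b1} (\<lambda>b. G2 (a, b)))"
    using integral_prod_continuous[OF cont(2)] by simp
  also have "\<dots> = integral {a0..a1} (\<lambda>a. G (a, b1) - G (a, b0))"
    by (intro integral_cong integral_unique
        fundamental_theorem_of_calculus[OF \<open>b0 \<le> b1\<close>] has_vector_derivative_at_within[OF G2])
  finally have 2: "integral (cbox (a0, b0) (a1, b1)) G2 = \<dots>" .
  show ?thesis
    using 1 2 cont by (simp add: integral_add integrable_continuous)
qed

text \<open>The minimum is at most the average. Good lines, and points of small potential on a line,
  are selected this way.\<close>

lemma integral_le_imp_exists_le:
  fixes f :: "real \<Rightarrow> real"
  assumes "a < b" "continuous_on {a..b} f" "integral {a..b} f \<le> c * (b - a)"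
  shows "\<exists>t\<in>{a..b}. f t \<le> c"
proof -
  obtain t where t: "t \<in> {a..b}" "\<And>s. s \<in> {a..b} \<Longrightarrow> f t \<le> f s"
    using continuous_attains_inf[of "{a..b}" f] assms by auto
  have "f t * (b - a) = integral {a..b} (\<lambda>_. f t)"
    using assms by simp
  also have "\<dots> \<le> integral {a..b} f"
    using assms t by (intro integral_le integrable_continuous_interval) auto
  also have "\<dots> \<le> c * (b - a)"
    by fact
  finally have "f t * (b - a) \<le> c * (b - a)" .
  then show ?thesis
    using t \<open>a < b\<close> mult_le_cancel_right_pos[of "b - a" "f t" c] by auto
qed

lemma compact_Collect_le:
  fixes f g :: "'a::t2_space \<Rightarrow> real"
  assumes "compact S" "continuous_on S f" "continuous_on S g"
  shows "compact {x \<in> S. f x \<le> g x}"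
  using compact_Int_closed[OF assms(1) continuous_on_closed_Collect_le[OF assms(2,3) compact_imp_closed[OF assms(1)]]]
  by (simp add: Collect_conj_eq Int_assoc[symmetric])

text \<open>Take \<open>s\<close> as the last point where \<open>h \<le> p\<close> and
  \<open>t\<close> as the first later point where \<open>h \<ge> q\<close>; by extremality
  \<open>h\<close> stays in the layer in between, and the intermediate value theorem gives equality
  at both ends.\<close>

lemma crossing_interval:
  fixes h :: "real \<Rightarrow> real"
  assumes "u \<le> v" "continuous_on {u..v} h" "h u \<le> p" "q \<le> h v" "p < q"
  obtains s t where "u \<le> s" "s \<le> t" "t \<le> v" "h s = p" "h t = q" "\<And>x. x \<in> {s..t} \<Longrightarrow> p \<le> h x \<and> h x \<le> q"
proof -
  have cl: "compact {x \<in> {u..v}. h x \<le> p}"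
    using assms by (intro compact_Collect_le continuous_on_const) auto
  have "u \<in> {x \<in> {u..v}. h x \<le> p}"
    using assms by auto
  then obtain s where s: "s \<in> {u..v}" "h s \<le> p" "\<And>x. x \<in> {u..v} \<Longrightarrow> h x \<le> p \<Longrightarrow> x \<le> s"
    using compact_attains_sup[OF cl] by blast
  obtain s' where s': "s \<le> s'" "s' \<le> v" "h s' = p"
    using IVT'[of h s p v] s assms continuous_on_subset[OF assms(2), of "{s..v}"] by auto
  have "s' \<le> s"
    using s s' by auto
  with s' have "h s = p"
    by simp
  have cl2: "compact {x \<in> {s..v}. q \<le> h x}"
    using assms s continuous_on_subset[OF assms(2), of "{s..v}"]
    by (intro compact_Collect_le continuous_on_const) auto
  have "v \<in> {x \<in> {s..v}. q \<le> h x}"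
    using assms s by auto
  then obtain t where t: "t \<in> {s..v}" "q \<le> h t" "\<And>x. x \<in> {s..v} \<Longrightarrow> q \<le> h x \<Longrightarrow> t \<le> x"
    using compact_attains_inf[OF cl2] by blast
  obtain t' where t': "s \<le> t'" "t' \<le> t" "h t' = q"
    using IVT'[of h s q t] s t assms continuous_on_subset[OF assms(2), of "{s..t}"] \<open>h s = p\<close> by auto
  have "t \<le> t'"
    using t t' by auto
  with t' have "h t = q"
    by simp
  show thesis
  proof (rule that[of s t])
    show "p \<le> h x \<and> h x \<le> q" if "x \<in> {s..t}" for x
    proof
      show "p \<le> h x"
        using s(3)[of x] s(1) t(1) that \<open>h s = p\<close> by (cases "x = s") force+
      show "h x \<le> q"
        using t(3)[of x] s(1) t(1) that \<open>h t = q\<close> by (cases "x = t") force+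
    qed
  qed (use s t \<open>h s = p\<close> \<open>h t = q\<close> in auto)
qed

text \<open>The one-dimensional energy dominates the length in the degenerate metric
  \<open>\<surd>(2 V)\<close>, so crossing a layer on which \<open>V \<ge> m\<close> costs at least \<open>\<surd>(2 m)\<close> times its width.\<close>

lemma curve_confined:
  fixes \<gamma> \<gamma>' :: "real \<Rightarrow> 'a::euclidean_space" and V g :: "'a \<Rightarrow> real"
  assumes der: "\<And>t. t \<in> {a..b} \<Longrightarrow> (\<gamma> has_vector_derivative \<gamma>' t) (at t)"
    and cont: "continuous_on {a..b} \<gamma>'" "continuous_on UNIV V"
    and lip: "\<And>y z. \<bar>g y - g z\<bar> \<le> norm (y - z)"
    and V: "\<And>y. V y \<ge> 0" "\<And>y. p \<le> g y \<Longrightarrow> g y \<le> q \<Longrightarrow> V y \<ge> m"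
    and "p < q" "m > 0" "\<epsilon> > 0"
    and energy: "integral {a..b} (\<lambda>t. \<epsilon> * (norm (\<gamma>' t))\<^sup>2 / 2 + V (\<gamma> t) / \<epsilon>) < sqrt (2 * m) * (q - p)"
    and t: "t0 \<in> {a..b}" "g (\<gamma> t0) \<le> p" "t \<in> {a..b}"
  shows "g (\<gamma> t) < q"
proof (rule ccontr)
  assume "\<not> g (\<gamma> t) < q"
  then have gt: "g (\<gamma> t) \<ge> q" by simp
  define e where "e = (\<lambda>t. \<epsilon> * (norm (\<gamma>' t))\<^sup>2 / 2 + V (\<gamma> t) / \<epsilon>)"
  have cont_\<gamma>: "continuous_on {a..b} \<gamma>"
    using der by (meson continuous_at_imp_continuous_on has_vector_derivative_continuous)
  have "continuous_on {a..b} (\<lambda>t. V (\<gamma> t))"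
    by (rule continuous_on_compose2[OF cont(2) cont_\<gamma>]) auto
  then have conte: "continuous_on {a..b} e"
    unfolding e_def using \<open>\<epsilon> > 0\<close> by (intro continuous_intros cont) auto
  have "continuous_on UNIV g"
    unfolding continuous_on_iff dist_norm real_norm_def using lip le_less_trans by blast
  then have conth: "continuous_on {a..b} (\<lambda>t. g (\<gamma> t))"
    using continuous_on_compose2[OF _ cont_\<gamma>] by blast
  obtain s1 s2 where s: "a \<le> s1" "s1 \<le> s2" "s2 \<le> b" "\<bar>g (\<gamma> s2) - g (\<gamma> s1)\<bar> = q - p"
    "\<And>x. x \<in> {s1..s2} \<Longrightarrow> p \<le> g (\<gamma> x) \<and> g (\<gamma> x) \<le> q"
  proof (cases "t0 \<le> t")
    case True
    show ?thesis
    proof (rule crossing_interval[of t0 t "\<lambda>t. g (\<gamma> t)" p q])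
      show "continuous_on {t0..t} (\<lambda>t. g (\<gamma> t))"
        using t by (intro continuous_on_subset[OF conth]) auto
    next
      fix s1 s2
      assume "t0 \<le> s1" "s1 \<le> s2" "s2 \<le> t" "g (\<gamma> s1) = p" "g (\<gamma> s2) = q"
        "\<And>x. x \<in> {s1..s2} \<Longrightarrow> p \<le> g (\<gamma> x) \<and> g (\<gamma> x) \<le> q"
      then show thesis
        using t \<open>p < q\<close> by (intro that[of s1 s2]) auto
    qed (use True t gt \<open>p < q\<close> in auto)
  next
    \<comment> \<open>Here the layer is crossed downwards as the parameter increases; negating
      \<open>g\<close> and exchanging the levels reduces this to an upward crossing.\<close>
    case False
    show ?thesis
    proof (rule crossing_interval[of t t0 "\<lambda>t. - g (\<gamma> t)" "- q" "- p"])
      show "continuous_on {t..t0} (\<lambda>t. - g (\<gamma> t))"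
        using t by (intro continuous_on_minus continuous_on_subset[OF conth]) auto
    next
      fix s1 s2
      assume *: "t \<le> s1" "s1 \<le> s2" "s2 \<le> t0" "- g (\<gamma> s1) = - q" "- g (\<gamma> s2) = - p"
        "\<And>x. x \<in> {s1..s2} \<Longrightarrow> - q \<le> - g (\<gamma> x) \<and> - g (\<gamma> x) \<le> - p"
      show thesis
      proof (rule that[of s1 s2])
        show "p \<le> g (\<gamma> x) \<and> g (\<gamma> x) \<le> q" if "x \<in> {s1..s2}" for x
          using *(6)[OF that] by linarith
      qed (use * t \<open>p < q\<close> in auto)
    qed (use False t gt \<open>p < q\<close> in auto)
  qed
  have sub: "{s1..s2} \<subseteq> {a..b}" using s(1,3) by auto
  have int: "integral {s1..s2} \<gamma>' = \<gamma> s2 - \<gamma> s1"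
  proof (rule integral_unique[OF fundamental_theorem_of_calculus[OF s(2)]])
    show "(\<gamma> has_vector_derivative \<gamma>' x) (at x within {s1..s2})" if "x \<in> {s1..s2}" for x
      using that sub by (intro has_vector_derivative_at_within[OF der]) auto
  qed
  have cont': "continuous_on {s1..s2} \<gamma>'" "continuous_on {s1..s2} e"
    using cont(1) conte sub continuous_on_subset by blast+
  have cont'': "continuous_on {s1..s2} (\<lambda>t. norm (\<gamma>' t))"
    using cont'(1) by (rule continuous_on_norm)
  have "norm (\<gamma> s2 - \<gamma> s1) \<le> integral {s1..s2} (\<lambda>t. norm (\<gamma>' t))"
    unfolding int[symmetric]
    using cont'(1) cont'' by (intro integral_norm_bound_integral integrable_continuous_interval) auto
  moreover have "q - p \<le> norm (\<gamma> s2 - \<gamma> s1)"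
    using s(4) lip[of "\<gamma> s2" "\<gamma> s1"] by linarith
  ultimately have "sqrt (2 * m) * (q - p) \<le> sqrt (2 * m) * integral {s1..s2} (\<lambda>t. norm (\<gamma>' t))"
    using \<open>m > 0\<close> by (intro mult_left_mono) auto
  also have "\<dots> = integral {s1..s2} (\<lambda>t. sqrt (2 * m) * norm (\<gamma>' t))"
    by simp
  also have "\<dots> \<le> integral {s1..s2} e"
  proof (intro integral_le integrable_continuous_interval continuous_on_mult_left cont' cont'')
    fix x assume x: "x \<in> {s1..s2}"
    \<comment> \<open>Completing the square removes \<open>\<epsilon>\<close> from the lower bound:
      kinetic plus potential energy is at least \<open>sqrt (2 * m)\<close> times speed.\<close>
    have "0 \<le> (\<epsilon> * norm (\<gamma>' x) - sqrt (2 * m))\<^sup>2 / (2 * \<epsilon>)"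
      using \<open>\<epsilon> > 0\<close> by simp
    also have "\<dots> = \<epsilon> * (norm (\<gamma>' x))\<^sup>2 / 2 + m / \<epsilon> - sqrt (2 * m) * norm (\<gamma>' x)"
      using \<open>\<epsilon> > 0\<close> \<open>m > 0\<close> by (simp add: power2_diff field_simps power2_eq_square)
    also have "m / \<epsilon> \<le> V (\<gamma> x) / \<epsilon>"
      using V(2) s(5)[OF x] \<open>\<epsilon> > 0\<close> by (simp add: divide_right_mono)
    finally show "sqrt (2 * m) * norm (\<gamma>' x) \<le> e x"
      by (simp add: e_def)
  qed
  also have "\<dots> \<le> integral {a..b} e"
  proof (intro integral_subset_le sub integrable_continuous_interval conte cont' ballI)
    show "0 \<le> e x" for x
      using \<open>\<epsilon> > 0\<close> V(1) by (simp add: e_def)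
  qed
  finally show False
    using energy by (simp add: e_def)
qed

section \<open>Potentials and the logarithmic cutoff\<close>

lemma has_real_derivative_inner:
  assumes "(f has_vector_derivative f') (at t)" "(g has_vector_derivative g') (at t)"
  shows "((\<lambda>t. f t \<bullet> g t :: real) has_real_derivative (f t \<bullet> g' + f' \<bullet> g t)) (at t)"
  using bounded_bilinear.has_vector_derivative[OF bounded_bilinear_inner assms]
  by (simp add: has_real_derivative_iff_has_vector_derivative)

text \<open>Squaring the positive part makes it continuously differentiable; this is why
  \<open>log_cutoff\<close> is a square.\<close>

lemma has_real_derivative_power2_pos_part:
  "((\<lambda>x::real. (max 0 x)\<^sup>2) has_real_derivative 2 * max 0 x) (at x)"
proof -
  consider "x > 0" | "x < 0" | "x = 0" by linarith
  then show ?thesis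
  proof cases
    case 1
    have "((\<lambda>x::real. x\<^sup>2) has_real_derivative 2 * max 0 x) (at x)"
      using 1 by (auto intro!: derivative_eq_intros)
    then show ?thesis
      by (rule has_field_derivative_transform_within_open[where S="{0<..}"]) (use 1 in auto)
  next
    case 2
    have "((\<lambda>x::real. 0) has_real_derivative 2 * max 0 x) (at x)"
      using 2 by (auto intro!: derivative_eq_intros)
    then show ?thesis
      by (rule has_field_derivative_transform_within_open[where S="{..<0}"]) (use 2 in auto)
  next
    case 3
    have "((\<lambda>h::real. (max 0 h)\<^sup>2 / h) \<longlongrightarrow> 0) (at 0)"
    proof (rule tendsto_0_le[where K=1])
      show "((\<lambda>h::real. h) \<longlongrightarrow> 0) (at 0)" by (rule tendsto_ident_at)
      show "\<forall>\<^sub>F h::real in at 0. norm ((max 0 h)\<^sup>2 / h) \<le> norm h * 1"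
        by (rule always_eventually) (auto simp: max_def power2_eq_square)
    qed
    then show ?thesis
      using 3 by (simp add: DERIV_def)
  qed
qed

text \<open>What the argument uses of a multiwell potential, free of coordinates: \<open>G\<close>
  is the gradient and \<open>W\<close> the zero set. \<open>well\<close> is the form in which the
  Hessian condition enters: it lets the tested term \<open>G y \<bullet> (y - \<sigma>)\<close>
  dominate \<open>V\<close>. The factor 2 in \<open>separated\<close> makes the balls of radius
  \<open>\<kappa>0\<close> disjoint, so a value close to some well determines that well.\<close>

locale potential =
  fixes V :: "'a::euclidean_space \<Rightarrow> real" and G :: "'a \<Rightarrow> 'a" and W :: "'a set" and \<kappa>0 R0 :: real
  assumes V_nonneg: "V y \<ge> 0"
    and V_zero: "V y = 0 \<longleftrightarrow> y \<in> W"
    and finite_W: "finite W"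
    and deriv_V: "(V has_derivative (\<lambda>h. G y \<bullet> h)) (at y)"
    and cont_G: "continuous_on UNIV G"
    and coercive: "filterlim V at_top at_infinity"
    and \<kappa>0_pos: "\<kappa>0 > 0"
    and well: "\<sigma> \<in> W \<Longrightarrow> norm (y - \<sigma>) \<le> \<kappa>0 \<Longrightarrow> V y \<le> G y \<bullet> (y - \<sigma>)"
    and separated: "\<sigma> \<in> W \<Longrightarrow> \<sigma>' \<in> W \<Longrightarrow> \<sigma> \<noteq> \<sigma>' \<Longrightarrow> norm (\<sigma> - \<sigma>') > 2 * \<kappa>0"
    and R0_pos: "R0 > 0"
    and outward: "norm y \<ge> R0 \<Longrightarrow> y \<bullet> G y > 0"
    and wells_inside: "\<sigma> \<in> W \<Longrightarrow> norm \<sigma> < R0"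
begin

lemma cont_V: "continuous_on S V"
  using deriv_V has_derivative_continuous continuous_at_imp_continuous_on by blast

text \<open>Coercivity gives \<open>V \<ge> 1\<close> outside a ball; inside it compactness gives a
  positive minimum.\<close>

lemma positive_lower_bound:
  assumes "closed S" "\<And>y. y \<in> S \<Longrightarrow> V y > 0"
  shows "\<exists>m>0. \<forall>y\<in>S. V y \<ge> m"
proof -
  obtain B where B: "\<And>y. norm y \<ge> B \<Longrightarrow> V y \<ge> 1"
    using coercive unfolding filterlim_at_top eventually_at_infinity by blast
  show ?thesis
  proof (cases "S \<inter> cball 0 B = {}")
    case True
    then have "V y \<ge> 1" if "y \<in> S" for y
      using that by (intro B) (force simp: not_less)
    then show ?thesis by (intro exI[of _ 1]) auto
  next
    case False
    have "compact (S \<inter> cball 0 B)"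
      using assms(1) by (intro closed_Int_compact) auto
    then obtain z where z: "z \<in> S \<inter> cball 0 B" "\<And>y. y \<in> S \<inter> cball 0 B \<Longrightarrow> V z \<le> V y"
      using continuous_attains_inf[OF _ False cont_V] by blast
    have "min 1 (V z) \<le> V y" if "y \<in> S" for y
      using z(2)[of y] B[of y] that by (cases "norm y \<le> B") auto
    then show ?thesis
      using z(1) assms(2) by (intro exI[of _ "min 1 (V z)"]) auto
  qed
qed

lemma lower_bound_off_wells:
  assumes "\<kappa> > 0"
  obtains m where "m > 0" "\<And>y. (\<And>\<sigma>. \<sigma> \<in> W \<Longrightarrow> norm (y - \<sigma>) \<ge> \<kappa>) \<Longrightarrow> V y \<ge> m"
proof -
  have "closed (\<Inter>\<sigma>\<in>W. {y. \<kappa> \<le> norm (y - \<sigma>)})"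
    by (intro closed_INT ballI closed_Collect_le continuous_intros)
  moreover have "V y > 0" if "y \<in> (\<Inter>\<sigma>\<in>W. {y. \<kappa> \<le> norm (y - \<sigma>)})" for y
    using that V_zero[of y] V_nonneg[of y] assms by fastforce
  ultimately obtain m where "m > 0" "\<forall>y\<in>(\<Inter>\<sigma>\<in>W. {y. \<kappa> \<le> norm (y - \<sigma>)}). V y \<ge> m"
    using positive_lower_bound by blast
  then show thesis
    by (intro that[of m]) auto
qed

lemma lower_bound_far:
  obtains m where "m > 0" "\<And>y. norm y \<ge> R0 \<Longrightarrow> V y \<ge> m"
proof -
  have "closed {y::'a. R0 \<le> norm y}"
    by (intro closed_Collect_le continuous_intros)
  moreover have "V y > 0" if "y \<in> {y. R0 \<le> norm y}" for y
    using that V_zero[of y] V_nonneg[of y] wells_inside by fastforce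
  ultimately obtain m where "m > 0" "\<forall>y\<in>{y. R0 \<le> norm y}. V y \<ge> m"
    using positive_lower_bound by blast
  then show thesis
    by (intro that[of m]) auto
qed

end

text \<open>The cutoff decays logarithmically between \<open>\<surd>t = \<kappa>\<close> and \<open>\<surd>t = \<kappa>0\<close>; this is what makes \<open>t |\<psi>' t|\<close> small.\<close>

definition log_cutoff :: "real \<Rightarrow> real \<Rightarrow> real \<Rightarrow> real" where
  "log_cutoff \<delta> \<kappa> t = (max 0 (1 - \<delta> * ln (1 + t / \<kappa>\<^sup>2)))\<^sup>2"

definition log_cutoff' :: "real \<Rightarrow> real \<Rightarrow> real \<Rightarrow> real" where
  "log_cutoff' \<delta> \<kappa> t = - (2 * \<delta> * max 0 (1 - \<delta> * ln (1 + t / \<kappa>\<^sup>2)) / (\<kappa>\<^sup>2 + t))"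

lemma log_cutoff_deriv:
  assumes "t \<ge> 0" "\<kappa> > 0"
  shows "(log_cutoff \<delta> \<kappa> has_real_derivative log_cutoff' \<delta> \<kappa> t) (at t)"
proof -
  have pos: "1 + t / \<kappa>\<^sup>2 > 0" "\<kappa>\<^sup>2 + t > 0"
    using assms by (simp_all add: add_pos_nonneg)
  have "((\<lambda>t. 1 - \<delta> * ln (1 + t / \<kappa>\<^sup>2)) has_real_derivative - (\<delta> / (\<kappa>\<^sup>2 + t))) (at t)"
    using assms pos by (auto intro!: derivative_eq_intros simp: field_simps)
  from DERIV_chain2[OF has_real_derivative_power2_pos_part this]
  show ?thesis
    unfolding log_cutoff_def log_cutoff'_def by (simp add: algebra_simps)
qed

text \<open>For \<open>t \<le> \<kappa>\<^sup>2\<close> the logarithm is at most 1, so the base is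
  at least 1/2 because \<open>\<delta> \<le> 1/2\<close>, and its square at least 1/4. The last
  bound is \<open>t / (\<kappa>\<^sup>2 + t) \<le> 1\<close>: the derivative of the logarithm
  cancels the factor \<open>t\<close>.\<close>

lemma log_cutoff_bounds:
  assumes "t \<ge> 0" "\<kappa> > 0" "0 < \<delta>" "\<delta> \<le> 1/2"
  shows "0 \<le> log_cutoff \<delta> \<kappa> t" "log_cutoff \<delta> \<kappa> t \<le> 1"
    and "t \<le> \<kappa>\<^sup>2 \<Longrightarrow> 1 / 4 \<le> log_cutoff \<delta> \<kappa> t"
    and "0 \<ge> log_cutoff' \<delta> \<kappa> t" "t * log_cutoff' \<delta> \<kappa> t \<ge> - (2 * \<delta>)"
proof -
  have "ln (1 + t / \<kappa>\<^sup>2) \<ge> 0" using assms by simp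
  then have m: "max 0 (1 - \<delta> * ln (1 + t / \<kappa>\<^sup>2)) \<le> 1" "0 \<le> max 0 (1 - \<delta> * ln (1 + t / \<kappa>\<^sup>2))"
    using assms by auto
  show "0 \<le> log_cutoff \<delta> \<kappa> t" by (simp add: log_cutoff_def)
  show "log_cutoff \<delta> \<kappa> t \<le> 1"
    unfolding log_cutoff_def using m by (intro power_le_one)
  show "1 / 4 \<le> log_cutoff \<delta> \<kappa> t" if "t \<le> \<kappa>\<^sup>2"
  proof -
    have "t / \<kappa>\<^sup>2 \<le> 1" using that assms by simp
    moreover have "ln (1 + t / \<kappa>\<^sup>2) \<le> t / \<kappa>\<^sup>2"
      using assms by (intro ln_add_one_self_le_self) simp
    ultimately have "ln (1 + t / \<kappa>\<^sup>2) \<le> 1"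
      by linarith
    then have "\<delta> * ln (1 + t / \<kappa>\<^sup>2) \<le> 1/2 * 1"
      using assms \<open>ln (1 + t / \<kappa>\<^sup>2) \<ge> 0\<close> by (intro mult_mono) auto
    then have "(1/2)\<^sup>2 \<le> (max 0 (1 - \<delta> * ln (1 + t / \<kappa>\<^sup>2)))\<^sup>2"
      by (intro power_mono) auto
    then show ?thesis by (simp add: log_cutoff_def power2_eq_square)
  qed
  have pos: "\<kappa>\<^sup>2 + t > 0" using assms by (simp add: add_pos_nonneg)
  show "0 \<ge> log_cutoff' \<delta> \<kappa> t"
    unfolding log_cutoff'_def using m pos assms by (simp add: zero_le_divide_iff)
  have "t / (\<kappa>\<^sup>2 + t) \<le> 1" "t / (\<kappa>\<^sup>2 + t) \<ge> 0"
    using pos assms by auto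
  then have "(2 * \<delta>) * (max 0 (1 - \<delta> * ln (1 + t / \<kappa>\<^sup>2)) * (t / (\<kappa>\<^sup>2 + t))) \<le> (2 * \<delta>) * (1 * 1)"
    using m assms by (intro mult_left_mono mult_mono) auto
  then show "t * log_cutoff' \<delta> \<kappa> t \<ge> - (2 * \<delta>)"
    by (simp add: log_cutoff'_def mult_ac)
qed

text \<open>This explains the relation \<open>\<kappa>\<^sup>2 * (exp (1 / \<delta>) - 1) =
  \<kappa>0\<^sup>2\<close> imposed on the two radii: the cutoff then vanishes once the distance to
  the well reaches \<open>\<kappa>0\<close>, the limit of validity of \<open>well\<close>.\<close>

lemma log_cutoff_support:
  assumes "\<delta> > 0" "\<kappa> > 0" "\<kappa>\<^sup>2 * (exp (1 / \<delta>) - 1) \<le> t"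
  shows "log_cutoff \<delta> \<kappa> t = 0"
proof -
  have "exp (1 / \<delta>) \<le> 1 + t / \<kappa>\<^sup>2"
    using assms by (simp add: field_simps)
  then have "1 / \<delta> \<le> ln (1 + t / \<kappa>\<^sup>2)"
    by (meson exp_gt_zero less_le_trans ln_ge_iff)
  then have "1 \<le> \<delta> * ln (1 + t / \<kappa>\<^sup>2)"
    using assms by (simp add: field_simps)
  then show ?thesis
    by (simp add: log_cutoff_def)
qed

section \<open>Solutions on a square\<close>

text \<open>Derivatives are two-sided even at the edges, as for a map smooth on an open set
  containing the closed square, so calculus can be run up to the sides. \<open>U12\<close> serves as
  both mixed derivatives; the cancellation in the stress identity rests on this symmetry.\<close>

locale planar_solution = potential V G W \<kappa>0 R0
  for V :: "'a::euclidean_space \<Rightarrow> real" and G :: "'a \<Rightarrow> 'a" and W :: "'a set" and \<kappa>0 R0 :: real +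
  fixes \<epsilon> R :: real and U U1 U2 U11 U12 U22 :: "real \<times> real \<Rightarrow> 'a"
  assumes eps_pos: "\<epsilon> > 0" and R_pos: "R > 0"
    and U1: "a \<in> {-R..R} \<Longrightarrow> b \<in> {-R..R} \<Longrightarrow> ((\<lambda>t. U (t, b)) has_vector_derivative U1 (a, b)) (at a)"
    and U2: "a \<in> {-R..R} \<Longrightarrow> b \<in> {-R..R} \<Longrightarrow> ((\<lambda>t. U (a, t)) has_vector_derivative U2 (a, b)) (at b)"
    and U11: "a \<in> {-R..R} \<Longrightarrow> b \<in> {-R..R} \<Longrightarrow> ((\<lambda>t. U1 (t, b)) has_vector_derivative U11 (a, b)) (at a)"
    and U12: "a \<in> {-R..R} \<Longrightarrow> b \<in> {-R..R} \<Longrightarrow> ((\<lambda>t. U1 (a, t)) has_vector_derivative U12 (a, b)) (at b)"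
    and U21: "a \<in> {-R..R} \<Longrightarrow> b \<in> {-R..R} \<Longrightarrow> ((\<lambda>t. U2 (t, b)) has_vector_derivative U12 (a, b)) (at a)"
    and U22: "a \<in> {-R..R} \<Longrightarrow> b \<in> {-R..R} \<Longrightarrow> ((\<lambda>t. U2 (a, t)) has_vector_derivative U22 (a, b)) (at b)"
    and cont_U: "continuous_on (cbox (-R, -R) (R, R)) U"
    and cont_U1: "continuous_on (cbox (-R, -R) (R, R)) U1"
    and cont_U2: "continuous_on (cbox (-R, -R) (R, R)) U2"
    and cont_U11: "continuous_on (cbox (-R, -R) (R, R)) U11"
    and cont_U12: "continuous_on (cbox (-R, -R) (R, R)) U12"
    and cont_U22: "continuous_on (cbox (-R, -R) (R, R)) U22"
    and equation: "a \<in> {-R..R} \<Longrightarrow> b \<in> {-R..R} \<Longrightarrow> U11 (a, b) + U22 (a, b) = (1 / \<epsilon>\<^sup>2) *\<^sub>R G (U (a, b))"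
begin

section \<open>Energy of lines and reflection in the diagonal\<close>

definition e :: "real \<times> real \<Rightarrow> real" where
  "e p = \<epsilon> * ((norm (U1 p))\<^sup>2 + (norm (U2 p))\<^sup>2) / 2 + V (U p) / \<epsilon>"

text \<open>The full density is integrated, with both partial derivatives. So \<open>h1 a\<close>
  dominates the one-dimensional energy of the curve \<open>U (a, _)\<close> and also the fluxes
  through the line.\<close>

definition h1 :: "real \<Rightarrow> real" where
  "h1 a = integral {-R..R} (\<lambda>b. e (a, b))"

definition h2 :: "real \<Rightarrow> real" where
  "h2 b = integral {-R..R} (\<lambda>a. e (a, b))"

lemma e_nonneg: "e p \<ge> 0"
  using eps_pos V_nonneg by (simp add: e_def)

lemma cont_VU: "continuous_on (cbox (-R, -R) (R, R)) (\<lambda>p. V (U p))"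
  by (rule continuous_on_compose2[OF cont_V[of UNIV] cont_U]) auto

lemma cont_GU: "continuous_on (cbox (-R, -R) (R, R)) (\<lambda>p. G (U p))"
  by (rule continuous_on_compose2[OF cont_G cont_U]) auto

lemma cont_e: "continuous_on (cbox (-R, -R) (R, R)) e"
  unfolding e_def using eps_pos
  by (intro continuous_intros cont_U1 cont_U2 cont_VU) auto

text \<open>Statements are proved for vertical lines and carried over to horizontal ones through
  this reflected solution; the pure second derivatives trade places and \<open>U12\<close>
  stays.\<close>

lemma swapped:
  "planar_solution V G W \<kappa>0 R0 \<epsilon> R (\<lambda>p. U (prod.swap p)) (\<lambda>p. U2 (prod.swap p)) (\<lambda>p. U1 (prod.swap p))
    (\<lambda>p. U22 (prod.swap p)) (\<lambda>p. U12 (prod.swap p)) (\<lambda>p. U11 (prod.swap p))"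
proof -
  have [continuous_intros]: "continuous_on S prod.swap" for S :: "(real \<times> real) set"
    by (rule continuous_on_swap)
  have sub: "prod.swap ` cbox (-R, -R) (R, R) \<subseteq> cbox (-R, -R) (R, R)"
    by (auto simp: cbox_Pair_eq)
  note c = continuous_on_compose2[OF _ continuous_on_swap sub]
  show ?thesis
    by unfold_locales
      (auto intro: c cont_U cont_U1 cont_U2 cont_U11 cont_U12 cont_U22 U1 U2 U11 U12 U21 U22 eps_pos R_pos
        simp: equation add.commute)
qed

lemma integrable_subrectangle:
  fixes f :: "real \<times> real \<Rightarrow> 'b::banach"
  assumes "-R \<le> a0" "a1 \<le> R" "-R \<le> b0" "b1 \<le> R" "continuous_on (cbox (-R, -R) (R, R)) f"
  shows "f integrable_on cbox (a0, b0) (a1, b1)" "continuous_on (cbox (a0, b0) (a1, b1)) f"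
proof -
  show "continuous_on (cbox (a0, b0) (a1, b1)) f"
    using assms by (intro continuous_on_subset[OF assms(5)]) (auto simp: cbox_Pair_eq)
  then show "f integrable_on cbox (a0, b0) (a1, b1)"
    by (rule integrable_continuous)
qed

lemma cont_slice1:
  assumes "a \<in> {-R..R}" "-R \<le> b0" "b1 \<le> R" "continuous_on (cbox (-R, -R) (R, R)) f"
  shows "continuous_on {b0..b1} (\<lambda>b. f (a, b))"
  using assms by (intro continuous_on_compose2[OF assms(4)] continuous_intros) (auto simp: cbox_Pair_eq)

lemma cont_slice2:
  assumes "b \<in> {-R..R}" "-R \<le> a0" "a1 \<le> R" "continuous_on (cbox (-R, -R) (R, R)) f"
  shows "continuous_on {a0..a1} (\<lambda>a. f (a, b))"
  using assms by (intro continuous_on_compose2[OF assms(4)] continuous_intros) (auto simp: cbox_Pair_eq)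

lemma h1_ge:
  assumes "a \<in> {-R..R}" "-R \<le> b0" "b1 \<le> R"
  shows "integral {b0..b1} (\<lambda>b. e (a, b)) \<le> h1 a"
  unfolding h1_def using assms
  by (intro integral_subset_le integrable_continuous_interval cont_slice1 cont_e) (auto simp: e_nonneg)

lemma h2_ge:
  assumes "b \<in> {-R..R}" "-R \<le> a0" "a1 \<le> R"
  shows "integral {a0..a1} (\<lambda>a. e (a, b)) \<le> h2 b"
  unfolding h2_def using assms
  by (intro integral_subset_le integrable_continuous_interval cont_slice2 cont_e) (auto simp: e_nonneg)

text \<open>The flux of the test field is bounded by a multiple of \<open>1 + e\<close>, that of the
  stress by \<open>e\<close>: the cases \<open>d = 1\<close> and \<open>d = 0\<close>.\<close>

lemma integral_vertical_side_bound:
  assumes "a \<in> {-R..R}" "-R \<le> b0" "b0 \<le> b1" "b1 \<le> R" "continuous_on {b0..b1} f"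
    "\<And>b. b \<in> {b0..b1} \<Longrightarrow> \<bar>f b\<bar> \<le> c * (d + e (a, b))" "c \<ge> 0" "d \<ge> 0"
  shows "\<bar>integral {b0..b1} f\<bar> \<le> c * (2 * R * d + h1 a)"
proof -
  have ce: "continuous_on {b0..b1} (\<lambda>b. e (a, b))"
    using assms by (intro cont_slice1 cont_e) auto
  have "\<bar>integral {b0..b1} f\<bar> \<le> integral {b0..b1} (\<lambda>b. c * (d + e (a, b)))"
    using assms unfolding real_norm_def[symmetric]
    by (intro integral_norm_bound_integral integrable_continuous_interval continuous_intros ce) auto
  also have "\<dots> = c * (d * (b1 - b0) + integral {b0..b1} (\<lambda>b. e (a, b)))"
    using assms integral_add[of "\<lambda>_. d" "{b0..b1}", OF _ integrable_continuous_interval[OF ce]]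
    by (simp add: integrable_const_ivl)
  also have "\<dots> \<le> c * (d * (2 * R) + h1 a)"
    using assms h1_ge[of a b0 b1] by (intro mult_left_mono add_mono) auto
  finally show ?thesis by (simp add: mult_ac)
qed

lemma integral_horizontal_side_bound:
  assumes "b \<in> {-R..R}" "-R \<le> a0" "a0 \<le> a1" "a1 \<le> R" "continuous_on {a0..a1} f"
    "\<And>a. a \<in> {a0..a1} \<Longrightarrow> \<bar>f a\<bar> \<le> c * (d + e (a, b))" "c \<ge> 0" "d \<ge> 0"
  shows "\<bar>integral {a0..a1} f\<bar> \<le> c * (2 * R * d + h2 b)"
proof -
  have ce: "continuous_on {a0..a1} (\<lambda>a. e (a, b))"
    using assms by (intro cont_slice2 cont_e) auto
  have "\<bar>integral {a0..a1} f\<bar> \<le> integral {a0..a1} (\<lambda>a. c * (d + e (a, b)))"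
    using assms unfolding real_norm_def[symmetric]
    by (intro integral_norm_bound_integral integrable_continuous_interval continuous_intros ce) auto
  also have "\<dots> = c * (d * (a1 - a0) + integral {a0..a1} (\<lambda>a. e (a, b)))"
    using assms integral_add[of "\<lambda>_. d" "{a0..a1}", OF _ integrable_continuous_interval[OF ce]]
    by (simp add: integrable_const_ivl)
  also have "\<dots> \<le> c * (d * (2 * R) + h2 b)"
    using assms h2_ge[of b a0 a1] by (intro mult_left_mono add_mono) auto
  finally show ?thesis by (simp add: mult_ac)
qed

lemma deriv_VU:
  assumes "(f has_vector_derivative f') (at t)"
  shows "((\<lambda>t. V (f t)) has_real_derivative G (f t) \<bullet> f') (at t)"
proof -
  have "((\<lambda>t. V (f t)) has_derivative (\<lambda>x. G (f t) \<bullet> (x *\<^sub>R f'))) (at t)"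
    using has_derivative_compose[OF assms[unfolded has_vector_derivative_def] deriv_V] by simp
  then show ?thesis
    by (simp add: has_field_derivative_def mult_commute_abs)
qed

text \<open>Testing the equation with \<open>\<psi> (|U - \<sigma>|\<^sup>2) (U - \<sigma>)\<close>.\<close>

lemma well_estimate:
  assumes "\<sigma> \<in> W" "0 < \<delta>" "\<delta> \<le> 1/2" "\<kappa> > 0" and \<kappa>: "\<kappa>\<^sup>2 * (exp (1 / \<delta>) - 1) = \<kappa>0\<^sup>2"
    and Q: "-R \<le> a0" "a0 \<le> a1" "a1 \<le> R" "-R \<le> b0" "b0 \<le> b1" "b1 \<le> R"
  shows "integral (cbox (a0, b0) (a1, b1)) (\<lambda>p. log_cutoff \<delta> \<kappa> ((norm (U p - \<sigma>))\<^sup>2) * e p)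
    \<le> 8 * \<delta> * integral (cbox (a0, b0) (a1, b1)) e
      + \<kappa>0 * sqrt \<epsilon> * (h1 a0 + h1 a1 + h2 b0 + h2 b1 + 8 * R)"
proof -
  define N where "N p = (U p - \<sigma>) \<bullet> (U p - \<sigma>)" for p
  define \<psi> where "\<psi> p = log_cutoff \<delta> \<kappa> (N p)" for p
  define \<psi>' where "\<psi>' p = log_cutoff' \<delta> \<kappa> (N p)" for p
  define F where "F p = \<epsilon> * (\<psi> p * ((U p - \<sigma>) \<bullet> U1 p))" for p
  define H where "H p = \<epsilon> * (\<psi> p * ((U p - \<sigma>) \<bullet> U2 p))" for p
  define F1 where "F1 p = \<epsilon> * (\<psi> p * ((U p - \<sigma>) \<bullet> U11 p + U1 p \<bullet> U1 p)
      + \<psi>' p * (2 * ((U p - \<sigma>) \<bullet> U1 p)) * ((U p - \<sigma>) \<bullet> U1 p))" for p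
  define H2 where "H2 p = \<epsilon> * (\<psi> p * ((U p - \<sigma>) \<bullet> U22 p + U2 p \<bullet> U2 p)
      + \<psi>' p * (2 * ((U p - \<sigma>) \<bullet> U2 p)) * ((U p - \<sigma>) \<bullet> U2 p))" for p
  have N: "N p \<ge> 0" for p by (simp add: N_def)
  have cont_N: "continuous_on (cbox (-R, -R) (R, R)) N"
    unfolding N_def by (intro continuous_intros cont_U)
  have nz: "1 + N p / \<kappa>\<^sup>2 \<noteq> 0" "\<kappa>\<^sup>2 + N p \<noteq> 0" for p
    using N[of p] \<open>\<kappa> > 0\<close> by (simp_all add: add_pos_nonneg less_imp_neq[symmetric])
  have cont_\<psi>: "continuous_on (cbox (-R, -R) (R, R)) \<psi>"
    unfolding \<psi>_def log_cutoff_def using nz \<open>\<kappa> > 0\<close>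
    by (intro continuous_intros cont_N) auto
  have cont_\<psi>': "continuous_on (cbox (-R, -R) (R, R)) \<psi>'"
    unfolding \<psi>'_def log_cutoff'_def using nz \<open>\<kappa> > 0\<close>
    by (intro continuous_intros cont_N) auto
  have cont_F: "continuous_on (cbox (-R, -R) (R, R)) F" "continuous_on (cbox (-R, -R) (R, R)) H"
    unfolding F_def H_def by (intro continuous_intros cont_\<psi> cont_U cont_U1 cont_U2)+
  have cont_F1: "continuous_on (cbox (-R, -R) (R, R)) F1" "continuous_on (cbox (-R, -R) (R, R)) H2"
    unfolding F1_def H2_def
    by (intro continuous_intros cont_\<psi> cont_\<psi>' cont_U cont_U1 cont_U2 cont_U11 cont_U22)+
  have div: "integral (cbox (a0, b0) (a1, b1)) (\<lambda>p. F1 p + H2 p) =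
    integral {b0..b1} (\<lambda>b. F (a1, b) - F (a0, b)) + integral {a0..a1} (\<lambda>a. H (a, b1) - H (a, b0))"
  proof (rule integral_divergence_rectangle)
    have gen: "((\<lambda>t. \<epsilon> * (log_cutoff \<delta> \<kappa> ((u t - \<sigma>) \<bullet> (u t - \<sigma>)) * ((u t - \<sigma>) \<bullet> u1 t))) has_vector_derivative
        \<epsilon> * (log_cutoff \<delta> \<kappa> ((u t - \<sigma>) \<bullet> (u t - \<sigma>)) * ((u t - \<sigma>) \<bullet> u11 + u1 t \<bullet> u1 t)
          + log_cutoff' \<delta> \<kappa> ((u t - \<sigma>) \<bullet> (u t - \<sigma>)) * (2 * ((u t - \<sigma>) \<bullet> u1 t)) * ((u t - \<sigma>) \<bullet> u1 t))) (at t)"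
      if u: "(u has_vector_derivative u1 t) (at t)" and u1: "(u1 has_vector_derivative u11) (at t)" for u u1 u11 t
    proof -
      have d: "((\<lambda>t. u t - \<sigma>) has_vector_derivative u1 t) (at t)"
        using has_vector_derivative_diff[OF u has_vector_derivative_const] by simp
      have dN: "((\<lambda>t. (u t - \<sigma>) \<bullet> (u t - \<sigma>)) has_real_derivative 2 * ((u t - \<sigma>) \<bullet> u1 t)) (at t)"
        using has_real_derivative_inner[OF d d] by (simp add: inner_commute)
      note dpsi = DERIV_chain2[OF log_cutoff_deriv[OF inner_ge_zero \<open>\<kappa> > 0\<close>] dN]
      note dp = DERIV_mult[OF dpsi has_real_derivative_inner[OF d u1]]
      from DERIV_cmult[OF dp, of \<epsilon>] show ?thesis
        unfolding has_real_derivative_iff_has_vector_derivative[symmetric]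
        by (rule DERIV_cong) (simp add: algebra_simps)
    qed
    show "((\<lambda>t. F (t, b)) has_vector_derivative F1 (a, b)) (at a)" if "a \<in> {a0..a1}" "b \<in> {b0..b1}" for a b
      using gen[of "\<lambda>t. U (t, b)" "\<lambda>t. U1 (t, b)" a "U11 (a, b)"] U1[of a b] U11[of a b] that Q
      by (simp add: F_def F1_def \<psi>_def \<psi>'_def N_def)
    show "((\<lambda>t. H (a, t)) has_vector_derivative H2 (a, b)) (at b)" if "a \<in> {a0..a1}" "b \<in> {b0..b1}" for a b
      using gen[of "\<lambda>t. U (a, t)" "\<lambda>t. U2 (a, t)" b "U22 (a, b)"] U2[of a b] U22[of a b] that Q
      by (simp add: H_def H2_def \<psi>_def \<psi>'_def N_def)
  qed (use Q cont_F1 integrable_subrectangle in auto)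
  \<comment> \<open>By the equation the divergence is \<open>\<psi> (G U \<bullet> (U - \<sigma>) /
    \<epsilon> + \<epsilon> |\<nabla>U|\<^sup>2)\<close> plus a term with \<open>\<psi>'\<close>.
    The first part dominates \<open>\<psi> e\<close> by \<open>well\<close>; the second is
    nonpositive, and Cauchy-Schwarz with the bound on \<open>t * log_cutoff'\<close> keeps it above
    \<open>- 8 * \<delta> * e\<close>.\<close>
  have lower: "\<psi> p * e p - 8 * \<delta> * e p \<le> F1 p + H2 p" if "p \<in> cbox (a0, b0) (a1, b1)" for p
  proof -
    obtain a b where [simp]: "p = (a, b)" by (cases p)
    have ab: "a \<in> {-R..R}" "b \<in> {-R..R}"
      using that Q by (auto simp: cbox_Pair_eq)
    define q where "q = (norm (U1 p))\<^sup>2 + (norm (U2 p))\<^sup>2"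
    define z where "z = ((U p - \<sigma>) \<bullet> U1 p)\<^sup>2 + ((U p - \<sigma>) \<bullet> U2 p)\<^sup>2"
    note b = log_cutoff_bounds[OF N \<open>\<kappa> > 0\<close> \<open>0 < \<delta>\<close> \<open>\<delta> \<le> 1/2\<close>, of p, folded \<psi>_def \<psi>'_def]
    have z: "z \<le> N p * q"
      using Cauchy_Schwarz_ineq[of "U p - \<sigma>" "U1 p"] Cauchy_Schwarz_ineq[of "U p - \<sigma>" "U2 p"]
      by (simp add: z_def q_def N_def power2_norm_eq_inner algebra_simps)
    have "q \<ge> 0" by (simp add: q_def)
    have "\<psi>' p * (N p * q) \<le> \<psi>' p * z"
      using z b(4) by (rule mult_left_mono_neg)
    moreover have "- (2 * \<delta>) * q \<le> (N p * \<psi>' p) * q"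
      using b(5) \<open>q \<ge> 0\<close> by (rule mult_right_mono)
    ultimately have "- (2 * \<delta> * q) \<le> \<psi>' p * z"
      by (simp add: mult_ac)
    then have 1: "2 * \<epsilon> * (- (2 * \<delta> * q)) \<le> 2 * \<epsilon> * (\<psi>' p * z)"
      using eps_pos by (intro mult_left_mono) auto
    have 2: "\<psi> p * V (U p) \<le> \<psi> p * (G (U p) \<bullet> (U p - \<sigma>))"
    proof (cases "norm (U p - \<sigma>) \<le> \<kappa>0")
      case True
      then show ?thesis
        using well[OF \<open>\<sigma> \<in> W\<close> True] b(1) by (rule_tac mult_left_mono)
    next
      case False
      then have "\<kappa>0\<^sup>2 \<le> N p"
        using \<kappa>0_pos by (auto simp: N_def power2_norm_eq_inner[symmetric] intro!: power_mono)
      then have "\<psi> p = 0"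
        unfolding \<psi>_def using \<kappa> \<open>0 < \<delta>\<close> \<open>\<kappa> > 0\<close> by (intro log_cutoff_support) auto
      then show ?thesis by simp
    qed
    have "F1 p + H2 p = \<psi> p * (\<epsilon> * ((U p - \<sigma>) \<bullet> (U11 p + U22 p))) + \<epsilon> * \<psi> p * q + 2 * \<epsilon> * (\<psi>' p * z)"
      unfolding F1_def H2_def z_def q_def
      by (simp only: power2_norm_eq_inner) (simp add: inner_add_right algebra_simps power2_eq_square)
    also have "\<epsilon> * ((U p - \<sigma>) \<bullet> (U11 p + U22 p)) = (G (U p) \<bullet> (U p - \<sigma>)) / \<epsilon>"
      using equation[OF ab] eps_pos by (simp add: inner_commute power2_eq_square)
    finally have eq: "F1 p + H2 p = \<psi> p * (G (U p) \<bullet> (U p - \<sigma>)) / \<epsilon> + \<epsilon> * \<psi> p * q + 2 * \<epsilon> * (\<psi>' p * z)"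
      by simp
    have 3: "\<psi> p * (G (U p) \<bullet> (U p - \<sigma>)) / \<epsilon> \<ge> \<psi> p * V (U p) / \<epsilon>"
      using 2 eps_pos by (intro divide_right_mono) auto
    have 4: "\<epsilon> * q \<le> 2 * e p" "0 \<le> \<epsilon> * q"
      using V_nonneg[of "U p"] eps_pos \<open>q \<ge> 0\<close> by (simp_all add: e_def q_def)
    have "2 * \<epsilon> * (2 * \<delta> * q) = 4 * \<delta> * (\<epsilon> * q)" by simp
    also have "\<dots> \<le> 4 * \<delta> * (2 * e p)"
      using 4 \<open>0 < \<delta>\<close> by (intro mult_left_mono) auto
    finally have 5: "2 * \<epsilon> * (- (2 * \<delta> * q)) \<ge> - (8 * \<delta> * e p)"
      by simp
    have "\<psi> p * e p = \<psi> p * (\<epsilon> * q) / 2 + \<psi> p * V (U p) / \<epsilon>"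
      by (simp add: e_def q_def algebra_simps)
    moreover have "\<psi> p * (\<epsilon> * q) / 2 \<le> \<epsilon> * \<psi> p * q"
      using mult_nonneg_nonneg[OF b(1) 4(2)] by (simp add: mult_ac)
    ultimately show ?thesis
      using eq 1 3 5 by linarith
  qed
  \<comment> \<open>Young's inequality weighted so that \<open>sqrt \<epsilon>\<close> comes out in
    front: the boundary flux has one derivative against a full \<open>\<epsilon>\<close>, and on
    sides of bounded energy it tends to 0.\<close>
  have sqrt: "\<epsilon> * x \<le> sqrt \<epsilon> * (1 + \<epsilon> * x\<^sup>2 / 2)" for x
  proof -
    have "0 \<le> (sqrt \<epsilon> * x - 1)\<^sup>2" by simp
    then have "2 * (sqrt \<epsilon> * x) \<le> 2 + \<epsilon> * x\<^sup>2"
      using eps_pos by (simp add: power2_diff power_mult_distrib)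
    then have "sqrt \<epsilon> * (sqrt \<epsilon> * x) \<le> sqrt \<epsilon> * (1 + \<epsilon> * x\<^sup>2 / 2)"
      using eps_pos by (intro mult_left_mono) auto
    then show ?thesis
      using eps_pos by (simp add: mult.assoc[symmetric])
  qed
  have bound: "\<bar>\<epsilon> * (\<psi> p * ((U p - \<sigma>) \<bullet> x))\<bar> \<le> \<kappa>0 * sqrt \<epsilon> * (1 + e p)"
    if x: "x = U1 p \<or> x = U2 p" for p x
  proof -
    note b = log_cutoff_bounds[OF N \<open>\<kappa> > 0\<close> \<open>0 < \<delta>\<close> \<open>\<delta> \<le> 1/2\<close>, of p, folded \<psi>_def \<psi>'_def]
    have "\<psi> p * norm (U p - \<sigma>) \<le> \<kappa>0"
    proof (cases "norm (U p - \<sigma>) \<le> \<kappa>0")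
      case True
      have "\<psi> p * norm (U p - \<sigma>) \<le> 1 * norm (U p - \<sigma>)"
        using b by (intro mult_right_mono) auto
      then show ?thesis using True by simp
    next
      case False
      then have "\<kappa>0\<^sup>2 \<le> N p"
        using \<kappa>0_pos by (auto simp: N_def power2_norm_eq_inner[symmetric] intro!: power_mono)
      then have "\<psi> p = 0"
        unfolding \<psi>_def using \<kappa> \<open>0 < \<delta>\<close> \<open>\<kappa> > 0\<close> by (intro log_cutoff_support) auto
      then show ?thesis using \<kappa>0_pos by simp
    qed
    then have "\<psi> p * norm (U p - \<sigma>) * (\<epsilon> * norm x) \<le> \<kappa>0 * (\<epsilon> * norm x)"
      using eps_pos by (intro mult_right_mono) auto
    moreover have "\<bar>\<epsilon> * (\<psi> p * ((U p - \<sigma>) \<bullet> x))\<bar> \<le> \<epsilon> * (\<psi> p * (norm (U p - \<sigma>) * norm x))"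
      using b(1) eps_pos Cauchy_Schwarz_ineq2[of "U p - \<sigma>" x]
      by (simp add: abs_mult mult_left_mono)
    moreover have "\<kappa>0 * (\<epsilon> * norm x) \<le> \<kappa>0 * (sqrt \<epsilon> * (1 + e p))"
    proof (rule mult_left_mono)
      have "\<epsilon> * (norm x)\<^sup>2 / 2 \<le> e p"
        using x eps_pos V_nonneg[of "U p"] by (auto simp: e_def divide_right_mono add_increasing2)
      then have "sqrt \<epsilon> * (1 + \<epsilon> * (norm x)\<^sup>2 / 2) \<le> sqrt \<epsilon> * (1 + e p)"
        using eps_pos by (intro mult_left_mono) auto
      then show "\<epsilon> * norm x \<le> sqrt \<epsilon> * (1 + e p)"
        using sqrt[of "norm x"] by linarith
    qed (use \<kappa>0_pos in auto)
    ultimately show ?thesis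
      by (simp add: mult_ac)
  qed
  have c0: "\<kappa>0 * sqrt \<epsilon> \<ge> 0" using \<kappa>0_pos eps_pos by simp
  have s1: "\<bar>integral {b0..b1} (\<lambda>b. F (a, b))\<bar> \<le> \<kappa>0 * sqrt \<epsilon> * (2 * R * 1 + h1 a)"
    if "a \<in> {a0..a1}" for a
    using that Q bound c0 by (intro integral_vertical_side_bound cont_slice1 cont_F) (auto simp: F_def)
  have s2: "\<bar>integral {a0..a1} (\<lambda>a. H (a, b))\<bar> \<le> \<kappa>0 * sqrt \<epsilon> * (2 * R * 1 + h2 b)"
    if "b \<in> {b0..b1}" for b
    using that Q bound c0 by (intro integral_horizontal_side_bound cont_slice2 cont_F) (auto simp: H_def)
  have i1: "(\<lambda>b. F (a, b)) integrable_on {b0..b1}" if "a \<in> {a0..a1}" for a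
    using that Q by (intro integrable_continuous_interval cont_slice1 cont_F) auto
  have i2: "(\<lambda>a. H (a, b)) integrable_on {a0..a1}" if "b \<in> {b0..b1}" for b
    using that Q by (intro integrable_continuous_interval cont_slice2 cont_F) auto
  have int: "(\<lambda>p. \<psi> p * e p) integrable_on cbox (a0, b0) (a1, b1)" "e integrable_on cbox (a0, b0) (a1, b1)"
    using Q by (auto intro!: integrable_subrectangle(1) continuous_on_mult cont_\<psi> cont_e)
  have "integral (cbox (a0, b0) (a1, b1)) (\<lambda>p. \<psi> p * e p) - 8 * \<delta> * integral (cbox (a0, b0) (a1, b1)) e
      = integral (cbox (a0, b0) (a1, b1)) (\<lambda>p. \<psi> p * e p - 8 * \<delta> * e p)"
    using integral_diff[OF int(1) integrable_cmul[OF int(2), of "8 * \<delta>"]] by simp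
  also have "\<dots> \<le> integral (cbox (a0, b0) (a1, b1)) (\<lambda>p. F1 p + H2 p)"
    using lower Q
    by (intro integral_le integrable_subrectangle(1) continuous_intros cont_\<psi> cont_e cont_F1) auto
  also have "\<dots> = integral {b0..b1} (\<lambda>b. F (a1, b)) - integral {b0..b1} (\<lambda>b. F (a0, b))
      + (integral {a0..a1} (\<lambda>a. H (a, b1)) - integral {a0..a1} (\<lambda>a. H (a, b0)))"
    unfolding div using i1[of a0] i1[of a1] i2[of b0] i2[of b1] Q by (simp add: integral_diff)
  also have "\<dots> \<le> \<kappa>0 * sqrt \<epsilon> * (2 * R * 1 + h1 a1) + \<kappa>0 * sqrt \<epsilon> * (2 * R * 1 + h1 a0)
      + (\<kappa>0 * sqrt \<epsilon> * (2 * R * 1 + h2 b1) + \<kappa>0 * sqrt \<epsilon> * (2 * R * 1 + h2 b0))"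
    using s1[of a0] s1[of a1] s2[of b0] s2[of b1] Q by auto
  also have "\<dots> = \<kappa>0 * sqrt \<epsilon> * (h1 a0 + h1 a1 + h2 b0 + h2 b1 + 8 * R)"
    by (simp add: algebra_simps)
  finally show ?thesis
    by (simp add: \<psi>_def N_def power2_norm_eq_inner)
qed

section \<open>Stress-energy tensor\<close>

text \<open>Diagonal entry of the tensor with entries
  \<open>\<epsilon> \<partial>i U \<bullet> \<partial>j U\<close>, minus \<open>e\<close> on the
  diagonal. The gradient terms of \<open>T11\<close> and \<open>T22\<close> cancel in the sum. The
  off-diagonal entry appears only as \<open>H\<close> in the proof of the flux bound.\<close>

definition T11 :: "real \<times> real \<Rightarrow> real" where
  "T11 p = \<epsilon> * ((norm (U1 p))\<^sup>2 - (norm (U2 p))\<^sup>2) / 2 - V (U p) / \<epsilon>"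

definition T22 :: "real \<times> real \<Rightarrow> real" where
  "T22 p = \<epsilon> * ((norm (U2 p))\<^sup>2 - (norm (U1 p))\<^sup>2) / 2 - V (U p) / \<epsilon>"

lemma cont_T11: "continuous_on (cbox (-R, -R) (R, R)) T11"
  unfolding T11_def using eps_pos
  by (intro continuous_intros cont_U1 cont_U2 cont_VU) auto

lemma cont_T22: "continuous_on (cbox (-R, -R) (R, R)) T22"
  unfolding T22_def using eps_pos
  by (intro continuous_intros cont_U1 cont_U2 cont_VU) auto

lemma T11_bound: "\<bar>T11 p\<bar> \<le> e p" and T22_bound: "\<bar>T22 p\<bar> \<le> e p"
proof -
  have *: "V (U p) / \<epsilon> \<ge> 0" "\<epsilon> * (norm (U1 p))\<^sup>2 \<ge> 0" "\<epsilon> * (norm (U2 p))\<^sup>2 \<ge> 0"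
    using V_nonneg eps_pos by auto
  have gen: "\<bar>(x - y) / 2 - z\<bar> \<le> (x + y) / 2 + z" "\<bar>(y - x) / 2 - z\<bar> \<le> (x + y) / 2 + z"
    if "0 \<le> z" "0 \<le> x" "0 \<le> y" for x y z :: real
    using that by (auto simp: abs_le_iff field_simps)
  show "\<bar>T11 p\<bar> \<le> e p" "\<bar>T22 p\<bar> \<le> e p"
    unfolding T11_def T22_def e_def distrib_left right_diff_distrib by (rule gen[OF *])+
qed

text \<open>The stress-energy tensor is divergence free, so the flux of its first row through a vertical
  segment is controlled by the three other sides.\<close>

lemma stress_slice1:
  assumes Q: "-R \<le> a0" "a1 \<le> R" "-R \<le> b0" "b0 \<le> b1" "b1 \<le> R" and a: "a \<in> {a0..a1}"
  shows "\<bar>integral {b0..b1} (\<lambda>b. T11 (a, b))\<bar> \<le> h1 a0 + h2 b0 + h2 b1"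
proof -
  define H where "H p = \<epsilon> * (U1 p \<bullet> U2 p)" for p
  define F1 where "F1 p = \<epsilon> * (U1 p \<bullet> U11 p - U2 p \<bullet> U12 p) - (G (U p) \<bullet> U1 p) / \<epsilon>" for p
  define H2 where "H2 p = \<epsilon> * (U1 p \<bullet> U22 p + U12 p \<bullet> U2 p)" for p
  have a': "-R \<le> a" "a \<le> R" "a0 \<le> a" using a Q by auto
  have cont_H: "continuous_on (cbox (-R, -R) (R, R)) H"
    unfolding H_def by (intro continuous_intros cont_U1 cont_U2)
  have cont_F1: "continuous_on (cbox (-R, -R) (R, R)) F1" "continuous_on (cbox (-R, -R) (R, R)) H2"
    unfolding F1_def H2_def using eps_pos
    by (intro continuous_intros cont_U1 cont_U2 cont_U11 cont_U12 cont_U22 cont_GU; simp)+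
  have "integral (cbox (a0, b0) (a, b1)) (\<lambda>p. F1 p + H2 p) =
    integral {b0..b1} (\<lambda>b. T11 (a, b) - T11 (a0, b)) + integral {a0..a} (\<lambda>a. H (a, b1) - H (a, b0))"
  proof (rule integral_divergence_rectangle)
    show "((\<lambda>t. T11 (t, d)) has_vector_derivative F1 (c, d)) (at c)" if "c \<in> {a0..a}" "d \<in> {b0..b1}" for c d
    proof -
      have cd: "c \<in> {-R..R}" "d \<in> {-R..R}" using that a' Q by auto
      have "((\<lambda>t. \<epsilon> * (U1 (t, d) \<bullet> U1 (t, d) - U2 (t, d) \<bullet> U2 (t, d)) / 2 - V (U (t, d)) / \<epsilon>)
          has_real_derivative \<epsilon> * ((U1 (c, d) \<bullet> U11 (c, d) + U11 (c, d) \<bullet> U1 (c, d))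
            - (U2 (c, d) \<bullet> U12 (c, d) + U12 (c, d) \<bullet> U2 (c, d))) / 2 - (G (U (c, d)) \<bullet> U1 (c, d)) / \<epsilon>) (at c)"
        by (intro DERIV_diff DERIV_cdivide DERIV_cmult has_real_derivative_inner[OF U11[OF cd] U11[OF cd]]
            has_real_derivative_inner[OF U21[OF cd] U21[OF cd]] deriv_VU[OF U1[OF cd]])
      then show ?thesis
        unfolding has_real_derivative_iff_has_vector_derivative[symmetric] T11_def F1_def power2_norm_eq_inner
        by (rule DERIV_cong) (simp add: inner_commute field_simps)
    qed
    show "((\<lambda>t. H (c, t)) has_vector_derivative H2 (c, d)) (at d)" if "c \<in> {a0..a}" "d \<in> {b0..b1}" for c d
    proof -
      have cd: "c \<in> {-R..R}" "d \<in> {-R..R}" using that a' Q by auto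
      show ?thesis
        unfolding has_real_derivative_iff_has_vector_derivative[symmetric] H_def H2_def
        by (intro DERIV_cmult has_real_derivative_inner U12[OF cd] U22[OF cd])
    qed
  qed (use Q a' cont_F1 integrable_subrectangle in auto)
  \<comment> \<open>The two terms with \<open>U12\<close> cancel; what remains is
    \<open>\<epsilon>\<close> times the equation paired with \<open>U1\<close>.\<close>
  also have "integral (cbox (a0, b0) (a, b1)) (\<lambda>p. F1 p + H2 p) = integral (cbox (a0, b0) (a, b1)) (\<lambda>p. 0)"
  proof (rule integral_cong)
    fix p assume "p \<in> cbox (a0, b0) (a, b1)"
    moreover obtain c d where [simp]: "p = (c, d)" by (cases p)
    ultimately have cd: "c \<in> {-R..R}" "d \<in> {-R..R}"
      using a' Q by (auto simp: cbox_Pair_eq)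
    have "F1 p + H2 p = \<epsilon> * (U1 p \<bullet> (U11 p + U22 p)) - (G (U p) \<bullet> U1 p) / \<epsilon>"
      by (simp add: F1_def H2_def inner_add_right inner_commute algebra_simps)
    also have "\<dots> = 0"
      using equation[OF cd] eps_pos by (simp add: inner_commute power2_eq_square)
    finally show "F1 p + H2 p = 0" .
  qed
  finally have "0 = integral {b0..b1} (\<lambda>b. T11 (a, b) - T11 (a0, b)) + integral {a0..a} (\<lambda>a. H (a, b1) - H (a, b0))"
    by simp
  also have "integral {b0..b1} (\<lambda>b. T11 (a, b) - T11 (a0, b)) =
      integral {b0..b1} (\<lambda>b. T11 (a, b)) - integral {b0..b1} (\<lambda>b. T11 (a0, b))"
    using a' Q by (intro integral_diff integrable_continuous_interval cont_slice1 cont_T11) auto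
  also have "integral {a0..a} (\<lambda>a. H (a, b1) - H (a, b0)) =
      integral {a0..a} (\<lambda>a. H (a, b1)) - integral {a0..a} (\<lambda>a. H (a, b0))"
    using a' Q by (intro integral_diff integrable_continuous_interval cont_slice2 cont_H) auto
  finally have eq: "integral {b0..b1} (\<lambda>b. T11 (a, b)) = integral {b0..b1} (\<lambda>b. T11 (a0, b))
      - integral {a0..a} (\<lambda>a. H (a, b1)) + integral {a0..a} (\<lambda>a. H (a, b0))"
    by simp
  have H_bound: "\<bar>H p\<bar> \<le> e p" for p
  proof -
    have "\<bar>U1 p \<bullet> U2 p\<bar> \<le> norm (U1 p) * norm (U2 p)"
      by (rule Cauchy_Schwarz_ineq2)
    also have "\<dots> \<le> ((norm (U1 p))\<^sup>2 + (norm (U2 p))\<^sup>2) / 2"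
      using sum_squares_bound[of "norm (U1 p)" "norm (U2 p)"] by simp
    finally have "\<epsilon> * \<bar>U1 p \<bullet> U2 p\<bar> \<le> \<epsilon> * (((norm (U1 p))\<^sup>2 + (norm (U2 p))\<^sup>2) / 2)"
      using eps_pos by (intro mult_left_mono) auto
    moreover have "0 \<le> V (U p) / \<epsilon>"
      using V_nonneg eps_pos by auto
    ultimately have "\<epsilon> * \<bar>U1 p \<bullet> U2 p\<bar> \<le> e p"
      unfolding e_def by linarith
    then show ?thesis
      using eps_pos by (simp add: H_def abs_mult)
  qed
  have "\<bar>integral {b0..b1} (\<lambda>b. T11 (a0, b))\<bar> \<le> 1 * (2 * R * 0 + h1 a0)"
    using a' Q T11_bound by (intro integral_vertical_side_bound cont_slice1 cont_T11) auto
  moreover have "\<bar>integral {a0..a} (\<lambda>a. H (a, b))\<bar> \<le> 1 * (2 * R * 0 + h2 b)" if "b \<in> {b0..b1}" for b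
    using a' Q H_bound that by (intro integral_horizontal_side_bound cont_slice2 cont_H) auto
  from this[of b0] this[of b1]
  have "\<bar>integral {a0..a} (\<lambda>a. H (a, b0))\<bar> \<le> h2 b0" "\<bar>integral {a0..a} (\<lambda>a. H (a, b1))\<bar> \<le> h2 b1"
    using Q by auto
  ultimately show ?thesis
    using eq by (simp add: abs_le_iff)
qed

lemma stress_slice2:
  assumes Q: "-R \<le> a0" "a0 \<le> a1" "a1 \<le> R" "-R \<le> b0" "b1 \<le> R" and b: "b \<in> {b0..b1}"
  shows "\<bar>integral {a0..a1} (\<lambda>a. T22 (a, b))\<bar> \<le> h2 b0 + h1 a0 + h1 a1"
proof -
  interpret s: planar_solution V G W \<kappa>0 R0 \<epsilon> R "\<lambda>p. U (prod.swap p)" "\<lambda>p. U2 (prod.swap p)"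
    "\<lambda>p. U1 (prod.swap p)" "\<lambda>p. U22 (prod.swap p)" "\<lambda>p. U12 (prod.swap p)" "\<lambda>p. U11 (prod.swap p)"
    by (rule swapped)
  have "s.e p = e (prod.swap p)" "s.T11 p = T22 (prod.swap p)" for p
    by (simp_all add: s.e_def e_def s.T11_def T22_def add.commute)
  then show ?thesis
    using s.stress_slice1[OF Q(4,5,1,2,3) b] by (simp add: s.h1_def s.h2_def h1_def h2_def)
qed

section \<open>Sup and gradient bounds for the solution\<close>

text \<open>\<open>|U|\<^sup>2\<close> has Laplacian \<open>2 |\<nabla>U|\<^sup>2 + 2 U \<bullet> G
  U / \<epsilon>\<^sup>2\<close>, positive wherever \<open>|U| > \<rho>\<close> by
  \<open>outward\<close>, so the maximum principle applies at level
  \<open>\<rho>\<^sup>2\<close>.\<close>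

lemma interior_sup_bound:
  assumes Q: "-R \<le> a0" "a1 \<le> R" "-R \<le> b0" "b1 \<le> R"
    and bdry: "\<And>a b. a \<in> {a0..a1} \<Longrightarrow> b \<in> {b0..b1} \<Longrightarrow> a = a0 \<or> a = a1 \<or> b = b0 \<or> b = b1 \<Longrightarrow>
      norm (U (a, b)) \<le> \<rho>"
    and "R0 \<le> \<rho>" and p: "p \<in> {a0..a1} \<times> {b0..b1}"
  shows "norm (U p) \<le> \<rho>"
proof -
  have \<rho>: "\<rho> > 0" using R0_pos \<open>R0 \<le> \<rho>\<close> by simp
  have "(\<lambda>p. U p \<bullet> U p) p \<le> \<rho>\<^sup>2"
  proof (rule max_principle_rectangle[where ?w1.0="\<lambda>p. U p \<bullet> U1 p + U1 p \<bullet> U p" and ?w2.0="\<lambda>p. U p \<bullet> U2 p + U2 p \<bullet> U p"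
        and ?w11.0="\<lambda>p. (U p \<bullet> U11 p + U1 p \<bullet> U1 p) + (U1 p \<bullet> U1 p + U11 p \<bullet> U p)"
        and ?w22.0="\<lambda>p. (U p \<bullet> U22 p + U2 p \<bullet> U2 p) + (U2 p \<bullet> U2 p + U22 p \<bullet> U p)"])
    show "continuous_on ({a0..a1} \<times> {b0..b1}) (\<lambda>p. U p \<bullet> U p)"
      using Q by (intro continuous_intros continuous_on_subset[OF cont_U]) (auto simp: cbox_Pair_eq)
    show "p \<in> {a0..a1} \<times> {b0..b1}" by (rule p)
  next
    fix a b assume "a \<in> {a0<..<a1}" "b \<in> {b0<..<b1}"
    then have ab: "a \<in> {-R..R}" "b \<in> {-R..R}" using Q by auto
    show "((\<lambda>t. U (t, b) \<bullet> U (t, b)) has_real_derivative U (a, b) \<bullet> U1 (a, b) + U1 (a, b) \<bullet> U (a, b)) (at a)"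
      by (rule has_real_derivative_inner[OF U1[OF ab] U1[OF ab]])
    show "((\<lambda>t. U (a, t) \<bullet> U (a, t)) has_real_derivative U (a, b) \<bullet> U2 (a, b) + U2 (a, b) \<bullet> U (a, b)) (at b)"
      by (rule has_real_derivative_inner[OF U2[OF ab] U2[OF ab]])
    show "((\<lambda>t. U (t, b) \<bullet> U1 (t, b) + U1 (t, b) \<bullet> U (t, b)) has_real_derivative
        (U (a, b) \<bullet> U11 (a, b) + U1 (a, b) \<bullet> U1 (a, b)) + (U1 (a, b) \<bullet> U1 (a, b) + U11 (a, b) \<bullet> U (a, b))) (at a)"
      by (intro DERIV_add has_real_derivative_inner[OF U1[OF ab] U11[OF ab]] has_real_derivative_inner[OF U11[OF ab] U1[OF ab]])
    show "((\<lambda>t. U (a, t) \<bullet> U2 (a, t) + U2 (a, t) \<bullet> U (a, t)) has_real_derivative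
        (U (a, b) \<bullet> U22 (a, b) + U2 (a, b) \<bullet> U2 (a, b)) + (U2 (a, b) \<bullet> U2 (a, b) + U22 (a, b) \<bullet> U (a, b))) (at b)"
      by (intro DERIV_add has_real_derivative_inner[OF U2[OF ab] U22[OF ab]] has_real_derivative_inner[OF U22[OF ab] U2[OF ab]])
    assume "\<rho>\<^sup>2 < U (a, b) \<bullet> U (a, b)"
    then have "\<rho> < norm (U (a, b))"
      by (metis norm_ge_zero power2_norm_eq_inner power_less_imp_less_base)
    then have "U (a, b) \<bullet> G (U (a, b)) > 0"
      using \<open>R0 \<le> \<rho>\<close> by (intro outward) auto
    then have "U (a, b) \<bullet> (U11 (a, b) + U22 (a, b)) > 0"
      using equation[OF ab] eps_pos by simp
    then have "U (a, b) \<bullet> U11 (a, b) + U (a, b) \<bullet> U22 (a, b) > 0"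
      by (simp add: inner_add_right)
    then show "0 < (U (a, b) \<bullet> U11 (a, b) + U1 (a, b) \<bullet> U1 (a, b)) + (U1 (a, b) \<bullet> U1 (a, b) + U11 (a, b) \<bullet> U (a, b))
        + ((U (a, b) \<bullet> U22 (a, b) + U2 (a, b) \<bullet> U2 (a, b)) + (U2 (a, b) \<bullet> U2 (a, b) + U22 (a, b) \<bullet> U (a, b)))"
      unfolding inner_commute[of "U11 (a, b)" "U (a, b)"] inner_commute[of "U22 (a, b)" "U (a, b)"]
      using inner_ge_zero[of "U1 (a, b)"] inner_ge_zero[of "U2 (a, b)"] by linarith
  next
    fix a b assume "a \<in> {a0..a1}" "b \<in> {b0..b1}" "a = a0 \<or> a = a1 \<or> b = b0 \<or> b = b1"
    from bdry[OF this] show "U (a, b) \<bullet> U (a, b) \<le> \<rho>\<^sup>2"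
      unfolding power2_norm_eq_inner[symmetric] by (intro power_mono) auto
  qed
  then show ?thesis
    using \<rho> by (metis less_imp_le norm_ge_zero power2_le_imp_le power2_norm_eq_inner)
qed

text \<open>Projecting on the direction \<open>n\<close> of \<open>U1 (a, b)\<close> reduces to a
  scalar function. On a square of half side \<open>\<epsilon>\<close> the equation bounds its
  Laplacian by \<open>L / \<epsilon>\<^sup>2\<close>, which is the scaling of the barrier estimate.
  When \<open>U1 (a, b)\<close> vanishes, \<open>sgn\<close> returns 0, which is harmless.\<close>

lemma gradient_bound1:
  assumes sub: "{a - \<epsilon>..a + \<epsilon>} \<subseteq> {-R..R}" "{b - \<epsilon>..b + \<epsilon>} \<subseteq> {-R..R}"
    and M: "\<And>s t. s \<in> {a - \<epsilon>..a + \<epsilon>} \<Longrightarrow> t \<in> {b - \<epsilon>..b + \<epsilon>} \<Longrightarrow> norm (U (s, t)) \<le> M"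
    and L: "\<And>y. norm y \<le> M \<Longrightarrow> norm (G y) \<le> L"
  shows "norm (U1 (a, b)) \<le> 3 * (2 * M + L + 1) / \<epsilon>"
proof -
  define n where "n = sgn (U1 (a, b))"
  have "norm n \<le> 1" by (simp add: n_def norm_sgn)
  then have n: "\<bar>n \<bullet> y\<bar> \<le> norm y" for y
    using Cauchy_Schwarz_ineq2[of n y] mult_right_mono[of "norm n" 1 "norm y"] by simp
  have d: "((\<lambda>t. n \<bullet> f t) has_real_derivative n \<bullet> f') (at t)" if "(f has_vector_derivative f') (at t)" for f f' t
    using has_real_derivative_inner[OF has_vector_derivative_const that] by simp
  have ab: "s \<in> {-R..R}" "t \<in> {-R..R}" if "s \<in> {a - \<epsilon>..a + \<epsilon>}" "t \<in> {b - \<epsilon>..b + \<epsilon>}" for s t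
    using that sub by blast+
  have "(\<lambda>p. n \<bullet> U1 p) (a, b) \<le> 3 * (2 * M + L + 1) / \<epsilon>"
  proof (rule brandt_gradient_bound[where v="\<lambda>p. n \<bullet> U p" and ?v2.0="\<lambda>p. n \<bullet> U2 p" and ?v11.0="\<lambda>p. n \<bullet> U11 p"
        and ?v22.0="\<lambda>p. n \<bullet> U22 p", OF eps_pos])
    show "continuous_on ({a - \<epsilon>..a + \<epsilon>} \<times> {b - \<epsilon>..b + \<epsilon>}) (\<lambda>p. n \<bullet> U p)"
    proof (intro continuous_intros continuous_on_subset[OF cont_U])
      show "{a - \<epsilon>..a + \<epsilon>} \<times> {b - \<epsilon>..b + \<epsilon>} \<subseteq> cbox (-R, -R) (R, R)"
        using sub by (auto simp: cbox_Pair_eq)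
    qed
  next
    fix s t assume st: "s \<in> {a - \<epsilon>..a + \<epsilon>}" "t \<in> {b - \<epsilon>..b + \<epsilon>}"
    note ab = ab[OF st]
    show "((\<lambda>s. n \<bullet> U (s, t)) has_real_derivative n \<bullet> U1 (s, t)) (at s)"
      by (rule d[OF U1[OF ab]])
    show "((\<lambda>s. n \<bullet> U1 (s, t)) has_real_derivative n \<bullet> U11 (s, t)) (at s)"
      by (rule d[OF U11[OF ab]])
    show "((\<lambda>t. n \<bullet> U (s, t)) has_real_derivative n \<bullet> U2 (s, t)) (at t)"
      by (rule d[OF U2[OF ab]])
    show "((\<lambda>t. n \<bullet> U2 (s, t)) has_real_derivative n \<bullet> U22 (s, t)) (at t)"
      by (rule d[OF U22[OF ab]])
    show "\<bar>n \<bullet> U (s, t)\<bar> \<le> M"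
      using n[of "U (s, t)"] M[OF st] by linarith
    have "n \<bullet> U11 (s, t) + n \<bullet> U22 (s, t) = (n \<bullet> G (U (s, t))) / \<epsilon>\<^sup>2"
      using equation[OF ab] by (simp add: inner_add_right[symmetric])
    also have "\<bar>\<dots>\<bar> \<le> L / \<epsilon>\<^sup>2"
      using n[of "G (U (s, t))"] L[OF M[OF st]] by (simp add: abs_divide divide_right_mono)
    finally show "\<bar>n \<bullet> U11 (s, t) + n \<bullet> U22 (s, t)\<bar> \<le> L / \<epsilon>\<^sup>2" .
  qed
  moreover have "n \<bullet> U1 (a, b) = norm (U1 (a, b))"
    by (cases "U1 (a, b) = 0") (simp_all add: n_def sgn_div_norm power2_norm_eq_inner[symmetric] power2_eq_square)
  ultimately show ?thesis by simp
qed

lemma gradient_bound2: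
  assumes sub: "{a - \<epsilon>..a + \<epsilon>} \<subseteq> {-R..R}" "{b - \<epsilon>..b + \<epsilon>} \<subseteq> {-R..R}"
    and M: "\<And>s t. s \<in> {a - \<epsilon>..a + \<epsilon>} \<Longrightarrow> t \<in> {b - \<epsilon>..b + \<epsilon>} \<Longrightarrow> norm (U (s, t)) \<le> M"
    and L: "\<And>y. norm y \<le> M \<Longrightarrow> norm (G y) \<le> L"
  shows "norm (U2 (a, b)) \<le> 3 * (2 * M + L + 1) / \<epsilon>"
proof -
  interpret s: planar_solution V G W \<kappa>0 R0 \<epsilon> R "\<lambda>p. U (prod.swap p)" "\<lambda>p. U2 (prod.swap p)"
    "\<lambda>p. U1 (prod.swap p)" "\<lambda>p. U22 (prod.swap p)" "\<lambda>p. U12 (prod.swap p)" "\<lambda>p. U11 (prod.swap p)"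
    by (rule swapped)
  show ?thesis
    using s.gradient_bound1[of b a M L] assms by simp
qed

section \<open>Good lines stay near one well\<close>

text \<open>\<open>V \<le> \<epsilon> e\<close> pointwise, so the average of \<open>V\<close> on a
  line is of order \<open>\<epsilon>\<close> times its energy. For small \<open>\<epsilon>\<close>
  the line therefore passes close to a well, which starts the confinement argument.\<close>

lemma line_small_potential:
  assumes a: "a \<in> {-R..R}"
  shows "\<exists>b\<in>{-R..R}. V (U (a, b)) \<le> \<epsilon> * h1 a / (2 * R)"
proof (rule integral_le_imp_exists_le)
  have R: "-R \<le> -R" "R \<le> R" by auto
  note c = cont_slice1[OF a R cont_VU] cont_slice1[OF a R cont_e]
  show "continuous_on {-R..R} (\<lambda>b. V (U (a, b)))" by (rule c)
  have "integral {-R..R} (\<lambda>b. V (U (a, b))) \<le> integral {-R..R} (\<lambda>b. \<epsilon> * e (a, b))"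
  proof (intro integral_le integrable_continuous_interval continuous_on_mult_left c)
    fix b
    have "e (a, b) \<ge> V (U (a, b)) / \<epsilon>"
      using eps_pos by (simp add: e_def)
    then show "V (U (a, b)) \<le> \<epsilon> * e (a, b)"
      using eps_pos by (simp add: field_simps)
  qed
  then show "integral {-R..R} (\<lambda>b. V (U (a, b))) \<le> \<epsilon> * h1 a / (2 * R) * (R - - R)"
    using R_pos by (simp add: h1_def)
qed (use R_pos in auto)

lemma line_confined:
  assumes a: "a \<in> {-R..R}"
    and lip: "\<And>y z. \<bar>g y - g z\<bar> \<le> norm (y - z)"
    and layer: "\<And>y. p \<le> g y \<Longrightarrow> g y \<le> q \<Longrightarrow> V y \<ge> m" "p < q" "m > 0"
    and energy: "h1 a < sqrt (2 * m) * (q - p)"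
    and start: "b0 \<in> {-R..R}" "g (U (a, b0)) \<le> p" and b: "b \<in> {-R..R}"
  shows "g (U (a, b)) < q"
proof (rule curve_confined[where a="-R" and b=R and \<gamma>="\<lambda>b. U (a, b)" and \<gamma>'="\<lambda>b. U2 (a, b)" and V=V
      and p=p and m=m and \<epsilon>=\<epsilon> and ?t0.0=b0])
  have R: "-R \<le> -R" "R \<le> R" by auto
  note c = cont_slice1[OF a R cont_VU] cont_slice1[OF a R cont_e] cont_slice1[OF a R cont_U2]
  show "((\<lambda>b. U (a, b)) has_vector_derivative U2 (a, t)) (at t)" if "t \<in> {-R..R}" for t
    using U2[OF a that] .
  show "continuous_on {-R..R} (\<lambda>b. U2 (a, b))" by (rule c)
  have "integral {-R..R} (\<lambda>t. \<epsilon> * (norm (U2 (a, t)))\<^sup>2 / 2 + V (U (a, t)) / \<epsilon>) \<le> h1 a"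
    unfolding h1_def
  proof (intro integral_le integrable_continuous_interval c)
    show "continuous_on {-R..R} (\<lambda>t. \<epsilon> * (norm (U2 (a, t)))\<^sup>2 / 2 + V (U (a, t)) / \<epsilon>)"
      using eps_pos by (intro continuous_intros c) auto
    show "\<epsilon> * (norm (U2 (a, t)))\<^sup>2 / 2 + V (U (a, t)) / \<epsilon> \<le> e (a, t)" for t
      using eps_pos by (simp add: e_def divide_right_mono)
  qed
  then show "integral {-R..R} (\<lambda>t. \<epsilon> * (norm (U2 (a, t)))\<^sup>2 / 2 + V (U (a, t)) / \<epsilon>) < sqrt (2 * m) * (q - p)"
    using energy by linarith
qed (use assms cont_V V_nonneg eps_pos in auto)

text \<open>The line has a point within \<open>\<kappa> / 2\<close> of some well, and leaving the
  ball of radius \<open>\<kappa>\<close> would mean crossing an annulus of width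
  \<open>\<kappa> / 2\<close>, too expensive for its energy. In the annulus \<open>V \<ge> m\<close>
  because the other wells are farther than
  \<open>2 * \<kappa>0 - \<kappa> \<ge> \<kappa>\<close>.\<close>

lemma line_near_well1:
  assumes a: "a \<in> {-R..R}" and \<kappa>: "0 < \<kappa>" "\<kappa> \<le> \<kappa>0"
    and m: "m > 0" "\<And>y. (\<And>\<sigma>. \<sigma> \<in> W \<Longrightarrow> norm (y - \<sigma>) \<ge> \<kappa> / 2) \<Longrightarrow> V y \<ge> m"
    and energy: "h1 a < sqrt (2 * m) * (\<kappa> / 2)" "\<epsilon> * h1 a < 2 * R * m"
  shows "\<exists>\<sigma>\<in>W. \<forall>b\<in>{-R..R}. norm (U (a, b) - \<sigma>) < \<kappa>"
proof -
  obtain b0 where b0: "b0 \<in> {-R..R}" "V (U (a, b0)) \<le> \<epsilon> * h1 a / (2 * R)"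
    using line_small_potential[OF a] by blast
  note b0(2)
  also have "\<epsilon> * h1 a / (2 * R) < m"
    using energy(2) R_pos by (simp add: field_simps)
  finally obtain \<sigma> where \<sigma>: "\<sigma> \<in> W" "norm (U (a, b0) - \<sigma>) < \<kappa> / 2"
    using m(2)[of "U (a, b0)"] by (meson not_le)
  have "norm (U (a, b) - \<sigma>) < \<kappa>" if "b \<in> {-R..R}" for b
  proof (rule line_confined[where g="\<lambda>y. norm (y - \<sigma>)" and p="\<kappa> / 2" and m=m, OF a])
    show "\<bar>norm (y - \<sigma>) - norm (z - \<sigma>)\<bar> \<le> norm (y - z)" for y z
      using norm_triangle_ineq3[of "y - \<sigma>" "z - \<sigma>"] by simp
    show "m \<le> V y" if y: "\<kappa> / 2 \<le> norm (y - \<sigma>)" "norm (y - \<sigma>) \<le> \<kappa>" for y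
    proof (rule m(2))
      fix \<sigma>' assume "\<sigma>' \<in> W"
      show "\<kappa> / 2 \<le> norm (y - \<sigma>')"
      proof (cases "\<sigma>' = \<sigma>")
        case False
        then have "norm (\<sigma> - \<sigma>') > 2 * \<kappa>0"
          using \<sigma>(1) \<open>\<sigma>' \<in> W\<close> separated by auto
        moreover have "norm (\<sigma> - \<sigma>') \<le> norm (y - \<sigma>) + norm (y - \<sigma>')"
          using norm_triangle_ineq4[of "y - \<sigma>'" "y - \<sigma>"] by (simp add: norm_minus_commute)
        ultimately show ?thesis using y \<kappa> by linarith
      qed (use y in auto)
    qed
  qed (use \<kappa> m \<sigma> b0 energy that in auto)
  then show ?thesis using \<sigma>(1) by blast
qed

text \<open>The same confinement with \<open>norm\<close> as the height function and the layer
  between \<open>R0\<close> and \<open>R0 + 1\<close>.\<close>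

lemma line_bounded1:
  assumes a: "a \<in> {-R..R}" and m: "m > 0" "\<And>y. norm y \<ge> R0 \<Longrightarrow> V y \<ge> m"
    and energy: "h1 a < sqrt (2 * m)" "\<epsilon> * h1 a < 2 * R * m" and b: "b \<in> {-R..R}"
  shows "norm (U (a, b)) \<le> R0 + 1"
proof -
  obtain b0 where b0: "b0 \<in> {-R..R}" "V (U (a, b0)) \<le> \<epsilon> * h1 a / (2 * R)"
    using line_small_potential[OF a] by blast
  note b0(2)
  also have "\<epsilon> * h1 a / (2 * R) < m"
    using energy(2) R_pos by (simp add: field_simps)
  finally have "norm (U (a, b0)) < R0"
    using m(2)[of "U (a, b0)"] by (meson not_le)
  then have "norm (U (a, b)) < R0 + 1"
    using m energy b0 b
    by (intro line_confined[where g=norm and p=R0 and m=m, OF a]) (auto intro: norm_triangle_ineq3)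
  then show ?thesis by simp
qed

lemma swapped_energy:
  defines "e' \<equiv> planar_solution.e V \<epsilon> (\<lambda>p. U (prod.swap p)) (\<lambda>p. U2 (prod.swap p)) (\<lambda>p. U1 (prod.swap p))"
  shows "integral {-R..R} (\<lambda>b. e' (a, b)) = h2 a"
proof -
  interpret s: planar_solution V G W \<kappa>0 R0 \<epsilon> R "\<lambda>p. U (prod.swap p)" "\<lambda>p. U2 (prod.swap p)"
    "\<lambda>p. U1 (prod.swap p)" "\<lambda>p. U22 (prod.swap p)" "\<lambda>p. U12 (prod.swap p)" "\<lambda>p. U11 (prod.swap p)"
    by (rule swapped)
  show ?thesis
    by (simp add: e'_def s.e_def e_def h2_def add.commute)
qed

lemma line_near_well2:
  assumes b: "b \<in> {-R..R}" and \<kappa>: "0 < \<kappa>" "\<kappa> \<le> \<kappa>0"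
    and m: "m > 0" "\<And>y. (\<And>\<sigma>. \<sigma> \<in> W \<Longrightarrow> norm (y - \<sigma>) \<ge> \<kappa> / 2) \<Longrightarrow> V y \<ge> m"
    and energy: "h2 b < sqrt (2 * m) * (\<kappa> / 2)" "\<epsilon> * h2 b < 2 * R * m"
  shows "\<exists>\<sigma>\<in>W. \<forall>a\<in>{-R..R}. norm (U (a, b) - \<sigma>) < \<kappa>"
proof -
  interpret s: planar_solution V G W \<kappa>0 R0 \<epsilon> R "\<lambda>p. U (prod.swap p)" "\<lambda>p. U2 (prod.swap p)"
    "\<lambda>p. U1 (prod.swap p)" "\<lambda>p. U22 (prod.swap p)" "\<lambda>p. U12 (prod.swap p)" "\<lambda>p. U11 (prod.swap p)"
    by (rule swapped)
  show ?thesis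
    using s.line_near_well1[OF b \<kappa> m] energy by (simp add: s.h1_def swapped_energy)
qed

lemma line_bounded2:
  assumes b: "b \<in> {-R..R}" and m: "m > 0" "\<And>y. norm y \<ge> R0 \<Longrightarrow> V y \<ge> m"
    and energy: "h2 b < sqrt (2 * m)" "\<epsilon> * h2 b < 2 * R * m" and a: "a \<in> {-R..R}"
  shows "norm (U (a, b)) \<le> R0 + 1"
proof -
  interpret s: planar_solution V G W \<kappa>0 R0 \<epsilon> R "\<lambda>p. U (prod.swap p)" "\<lambda>p. U2 (prod.swap p)"
    "\<lambda>p. U1 (prod.swap p)" "\<lambda>p. U22 (prod.swap p)" "\<lambda>p. U12 (prod.swap p)" "\<lambda>p. U11 (prod.swap p)"
    by (rule swapped)
  show ?thesis
    using s.line_bounded1[OF b m] energy a by (simp add: s.h1_def swapped_energy)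
qed

section \<open>Energy decay\<close>

definition energy :: real where
  "energy = integral (cbox (-R, -R) (R, R)) e"

lemma cont_h1: "continuous_on {-R..R} h1"
proof -
  have "continuous_on ({-R..R} \<times> cbox (-R) R) (\<lambda>(a, b). e (a, b))"
    using cont_e by (simp add: cbox_Pair_eq)
  from integral_continuous_on_param[OF this] show ?thesis
    by (simp add: h1_def[abs_def])
qed

lemma cont_h2: "continuous_on {-R..R} h2"
proof -
  have "continuous_on ({-R..R} \<times> cbox (-R) R) (\<lambda>(b, a). e (a, b))"
    unfolding case_prod_beta
    by (rule continuous_on_compose2[OF cont_e]) (auto simp: cbox_Pair_eq intro!: continuous_intros)
  from integral_continuous_on_param[OF this] show ?thesis
    by (simp add: h2_def[abs_def])
qed

lemma integral_h1: "integral {-R..R} h1 = energy"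
  using integral_prod_continuous[OF cont_e] by (simp add: energy_def h1_def[abs_def])

lemma integral_h2: "integral {-R..R} h2 = energy"
  using integral_prod_continuous[OF cont_e] integral_swap_continuous[of "-R" "-R" R R "\<lambda>a b. e (a, b)"] cont_e
  by (simp add: energy_def h2_def[abs_def])

lemma h1_nonneg: "a \<in> {-R..R} \<Longrightarrow> h1 a \<ge> 0" and h2_nonneg: "a \<in> {-R..R} \<Longrightarrow> h2 a \<ge> 0"
  using R_pos by (auto simp: h1_def h2_def e_nonneg
    intro!: integral_nonneg integrable_continuous_interval cont_slice1 cont_slice2 cont_e)

lemma energy_nonneg: "energy \<ge> 0"
  unfolding energy_def using integrable_continuous[OF cont_e] e_nonneg by (intro integral_nonneg) auto

lemma exists_good_side:
  fixes h :: "real \<Rightarrow> real"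
  assumes "continuous_on {-R..R} h" "\<And>a. a \<in> {-R..R} \<Longrightarrow> h a \<ge> 0" "integral {-R..R} h = energy"
    and "-R \<le> l" "l < u" "u \<le> R" "energy \<le> c * (u - l)"
  shows "\<exists>a\<in>{l..u}. h a \<le> c"
proof (rule integral_le_imp_exists_le)
  show ch: "continuous_on {l..u} h"
    using assms by (intro continuous_on_subset[OF assms(1)]) auto
  have "integral {l..u} h \<le> integral {-R..R} h"
    using assms ch by (intro integral_subset_le integrable_continuous_interval) auto
  then show "integral {l..u} h \<le> c * (u - l)"
    using assms by simp
qed fact

text \<open>Fubini for a weight depending on one coordinate: a uniform bound on the flux through
  single lines is multiplied only by the total weight, which later stands for the total width of the
  bad lines.\<close>

lemma weighted_slices:
  fixes f :: "real \<times> real \<Rightarrow> real" and w :: "real \<Rightarrow> real"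
  assumes Q: "-R \<le> a0" "a0 \<le> a1" "a1 \<le> R" "-R \<le> b0" "b0 \<le> b1" "b1 \<le> R"
    and f: "continuous_on (cbox (-R, -R) (R, R)) f"
    and w: "continuous_on {-R..R} w" "\<And>a. a \<in> {-R..R} \<Longrightarrow> 0 \<le> w a" "integral {-R..R} w \<le> c"
    and K: "\<And>a. a \<in> {a0..a1} \<Longrightarrow> \<bar>integral {b0..b1} (\<lambda>b. f (a, b))\<bar> \<le> K"
  shows "\<bar>integral (cbox (a0, b0) (a1, b1)) (\<lambda>p. w (fst p) * f p)\<bar> \<le> K * c"
proof -
  have cont: "continuous_on (cbox (-R, -R) (R, R)) (\<lambda>p. w (fst p) * f p)"
    by (intro continuous_on_mult f continuous_on_compose2[OF w(1)] continuous_on_fst continuous_on_id)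
       (auto simp: cbox_Pair_eq)
  note contQ = integrable_subrectangle(2)[OF Q(1,3,4,6)]
  have K0: "K \<ge> 0" using K[of a0] Q by auto
  have cw: "continuous_on {a0..a1} w"
    using Q by (intro continuous_on_subset[OF w(1)]) auto
  have cI: "continuous_on {a0..a1} (\<lambda>a. w a * integral {b0..b1} (\<lambda>b. f (a, b)))"
  proof (intro continuous_on_mult cw)
    have "continuous_on ({a0..a1} \<times> cbox b0 b1) (\<lambda>(a, b). f (a, b))"
      using contQ[OF f] by (simp add: cbox_Pair_eq)
    from integral_continuous_on_param[OF this]
    show "continuous_on {a0..a1} (\<lambda>a. integral {b0..b1} (\<lambda>b. f (a, b)))" by simp
  qed
  have "integral (cbox (a0, b0) (a1, b1)) (\<lambda>p. w (fst p) * f p)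
      = integral {a0..a1} (\<lambda>a. w a * integral {b0..b1} (\<lambda>b. f (a, b)))"
    using integral_prod_continuous[OF contQ[OF cont]] by simp
  also have "\<bar>\<dots>\<bar> \<le> integral {a0..a1} (\<lambda>a. K * w a)"
    unfolding real_norm_def[symmetric]
  proof (intro integral_norm_bound_integral integrable_continuous_interval cI continuous_on_mult_left cw)
    fix a assume a: "a \<in> {a0..a1}"
    then have "w a * \<bar>integral {b0..b1} (\<lambda>b. f (a, b))\<bar> \<le> w a * K"
      using K Q w(2)[of a] by (intro mult_left_mono) auto
    then show "norm (w a * integral {b0..b1} (\<lambda>b. f (a, b))) \<le> K * w a"
      using w(2)[of a] a Q by (simp add: abs_mult mult.commute)
  qed
  also have "\<dots> = K * integral {a0..a1} w"
    by simp
  also have "integral {a0..a1} w \<le> integral {-R..R} w"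
    using Q w by (intro integral_subset_le integrable_continuous_interval cw) auto
  also have "\<dots> \<le> c" by fact
  finally show ?thesis
    using K0 by (simp add: mult_left_mono)
qed

lemma integral_swap_subrectangle:
  assumes Q: "-R \<le> a0" "a1 \<le> R" "-R \<le> b0" "b1 \<le> R"
    and f: "continuous_on (cbox (-R, -R) (R, R)) (f :: real \<times> real \<Rightarrow> real)"
  shows "integral (cbox (a0, b0) (a1, b1)) f = integral (cbox (b0, a0) (b1, a1)) (\<lambda>p. f (prod.swap p))"
  using integral_swap_2dim[of a0 b0 a1 b1 "\<lambda>a b. f (a, b)"] integrable_subrectangle(2)[OF Q f]
  by (simp add: case_prod_unfold prod.swap_def)

lemma weighted_slices2:
  fixes f :: "real \<times> real \<Rightarrow> real" and w :: "real \<Rightarrow> real"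
  assumes Q: "-R \<le> a0" "a0 \<le> a1" "a1 \<le> R" "-R \<le> b0" "b0 \<le> b1" "b1 \<le> R"
    and f: "continuous_on (cbox (-R, -R) (R, R)) f"
    and w: "continuous_on {-R..R} w" "\<And>a. a \<in> {-R..R} \<Longrightarrow> 0 \<le> w a" "integral {-R..R} w \<le> c"
    and K: "\<And>b. b \<in> {b0..b1} \<Longrightarrow> \<bar>integral {a0..a1} (\<lambda>a. f (a, b))\<bar> \<le> K"
  shows "\<bar>integral (cbox (a0, b0) (a1, b1)) (\<lambda>p. w (snd p) * f p)\<bar> \<le> K * c"
proof -
  have c1: "continuous_on (cbox (-R, -R) (R, R)) (\<lambda>p. f (prod.swap p))"
    by (rule continuous_on_compose2[OF f continuous_on_swap]) (auto simp: cbox_Pair_eq)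
  have c2: "continuous_on (cbox (-R, -R) (R, R)) (\<lambda>p. w (snd p) * f p)"
    by (intro continuous_on_mult f continuous_on_compose2[OF w(1)] continuous_on_snd continuous_on_id)
       (auto simp: cbox_Pair_eq)
  show ?thesis
    using weighted_slices[OF Q(4,5,6,1,2,3) c1 w, of K] K
    by (simp add: integral_swap_subrectangle[OF Q(1,3,4,6) c2])
qed

text \<open>The weights \<open>min 1 (h / \<tau>)\<close> equal 1 on the bad lines. Where both do, the weighted stresses add up to
  \<open>-2 V / \<epsilon>\<close>; everywhere else \<open>U\<close> is near \<open>\<sigma>\<close> and the cutoff energy absorbs them.\<close>

lemma energy_on_rectangle:
  assumes Q: "-R \<le> a0" "a0 \<le> a1" "a1 \<le> R" "-R \<le> b0" "b0 \<le> b1" "b1 \<le> R"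
    and sides: "h1 a0 \<le> c" "h1 a1 \<le> c" "h2 b0 \<le> c" "h2 b1 \<le> c"
    and near1: "\<And>a. a \<in> {-R..R} \<Longrightarrow> h1 a < \<tau> \<Longrightarrow> \<exists>\<sigma>\<in>W. \<forall>b\<in>{-R..R}. norm (U (a, b) - \<sigma>) < \<kappa>"
    and near2: "\<And>b. b \<in> {-R..R} \<Longrightarrow> h2 b < \<tau> \<Longrightarrow> \<exists>\<sigma>\<in>W. \<forall>a\<in>{-R..R}. norm (U (a, b) - \<sigma>) < \<kappa>"
    and \<tau>: "c < \<tau>"
    and \<kappa>: "\<kappa> > 0" "\<kappa> \<le> \<kappa>0" "\<kappa>\<^sup>2 * (exp (1 / \<delta>) - 1) = \<kappa>0\<^sup>2"
    and \<delta>: "0 < \<delta>" "\<delta> \<le> 1/2"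
    and \<kappa>1: "\<kappa>1 > 0" "\<kappa>1\<^sup>2 * (exp (1 / \<delta>1) - 1) = \<kappa>0\<^sup>2"
    and \<delta>1: "0 < \<delta>1" "\<delta>1 \<le> 1/2" "64 * real (card W) * \<delta>1 \<le> 1"
    and far: "\<And>p. p \<in> cbox (a0, b0) (a1, b1) \<Longrightarrow> (\<And>\<sigma>. \<sigma> \<in> W \<Longrightarrow> norm (U p - \<sigma>) \<ge> \<kappa>1) \<Longrightarrow>
        e p \<le> C * (V (U p) / \<epsilon>)"
    and C: "C \<ge> 0" "256 * C * \<delta> \<le> 1"
  shows "integral (cbox (a0, b0) (a1, b1)) e \<le> 12 * C * c * energy / \<tau>
      + (32 * C + 16 * real (card W)) * (\<kappa>0 * sqrt \<epsilon> * (4 * c + 8 * R))"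
proof -
  define Y where "Y = integral (cbox (a0, b0) (a1, b1)) e"
  define X where "X = integral (cbox (a0, b0) (a1, b1)) (\<lambda>p. V (U p) / \<epsilon>)"
  define B where "B = \<kappa>0 * sqrt \<epsilon> * (4 * c + 8 * R)"
  note intQ = integrable_subrectangle(1)[OF Q(1,3,4,6)]
  have c_VU: "continuous_on (cbox (-R, -R) (R, R)) (\<lambda>p. V (U p) / \<epsilon>)"
    using eps_pos by (intro continuous_intros cont_VU) auto
  have c_psi: "continuous_on (cbox (-R, -R) (R, R)) (\<lambda>p. log_cutoff d k ((norm (U p - \<sigma>))\<^sup>2) * e p)"
    if "k > 0" for d k \<sigma>
  proof -
    have "1 + (norm (U p - \<sigma>))\<^sup>2 / k\<^sup>2 \<noteq> 0" for p
      using that by (simp add: add_pos_nonneg less_imp_neq[symmetric])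
    then show ?thesis
      unfolding log_cutoff_def using that by (intro continuous_intros cont_e cont_U) auto
  qed
  have B0: "\<kappa>0 * sqrt \<epsilon> * (h1 a0 + h1 a1 + h2 b0 + h2 b1 + 8 * R) \<le> B"
    unfolding B_def using sides \<kappa>0_pos eps_pos by (intro mult_left_mono) auto
  have est: "integral (cbox (a0, b0) (a1, b1)) (\<lambda>p. log_cutoff d k ((norm (U p - \<sigma>))\<^sup>2) * e p) \<le> 8 * d * Y + B"
    if "\<sigma> \<in> W" "0 < d" "d \<le> 1/2" "k > 0" "k\<^sup>2 * (exp (1 / d) - 1) = \<kappa>0\<^sup>2" for d k \<sigma>
    using well_estimate[OF that Q] B0 unfolding Y_def by linarith
  define q where "q = real (card W)"
  have "Y \<ge> 0"
    unfolding Y_def using intQ[OF cont_e] e_nonneg by (intro integral_nonneg) auto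
  \<comment> \<open>Off all wells \<open>far\<close> compares \<open>e\<close> with the potential;
    within \<open>\<kappa>1\<close> of a well the first cutoff is at least 1/4, whence the 4.
    Summing over all wells avoids saying which well is close.\<close>
  have Y1: "Y \<le> C * X + 4 * (q * (8 * \<delta>1 * Y + B))"
  proof -
    have pw: "e p \<le> C * (V (U p) / \<epsilon>) + 4 * (\<Sum>\<sigma>\<in>W. log_cutoff \<delta>1 \<kappa>1 ((norm (U p - \<sigma>))\<^sup>2) * e p)"
      if "p \<in> cbox (a0, b0) (a1, b1)" for p
    proof -
      have nn: "log_cutoff \<delta>1 \<kappa>1 ((norm (U p - \<sigma>))\<^sup>2) * e p \<ge> 0" for \<sigma>
        using log_cutoff_bounds(1)[of "(norm (U p - \<sigma>))\<^sup>2" \<kappa>1 \<delta>1] \<kappa>1 \<delta>1 e_nonneg by simp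
      have CV: "C * (V (U p) / \<epsilon>) \<ge> 0"
        using C(1) V_nonneg eps_pos by simp
      show ?thesis
      proof (cases "\<forall>\<sigma>\<in>W. norm (U p - \<sigma>) \<ge> \<kappa>1")
        case True
        then have "e p \<le> C * (V (U p) / \<epsilon>)"
          using far[OF that] by blast
        moreover have "(\<Sum>\<sigma>\<in>W. log_cutoff \<delta>1 \<kappa>1 ((norm (U p - \<sigma>))\<^sup>2) * e p) \<ge> 0"
          by (intro sum_nonneg nn)
        ultimately show ?thesis by linarith
      next
        case False
        then obtain \<sigma> where \<sigma>: "\<sigma> \<in> W" "norm (U p - \<sigma>) < \<kappa>1" by force
        then have "(norm (U p - \<sigma>))\<^sup>2 \<le> \<kappa>1\<^sup>2" by (intro power_mono) auto
        then have "1 / 4 \<le> log_cutoff \<delta>1 \<kappa>1 ((norm (U p - \<sigma>))\<^sup>2)"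
          using \<kappa>1 \<delta>1 by (intro log_cutoff_bounds(3)) auto
        then have "1 / 4 * e p \<le> log_cutoff \<delta>1 \<kappa>1 ((norm (U p - \<sigma>))\<^sup>2) * e p"
          using e_nonneg by (intro mult_right_mono)
        also have "\<dots> \<le> (\<Sum>\<sigma>\<in>W. log_cutoff \<delta>1 \<kappa>1 ((norm (U p - \<sigma>))\<^sup>2) * e p)"
          using finite_W \<sigma>(1) nn by (intro member_le_sum) auto
        finally show ?thesis using CV by linarith
      qed
    qed
    have i1: "(\<lambda>p. C * (V (U p) / \<epsilon>)) integrable_on cbox (a0, b0) (a1, b1)"
      by (intro intQ continuous_on_mult_left c_VU)
    have i2: "(\<lambda>p. \<Sum>\<sigma>\<in>W. log_cutoff \<delta>1 \<kappa>1 ((norm (U p - \<sigma>))\<^sup>2) * e p) integrable_on cbox (a0, b0) (a1, b1)"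
      by (intro intQ continuous_on_sum c_psi \<kappa>1)
    have "Y \<le> integral (cbox (a0, b0) (a1, b1))
        (\<lambda>p. C * (V (U p) / \<epsilon>) + 4 * (\<Sum>\<sigma>\<in>W. log_cutoff \<delta>1 \<kappa>1 ((norm (U p - \<sigma>))\<^sup>2) * e p))"
      unfolding Y_def using pw i1 integrable_cmul[OF i2, of 4] intQ[OF cont_e]
      by (intro integral_le integrable_add) auto
    also have "\<dots> = C * X + 4 * integral (cbox (a0, b0) (a1, b1))
        (\<lambda>p. \<Sum>\<sigma>\<in>W. log_cutoff \<delta>1 \<kappa>1 ((norm (U p - \<sigma>))\<^sup>2) * e p)"
      using integral_add[OF i1 integrable_cmul[OF i2, of 4]] by (simp add: X_def)
    also have "integral (cbox (a0, b0) (a1, b1)) (\<lambda>p. \<Sum>\<sigma>\<in>W. log_cutoff \<delta>1 \<kappa>1 ((norm (U p - \<sigma>))\<^sup>2) * e p)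
        = (\<Sum>\<sigma>\<in>W. integral (cbox (a0, b0) (a1, b1)) (\<lambda>p. log_cutoff \<delta>1 \<kappa>1 ((norm (U p - \<sigma>))\<^sup>2) * e p))"
      by (intro integral_sum finite_W intQ c_psi \<kappa>1)
    also have "\<dots> \<le> q * (8 * \<delta>1 * Y + B)"
      unfolding q_def using \<kappa>1 \<delta>1 by (intro sum_bounded_above est) auto
    finally show ?thesis by simp
  qed
  \<comment> \<open>The condition on \<open>\<delta>1\<close> makes the term in \<open>Y\<close> on
    the right at most \<open>Y / 2\<close>, so that it can be absorbed.\<close>
  have Y2: "Y \<le> 2 * C * X + 8 * (q * B)"
  proof -
    have "(64 * q * \<delta>1) * Y \<le> 1 * Y"
      using \<delta>1(3) \<open>Y \<ge> 0\<close> unfolding q_def by (intro mult_right_mono)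
    moreover have "4 * (q * (8 * \<delta>1 * Y + B)) = (64 * q * \<delta>1 * Y) / 2 + 4 * (q * B)"
      by (simp add: algebra_simps)
    ultimately show ?thesis using Y1 by linarith
  qed
  have R: "a0 \<in> {-R..R}" "a1 \<in> {-R..R}" "b0 \<in> {-R..R}" "b1 \<in> {-R..R}" using Q by auto
  \<comment> \<open>The left side is a good line and fixes the well. Every good horizontal line
    crosses it and so has the same well; the bottom side is one of these, and every good vertical
    line crosses it.\<close>
  obtain \<sigma> where \<sigma>: "\<sigma> \<in> W" "\<forall>b\<in>{-R..R}. norm (U (a0, b) - \<sigma>) < \<kappa>"
    using near1[OF R(1)] sides \<tau> by fastforce
  have same: "\<sigma>' = \<sigma>''" if "\<sigma>' \<in> W" "\<sigma>'' \<in> W" "norm (y - \<sigma>') < \<kappa>" "norm (y - \<sigma>'') < \<kappa>" for \<sigma>' \<sigma>'' y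
  proof (rule ccontr)
    assume "\<sigma>' \<noteq> \<sigma>''"
    then have "norm (\<sigma>' - \<sigma>'') > 2 * \<kappa>0" using separated that by blast
    moreover have "norm (\<sigma>' - \<sigma>'') \<le> norm (y - \<sigma>') + norm (y - \<sigma>'')"
      using norm_triangle_ineq4[of "y - \<sigma>''" "y - \<sigma>'"] by simp
    ultimately show False using that \<kappa> by linarith
  qed
  have hor: "norm (U (a, b) - \<sigma>) < \<kappa>" if ab: "a \<in> {-R..R}" "b \<in> {-R..R}" and h: "h2 b < \<tau>" for a b
  proof -
    obtain \<sigma>' where \<sigma>': "\<sigma>' \<in> W" "\<forall>a\<in>{-R..R}. norm (U (a, b) - \<sigma>') < \<kappa>"
      using near2[OF ab(2) h] by blast
    then have "\<sigma>' = \<sigma>"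
      using same[of \<sigma>' \<sigma> "U (a0, b)"] \<sigma> R ab by blast
    then show ?thesis using \<sigma>' ab by blast
  qed
  have ver: "norm (U (a, b) - \<sigma>) < \<kappa>" if ab: "a \<in> {-R..R}" "b \<in> {-R..R}" and h: "h1 a < \<tau>" for a b
  proof -
    obtain \<sigma>' where \<sigma>': "\<sigma>' \<in> W" "\<forall>b\<in>{-R..R}. norm (U (a, b) - \<sigma>') < \<kappa>"
      using near1[OF ab(1) h] by blast
    moreover have "norm (U (a, b0) - \<sigma>) < \<kappa>"
      using sides \<tau> by (intro hor ab R) auto
    ultimately have "\<sigma>' = \<sigma>"
      using same[of \<sigma>' \<sigma> "U (a, b0)"] \<sigma> R by blast
    then show ?thesis using \<sigma>' ab by blast
  qed
  define w1 where "w1 a = min 1 (h1 a / \<tau>)" for a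
  define w2 where "w2 a = min 1 (h2 a / \<tau>)" for a
  have "c \<ge> 0" using h1_nonneg[OF R(1)] sides by linarith
  then have "\<tau> > 0" using \<tau> by linarith
  have w: "continuous_on {-R..R} w1" "continuous_on {-R..R} w2"
    unfolding w1_def[abs_def] w2_def[abs_def] using \<open>\<tau> > 0\<close>
    by (intro continuous_intros cont_h1 cont_h2; simp)+
  have w0: "0 \<le> w1 a" "0 \<le> w2 a" if "a \<in> {-R..R}" for a
    using \<open>\<tau> > 0\<close> h1_nonneg[OF that] h2_nonneg[OF that] by (simp_all add: w1_def w2_def)
  \<comment> \<open>Chebyshev's inequality for the width of the bad lines, with continuous weights
    in place of indicators.\<close>
  have wint: "integral {-R..R} w1 \<le> energy / \<tau>" "integral {-R..R} w2 \<le> energy / \<tau>"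
  proof -
    have "integral {-R..R} w1 \<le> integral {-R..R} (\<lambda>a. h1 a / \<tau>)"
      using \<open>\<tau> > 0\<close> w by (intro integral_le integrable_continuous_interval continuous_intros cont_h1) (auto simp: w1_def)
    then show "integral {-R..R} w1 \<le> energy / \<tau>"
      by (simp add: integral_h1)
    have "integral {-R..R} w2 \<le> integral {-R..R} (\<lambda>a. h2 a / \<tau>)"
      using \<open>\<tau> > 0\<close> w by (intro integral_le integrable_continuous_interval continuous_intros cont_h2) (auto simp: w2_def)
    then show "integral {-R..R} w2 \<le> energy / \<tau>"
      by (simp add: integral_h2)
  qed
  have s1: "\<bar>integral (cbox (a0, b0) (a1, b1)) (\<lambda>p. w1 (fst p) * T11 p)\<bar> \<le> 3 * c * (energy / \<tau>)"
  proof (rule weighted_slices[OF Q cont_T11 w(1) w0(1) wint(1)])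
    show "\<bar>integral {b0..b1} (\<lambda>b. T11 (a, b))\<bar> \<le> 3 * c" if "a \<in> {a0..a1}" for a
      using stress_slice1[OF Q(1,3,4,5,6) that] sides by linarith
  qed auto
  have s2: "\<bar>integral (cbox (a0, b0) (a1, b1)) (\<lambda>p. w2 (snd p) * T22 p)\<bar> \<le> 3 * c * (energy / \<tau>)"
  proof (rule weighted_slices2[OF Q cont_T22 w(2) w0(2) wint(2)])
    show "\<bar>integral {a0..a1} (\<lambda>a. T22 (a, b))\<bar> \<le> 3 * c" if "b \<in> {b0..b1}" for b
      using stress_slice2[OF Q(1,2,3,4,6) that] sides by linarith
  qed auto
  have c_w: "continuous_on (cbox (-R, -R) (R, R)) (\<lambda>p. w1 (fst p) * T11 p)"
      "continuous_on (cbox (-R, -R) (R, R)) (\<lambda>p. w2 (snd p) * T22 p)"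
    by (intro continuous_on_mult cont_T11 cont_T22 continuous_on_compose2[OF w(1)] continuous_on_compose2[OF w(2)]
        continuous_on_fst continuous_on_snd continuous_on_id; auto simp: cbox_Pair_eq)+
  define \<psi> where "\<psi> p = log_cutoff \<delta> \<kappa> ((norm (U p - \<sigma>))\<^sup>2)" for p
  \<comment> \<open>On a good line \<open>\<psi> \<ge> 1/4\<close>, so
    \<open>8 \<psi> e \<ge> 2 e\<close> pays for \<open>V / \<epsilon> \<le> e\<close> and for half
    of two stresses, each at most \<open>e\<close>. Where both lines are bad the weights are 1 and
    the trace identity gives \<open>V / \<epsilon>\<close> exactly.\<close>
  have pw: "V (U p) / \<epsilon> \<le> 8 * (\<psi> p * e p) - 1/2 * (w1 (fst p) * T11 p + w2 (snd p) * T22 p)"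
    if "p \<in> cbox (a0, b0) (a1, b1)" for p
  proof -
    obtain a b where [simp]: "p = (a, b)" by (cases p)
    have ab: "a \<in> {-R..R}" "b \<in> {-R..R}"
      using that Q by (auto simp: cbox_Pair_eq)
    have \<psi>0: "\<psi> p * e p \<ge> 0"
      unfolding \<psi>_def using log_cutoff_bounds(1)[of "(norm (U p - \<sigma>))\<^sup>2" \<kappa> \<delta>] \<kappa> \<delta> e_nonneg by simp
    show ?thesis
    proof (cases "h1 a < \<tau> \<or> h2 b < \<tau>")
      case True
      then have "norm (U p - \<sigma>) < \<kappa>"
        using hor[OF ab] ver[OF ab] by auto
      then have "(norm (U p - \<sigma>))\<^sup>2 \<le> \<kappa>\<^sup>2" by (intro power_mono) auto
      then have "1 / 4 \<le> \<psi> p"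
        unfolding \<psi>_def using \<kappa> \<delta> by (intro log_cutoff_bounds(3)) auto
      then have "1 / 4 * e p \<le> \<psi> p * e p"
        using e_nonneg by (intro mult_right_mono)
      moreover have "w1 a * T11 p \<le> e p" "w2 b * T22 p \<le> e p"
      proof -
        have "w1 a * T11 p \<le> w1 a * e p" "w2 b * T22 p \<le> w2 b * e p"
          using T11_bound[of p] T22_bound[of p] w0[OF ab(1)] w0[OF ab(2)] by (intro mult_left_mono; simp)+
        moreover have "w1 a * e p \<le> 1 * e p" "w2 b * e p \<le> 1 * e p"
          using e_nonneg by (intro mult_right_mono; simp add: w1_def w2_def)+
        ultimately show "w1 a * T11 p \<le> e p" "w2 b * T22 p \<le> e p" by linarith+
      qed
      moreover have "V (U p) / \<epsilon> \<le> e p"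
        using eps_pos by (simp add: e_def)
      moreover have "x \<le> 8 * k - 1/2 * (t + t')"
        if "1/4 * y \<le> k" "t \<le> y" "t' \<le> y" "x \<le> y" for x y k t t' :: real
        using that by (simp add: field_simps)
      ultimately show ?thesis by simp
    next
      case False
      then have "w1 a = 1" "w2 b = 1"
        using \<open>\<tau> > 0\<close> by (auto simp: w1_def w2_def)
      moreover have "T11 p + T22 p = - 2 * (V (U p) / \<epsilon>)"
        by (simp add: T11_def T22_def field_simps)
      ultimately show ?thesis using \<psi>0 by simp
    qed
  qed
  note c\<psi> = c_psi[OF \<kappa>(1), of \<delta> \<sigma>, folded \<psi>_def]
  have i: "(\<lambda>p. 8 * (\<psi> p * e p)) integrable_on cbox (a0, b0) (a1, b1)"
    "(\<lambda>p. 1/2 * (w1 (fst p) * T11 p + w2 (snd p) * T22 p)) integrable_on cbox (a0, b0) (a1, b1)"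
    by (intro intQ continuous_on_mult_left continuous_on_add c_w c\<psi>)+
  have "X \<le> integral (cbox (a0, b0) (a1, b1))
      (\<lambda>p. 8 * (\<psi> p * e p) - 1/2 * (w1 (fst p) * T11 p + w2 (snd p) * T22 p))"
    unfolding X_def using pw by (intro integral_le integrable_diff i intQ c_VU)
  also have "\<dots> = 8 * integral (cbox (a0, b0) (a1, b1)) (\<lambda>p. \<psi> p * e p)
      - 1/2 * (integral (cbox (a0, b0) (a1, b1)) (\<lambda>p. w1 (fst p) * T11 p)
             + integral (cbox (a0, b0) (a1, b1)) (\<lambda>p. w2 (snd p) * T22 p))"
    using integral_diff[OF i] integral_add[OF intQ[OF c_w(1)] intQ[OF c_w(2)]]
    by (simp only: integral_mult_right)
  also have "\<dots> \<le> 8 * (8 * \<delta> * Y + B) + 3 * c * (energy / \<tau>)"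
    using s1 s2 est[OF \<sigma>(1) \<delta> \<kappa>(1,3), folded \<psi>_def] unfolding distrib_left by linarith
  \<comment> \<open>The cutoff error becomes \<open>128 * C * \<delta> * Y \<le> Y / 2\<close>;
    absorbing it doubles the stress term from 6 to 12.\<close>
  finally have "2 * C * X \<le> 2 * C * (8 * (8 * \<delta> * Y + B) + 3 * c * (energy / \<tau>))"
    using C(1) by (intro mult_left_mono) auto
  also have "\<dots> = (256 * C * \<delta>) * Y / 2 + 16 * C * B + 6 * C * c * energy / \<tau>"
    by (simp add: algebra_simps)
  also have "(256 * C * \<delta>) * Y \<le> 1 * Y"
    using C(2) \<open>Y \<ge> 0\<close> by (intro mult_right_mono)
  finally have "2 * C * X \<le> Y / 2 + 16 * C * B + 6 * C * c * energy / \<tau>"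
    by simp
  moreover have "y \<le> 2 * (x + z) + 16 * w"
    if "u \<le> y / 2 + x + z" "y \<le> u + 8 * w" for u w x y z :: real
    using that by argo
  ultimately have "Y \<le> 2 * (16 * C * B + 6 * C * c * energy / \<tau>) + 16 * (q * B)"
    using Y2 by blast
  then show ?thesis
    by (simp add: Y_def B_def q_def algebra_simps)
qed


text \<open>Two nested rectangles with good sides are chosen: the inner one, with sides between
  \<open>R / 2\<close> and \<open>5 * R / 8\<close>, carries the energy estimate; the outer one,
  beyond \<open>3 * R / 4\<close>, carries the sup bound. The gap of at least
  \<open>R / 8 \<ge> \<epsilon>\<close> leaves room for the squares of the gradient bound.\<close>

lemma energy_on_half_square:
  assumes m1: "m1 > 0" "\<And>y. norm y \<ge> R0 \<Longrightarrow> V y \<ge> m1"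
    and L: "\<And>y. norm y \<le> R0 + 1 \<Longrightarrow> norm (G y) \<le> L"
    and \<kappa>: "\<kappa> > 0" "\<kappa> \<le> \<kappa>0" "\<kappa>\<^sup>2 * (exp (1 / \<delta>) - 1) = \<kappa>0\<^sup>2"
    and \<delta>: "0 < \<delta>" "\<delta> \<le> 1/2"
    and \<kappa>1: "\<kappa>1 > 0" "\<kappa>1\<^sup>2 * (exp (1 / \<delta>1) - 1) = \<kappa>0\<^sup>2"
    and \<delta>1: "0 < \<delta>1" "\<delta>1 \<le> 1/2" "64 * real (card W) * \<delta>1 \<le> 1"
    and m2: "m2 > 0" "\<And>y. (\<And>\<sigma>. \<sigma> \<in> W \<Longrightarrow> norm (y - \<sigma>) \<ge> \<kappa>1) \<Longrightarrow> V y \<ge> m2"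
    and m3: "m3 > 0" "\<And>y. (\<And>\<sigma>. \<sigma> \<in> W \<Longrightarrow> norm (y - \<sigma>) \<ge> \<kappa> / 2) \<Longrightarrow> V y \<ge> m3"
    and C: "C = (3 * (2 * (R0 + 1) + L + 1))\<^sup>2 / m2 + 1" "256 * C * \<delta> \<le> 1"
    and \<tau>: "\<tau> \<le> sqrt (2 * m1)" "\<tau> \<le> sqrt (2 * m3) * (\<kappa> / 2)" "8 * \<eta> < \<tau>" "\<eta> > 0"
    and \<epsilon>: "\<epsilon> \<le> R / 8" "\<epsilon> * \<tau> \<le> 2 * R * m1" "\<epsilon> * \<tau> \<le> 2 * R * m3"
    and energy: "energy \<le> \<eta> * R"
  shows "integral (cbox (- (R / 2), - (R / 2)) (R / 2, R / 2)) e \<le> 12 * C * (8 * \<eta>) * energy / \<tau>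
      + (32 * C + 16 * real (card W)) * (\<kappa>0 * sqrt \<epsilon> * (4 * (8 * \<eta>) + 8 * R))"
proof -
  have \<eta>R: "\<eta> * R > 0" using \<tau> R_pos by simp
  \<comment> \<open>The narrowest strips searched have width \<open>R / 8\<close>, and
    \<open>\<eta> * R = 8 * \<eta> * (R / 8)\<close>; this is the source of the threshold
    \<open>8 * \<eta>\<close>.\<close>
  note vert = exists_good_side[OF cont_h1 h1_nonneg integral_h1, where c="8 * \<eta>"]
  note horiz = exists_good_side[OF cont_h2 h2_nonneg integral_h2, where c="8 * \<eta>"]
  obtain a0 where a0: "a0 \<in> {- (5 * R / 8)..- (R / 2)}" "h1 a0 \<le> 8 * \<eta>"
    using vert[of "- (5 * R / 8)" "- (R / 2)"] R_pos energy by (auto simp: algebra_simps)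
  obtain a1 where a1: "a1 \<in> {R / 2..5 * R / 8}" "h1 a1 \<le> 8 * \<eta>"
    using vert[of "R / 2" "5 * R / 8"] R_pos energy by (auto simp: algebra_simps)
  obtain b0 where b0: "b0 \<in> {- (5 * R / 8)..- (R / 2)}" "h2 b0 \<le> 8 * \<eta>"
    using horiz[of "- (5 * R / 8)" "- (R / 2)"] R_pos energy by (auto simp: algebra_simps)
  obtain b1 where b1: "b1 \<in> {R / 2..5 * R / 8}" "h2 b1 \<le> 8 * \<eta>"
    using horiz[of "R / 2" "5 * R / 8"] R_pos energy by (auto simp: algebra_simps)
  obtain c0 where c0: "c0 \<in> {-R..- (3 * R / 4)}" "h1 c0 \<le> 8 * \<eta>"
    using vert[of "-R" "- (3 * R / 4)"] R_pos energy \<eta>R by (auto simp: algebra_simps)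
  obtain c1 where c1: "c1 \<in> {3 * R / 4..R}" "h1 c1 \<le> 8 * \<eta>"
    using vert[of "3 * R / 4" R] R_pos energy \<eta>R by (auto simp: algebra_simps)
  obtain d0 where d0: "d0 \<in> {-R..- (3 * R / 4)}" "h2 d0 \<le> 8 * \<eta>"
    using horiz[of "-R" "- (3 * R / 4)"] R_pos energy \<eta>R by (auto simp: algebra_simps)
  obtain d1 where d1: "d1 \<in> {3 * R / 4..R}" "h2 d1 \<le> 8 * \<eta>"
    using horiz[of "3 * R / 4" R] R_pos energy \<eta>R by (auto simp: algebra_simps)
  have small: "\<epsilon> * h < x" if "h < \<tau>" "\<epsilon> * \<tau> \<le> x" for h x
    using mult_strict_left_mono[OF that(1) eps_pos] that(2) by linarith
  have bounded: "norm (U (s, t)) \<le> R0 + 1" if "s \<in> {c0..c1}" "t \<in> {d0..d1}" for s t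
  proof (rule interior_sup_bound[of c0 c1 d0 d1])
    fix a b assume ab: "a \<in> {c0..c1}" "b \<in> {d0..d1}" "a = c0 \<or> a = c1 \<or> b = d0 \<or> b = d1"
    then have R: "a \<in> {-R..R}" "b \<in> {-R..R}" using c0 c1 d0 d1 by auto
    from ab(3) have "h1 a \<le> 8 * \<eta> \<or> h2 b \<le> 8 * \<eta>" using c0 c1 d0 d1 by auto
    then have "h1 a < \<tau> \<or> h2 b < \<tau>" using \<tau> by linarith
    then show "norm (U (a, b)) \<le> R0 + 1"
      using line_bounded1[OF R(1) m1 _ _ R(2)] line_bounded2[OF R(2) m1 _ _ R(1)] \<tau>(1) small[OF _ \<epsilon>(2)]
      by force
  qed (use c0 c1 d0 d1 that R_pos in auto)
  \<comment> \<open>Constant of the gradient bound for values of norm at most \<open>R0 + 1\<close>.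
    Where \<open>V \<ge> m2\<close> the gradient energy is at most
    \<open>P\<^sup>2 / \<epsilon>\<close>, hence at most \<open>P\<^sup>2 / m2\<close> times
    \<open>V / \<epsilon>\<close>; the \<open>+ 1\<close> in \<open>C\<close> is the potential
    itself.\<close>
  define P where "P = 3 * (2 * (R0 + 1) + L + 1)"
  have "norm (G 0) \<le> L" using R0_pos by (intro L) auto
  then have "L \<ge> 0" using norm_ge_zero[of "G 0"] by linarith
  then have "P > 0" unfolding P_def using R0_pos by simp
  have "integral (cbox (- (R / 2), - (R / 2)) (R / 2, R / 2)) e \<le> integral (cbox (a0, b0) (a1, b1)) e"
    using a0 a1 b0 b1 R_pos
    by (intro integral_subset_le integrable_subrectangle(1) cont_e) (auto simp: cbox_Pair_eq e_nonneg)
  also have "\<dots> \<le> 12 * C * (8 * \<eta>) * energy / \<tau>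
      + (32 * C + 16 * real (card W)) * (\<kappa>0 * sqrt \<epsilon> * (4 * (8 * \<eta>) + 8 * R))"
  proof (rule energy_on_rectangle[where \<kappa>=\<kappa> and \<delta>=\<delta> and ?\<kappa>1.0=\<kappa>1 and ?\<delta>1.0=\<delta>1])
    fix a assume a: "a \<in> {-R..R}"
    show "\<exists>\<sigma>\<in>W. \<forall>b\<in>{-R..R}. norm (U (a, b) - \<sigma>) < \<kappa>" if "h1 a < \<tau>"
      using \<tau>(2) small[OF that \<epsilon>(3)] that by (intro line_near_well1[OF a \<kappa>(1,2) m3]) auto
    show "\<exists>\<sigma>\<in>W. \<forall>b\<in>{-R..R}. norm (U (b, a) - \<sigma>) < \<kappa>" if "h2 a < \<tau>"
      using \<tau>(2) small[OF that \<epsilon>(3)] that by (intro line_near_well2[OF a \<kappa>(1,2) m3]) auto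
  next
    fix p assume p: "p \<in> cbox (a0, b0) (a1, b1)" and "\<And>\<sigma>. \<sigma> \<in> W \<Longrightarrow> norm (U p - \<sigma>) \<ge> \<kappa>1"
    then have V: "V (U p) \<ge> m2" using m2(2) by blast
    obtain a b where [simp]: "p = (a, b)" by (cases p)
    have ab: "a \<in> {a0..a1}" "b \<in> {b0..b1}" using p by (auto simp: cbox_Pair_eq)
    have sub: "{a - \<epsilon>..a + \<epsilon>} \<subseteq> {c0..c1}" "{b - \<epsilon>..b + \<epsilon>} \<subseteq> {d0..d1}"
      using ab a0 a1 b0 b1 c0 c1 d0 d1 \<epsilon>(1) by auto
    have sub': "{a - \<epsilon>..a + \<epsilon>} \<subseteq> {-R..R}" "{b - \<epsilon>..b + \<epsilon>} \<subseteq> {-R..R}"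
      using sub c0 c1 d0 d1 by auto
    have g: "norm (U1 p) \<le> P / \<epsilon>" "norm (U2 p) \<le> P / \<epsilon>"
      using gradient_bound1[OF sub' bounded L] gradient_bound2[OF sub' bounded L] sub
      by (auto simp: P_def)
    have "(norm (U1 p))\<^sup>2 + (norm (U2 p))\<^sup>2 \<le> (P / \<epsilon>)\<^sup>2 + (P / \<epsilon>)\<^sup>2"
      using g by (intro add_mono power_mono) auto
    then have "\<epsilon> * ((norm (U1 p))\<^sup>2 + (norm (U2 p))\<^sup>2) / 2 \<le> \<epsilon> * ((P / \<epsilon>)\<^sup>2 + (P / \<epsilon>)\<^sup>2) / 2"
      using eps_pos by (intro divide_right_mono mult_left_mono) auto
    also have "\<dots> = P\<^sup>2 / \<epsilon> * 1"
      using eps_pos by (simp add: power2_eq_square)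
    also have "\<dots> \<le> P\<^sup>2 / \<epsilon> * (V (U p) / m2)"
      using V m2(1) eps_pos by (intro mult_left_mono) auto
    finally show "e p \<le> C * (V (U p) / \<epsilon>)"
      by (simp add: e_def C(1) P_def algebra_simps)
  next
    show "C \<ge> 0"
      using m2(1) by (simp add: C(1))
  qed (use a0 a1 b0 b1 R_pos assms in auto)
  finally show ?thesis .
qed

end

context potential
begin

lemma exists_cutoff_radius:
  assumes "0 < \<delta>" "\<delta> \<le> 1/2"
  shows "\<exists>\<kappa>>0. \<kappa> \<le> \<kappa>0 \<and> \<kappa>\<^sup>2 * (exp (1 / \<delta>) - 1) = \<kappa>0\<^sup>2"
proof -
  have "2 \<le> 1 / \<delta>" using assms by (simp add: field_simps)
  then have "exp (1 / \<delta>) \<ge> 2"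
    using exp_ge_add_one_self[of "1 / \<delta>"] by linarith
  define z where "z = sqrt (exp (1 / \<delta>) - 1)"
  have z: "z \<ge> 1" "z\<^sup>2 = exp (1 / \<delta>) - 1"
    using \<open>exp (1 / \<delta>) \<ge> 2\<close> assms by (simp_all add: z_def)
  show ?thesis
  proof (intro exI[of _ "\<kappa>0 / z"] conjI)
    show "\<kappa>0 / z \<le> \<kappa>0"
      using z(1) \<kappa>0_pos by (simp add: field_simps)
    show "(\<kappa>0 / z)\<^sup>2 * (exp (1 / \<delta>) - 1) = \<kappa>0\<^sup>2"
      using z by (simp add: power_divide z(2)[symmetric])
  qed (use z \<kappa>0_pos in auto)
qed

text \<open>The constants are chosen in the order \<open>\<delta>1\<close>,
  \<open>\<kappa>1\<close>, \<open>m2\<close>, \<open>C\<close>, \<open>\<delta>\<close>,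
  \<open>\<kappa>\<close>, \<open>m3\<close>, \<open>\<tau>\<close>, \<open>\<eta>\<close>, each
  from the previous ones, the potential and \<open>\<theta>\<close>. None involves \<open>R\<close>,
  so \<open>\<eta>\<close> serves at every scale; only \<open>\<epsilon>0\<close> depends on
  \<open>R\<close> and on the tolerated error \<open>s\<close>.\<close>

lemma energy_decay:
  assumes "\<theta> > 0"
  obtains \<eta> where "\<eta> > 0"
    "\<And>R s. R > 0 \<Longrightarrow> s > 0 \<Longrightarrow> \<exists>\<epsilon>0>0. \<forall>\<epsilon> U U1 U2 U11 U12 U22.
      planar_solution V G W \<kappa>0 R0 \<epsilon> R U U1 U2 U11 U12 U22 \<longrightarrow> \<epsilon> < \<epsilon>0 \<longrightarrow>
      integral (cbox (-R, -R) (R, R)) (planar_solution.e V \<epsilon> U U1 U2) \<le> \<eta> * R \<longrightarrow>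
      integral (cbox (- (R / 2), - (R / 2)) (R / 2, R / 2)) (planar_solution.e V \<epsilon> U U1 U2)
        \<le> \<theta> * integral (cbox (-R, -R) (R, R)) (planar_solution.e V \<epsilon> U U1 U2) + s"
proof -
  obtain m1 where m1: "m1 > 0" "\<And>y. norm y \<ge> R0 \<Longrightarrow> V y \<ge> m1"
    using lower_bound_far by blast
  have "compact (G ` cball 0 (R0 + 1))"
    using cont_G by (intro compact_continuous_image compact_cball) (rule continuous_on_subset, auto)
  then obtain L where L: "\<And>y. norm y \<le> R0 + 1 \<Longrightarrow> norm (G y) \<le> L"
    by (force dest!: compact_imp_bounded simp: bounded_iff)
  define q where "q = real (card W)"
  have "q \<ge> 0" by (simp add: q_def)
  define \<delta>1 where "\<delta>1 = 1 / (64 * (q + 1))"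
  have \<delta>1: "0 < \<delta>1" "\<delta>1 \<le> 1/2" "64 * q * \<delta>1 \<le> 1"
    using \<open>q \<ge> 0\<close> by (simp_all add: \<delta>1_def field_simps)
  obtain \<kappa>1 where \<kappa>1: "\<kappa>1 > 0" "\<kappa>1 \<le> \<kappa>0" "\<kappa>1\<^sup>2 * (exp (1 / \<delta>1) - 1) = \<kappa>0\<^sup>2"
    using exists_cutoff_radius[OF \<delta>1(1,2)] by blast
  obtain m2 where m2: "m2 > 0" "\<And>y. (\<And>\<sigma>. \<sigma> \<in> W \<Longrightarrow> norm (y - \<sigma>) \<ge> \<kappa>1) \<Longrightarrow> V y \<ge> m2"
    using lower_bound_off_wells[OF \<kappa>1(1)] by blast
  define C where "C = (3 * (2 * (R0 + 1) + L + 1))\<^sup>2 / m2 + 1"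
  have "C \<ge> 1" using m2(1) by (simp add: C_def)
  define \<delta> where "\<delta> = 1 / (256 * C)"
  have \<delta>: "0 < \<delta>" "\<delta> \<le> 1/2" "256 * C * \<delta> \<le> 1"
    using \<open>C \<ge> 1\<close> by (simp_all add: \<delta>_def field_simps)
  obtain \<kappa> where \<kappa>: "\<kappa> > 0" "\<kappa> \<le> \<kappa>0" "\<kappa>\<^sup>2 * (exp (1 / \<delta>) - 1) = \<kappa>0\<^sup>2"
    using exists_cutoff_radius[OF \<delta>(1,2)] by blast
  obtain m3 where m3: "m3 > 0" "\<And>y. (\<And>\<sigma>. \<sigma> \<in> W \<Longrightarrow> norm (y - \<sigma>) \<ge> \<kappa> / 2) \<Longrightarrow> V y \<ge> m3"
    using lower_bound_off_wells[of "\<kappa> / 2"] \<kappa>(1) by auto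
  define \<tau> where "\<tau> = min (sqrt (2 * m1)) (sqrt (2 * m3) * (\<kappa> / 2))"
  have \<tau>: "\<tau> > 0" "\<tau> \<le> sqrt (2 * m1)" "\<tau> \<le> sqrt (2 * m3) * (\<kappa> / 2)"
    using m1(1) m3(1) \<kappa>(1) by (auto simp: \<tau>_def)
  \<comment> \<open>The 1/16 keeps the chosen sides, of energy at most \<open>8 * \<eta>\<close>,
    strictly below the threshold \<open>\<tau>\<close>; the other bound turns
    \<open>12 * C * (8 * \<eta>) / \<tau>\<close> into at most \<open>\<theta>\<close>.\<close>
  define \<eta> where "\<eta> = \<tau> * min (1/16) (\<theta> / (96 * C))"
  have \<eta>: "\<eta> > 0" "8 * \<eta> < \<tau>" "12 * C * (8 * \<eta>) / \<tau> \<le> \<theta>"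
  proof -
    show "\<eta> > 0" using \<tau> \<open>C \<ge> 1\<close> assms by (simp add: \<eta>_def)
    have "\<eta> \<le> \<tau> * (1/16)" unfolding \<eta>_def using \<tau> by (intro mult_left_mono) auto
    then show "8 * \<eta> < \<tau>" using \<tau> by linarith
    have "\<eta> \<le> \<tau> * (\<theta> / (96 * C))" unfolding \<eta>_def using \<tau> by (intro mult_left_mono) auto
    then show "12 * C * (8 * \<eta>) / \<tau> \<le> \<theta>" using \<tau> \<open>C \<ge> 1\<close> by (simp add: field_simps)
  qed
  show thesis
  proof (rule that[OF \<eta>(1)])
    fix R s :: real assume R: "R > 0" and s: "s > 0"
    define K where "K = (32 * C + 16 * q) * \<kappa>0 * (32 * \<eta> + 8 * R)"
    have K: "K > 0" unfolding K_def using \<open>C \<ge> 1\<close> \<open>q \<ge> 0\<close> \<kappa>0_pos \<eta>(1) R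
      by (intro mult_pos_pos add_pos_nonneg) auto
    \<comment> \<open>The entries give, in order, room for the gradient squares, a starting point on
      good lines for the sup bound and for closeness to a well, and
      \<open>K * sqrt \<epsilon> \<le> s\<close>.\<close>
    define \<epsilon>0 where "\<epsilon>0 = Min {R / 8, 2 * R * m1 / \<tau>, 2 * R * m3 / \<tau>, (s / K)\<^sup>2}"
    have "\<epsilon>0 > 0" unfolding \<epsilon>0_def using R s K m1(1) m3(1) \<tau> by simp
    moreover have "integral (cbox (- (R / 2), - (R / 2)) (R / 2, R / 2)) (planar_solution.e V \<epsilon> U U1 U2)
        \<le> \<theta> * integral (cbox (-R, -R) (R, R)) (planar_solution.e V \<epsilon> U U1 U2) + s"
      if sol: "planar_solution V G W \<kappa>0 R0 \<epsilon> R U U1 U2 U11 U12 U22" and "\<epsilon> < \<epsilon>0"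
        and E: "integral (cbox (-R, -R) (R, R)) (planar_solution.e V \<epsilon> U U1 U2) \<le> \<eta> * R"
      for \<epsilon> U U1 U2 U11 U12 U22
    proof -
      interpret s: planar_solution V G W \<kappa>0 R0 \<epsilon> R U U1 U2 U11 U12 U22 by (rule sol)
      have \<epsilon>: "\<epsilon> \<le> R / 8" "\<epsilon> \<le> 2 * R * m1 / \<tau>" "\<epsilon> \<le> 2 * R * m3 / \<tau>" "\<epsilon> \<le> (s / K)\<^sup>2"
        using \<open>\<epsilon> < \<epsilon>0\<close> by (auto simp: \<epsilon>0_def)
      have "sqrt \<epsilon> \<le> s / K"
        using \<epsilon>(4) s K by (intro real_le_lsqrt) auto
      then have err: "K * sqrt \<epsilon> \<le> s" using K by (simp add: field_simps)
      have "integral (cbox (- (R / 2), - (R / 2)) (R / 2, R / 2)) s.e \<le> 12 * C * (8 * \<eta>) * s.energy / \<tau>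
          + (32 * C + 16 * q) * (\<kappa>0 * sqrt \<epsilon> * (4 * (8 * \<eta>) + 8 * R))"
        unfolding q_def
        using \<epsilon> \<tau> E
        by (intro s.energy_on_half_square[OF m1 L \<kappa> \<delta>(1,2) \<kappa>1(1,3) \<delta>1[unfolded q_def] m2 m3 C_def \<delta>(3) \<tau>(2,3) \<eta>(2,1)])
           (auto simp: field_simps s.energy_def)
      also have "\<dots> = (12 * C * (8 * \<eta>) / \<tau>) * s.energy + K * sqrt \<epsilon>"
        by (simp add: K_def algebra_simps)
      also have "\<dots> \<le> \<theta> * s.energy + s"
        using \<eta>(3) err s.energy_nonneg by (intro add_mono mult_right_mono)
      finally show ?thesis by (simp add: s.energy_def)
    qed
    ultimately show "\<exists>\<epsilon>0>0. \<forall>\<epsilon> U U1 U2 U11 U12 U22.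
      planar_solution V G W \<kappa>0 R0 \<epsilon> R U U1 U2 U11 U12 U22 \<longrightarrow> \<epsilon> < \<epsilon>0 \<longrightarrow>
      integral (cbox (-R, -R) (R, R)) (planar_solution.e V \<epsilon> U U1 U2) \<le> \<eta> * R \<longrightarrow>
      integral (cbox (- (R / 2), - (R / 2)) (R / 2, R / 2)) (planar_solution.e V \<epsilon> U U1 U2)
        \<le> \<theta> * integral (cbox (-R, -R) (R, R)) (planar_solution.e V \<epsilon> U U1 U2) + s"
      by blast
  qed
qed

end

section \<open>From smooth maps to the square\<close>

lemma smooth_on_partial: "smooth_on S f \<Longrightarrow> smooth_on S (partial i f)"
  unfolding smooth_on_def by (metis Ck_on.simps(2))

lemma smooth_on_imp_continuous_on: "smooth_on S f \<Longrightarrow> continuous_on S f"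
  unfolding smooth_on_def by (metis Ck_on.simps(1))

lemma smooth_on_has_derivative:
  assumes "smooth_on S f" "open S" "x \<in> S"
  shows "(f has_derivative frechet_derivative f (at x)) (at x)"
proof -
  have "f differentiable_on S"
    using assms(1) unfolding smooth_on_def by (metis Ck_on.simps(2))
  then show ?thesis
    using assms(2,3) by (simp add: differentiable_on_eq_differentiable_at frechet_derivative_works)
qed

lemma frechet_derivative_eq_sum_partial:
  fixes f :: "real^'n \<Rightarrow> 'b::real_normed_vector"
  assumes "smooth_on S f" "open S" "x \<in> S"
  shows "frechet_derivative f (at x) h = (\<Sum>i\<in>UNIV. h $ i *\<^sub>R partial i f x)"
proof -
  have lin: "linear (frechet_derivative f (at x))"
    using smooth_on_has_derivative[OF assms] by (rule has_derivative_linear)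
  have "h = (\<Sum>i\<in>UNIV. h $ i *\<^sub>R axis i 1)"
    by (simp add: vec_eq_iff axis_def if_distrib[of "\<lambda>x. _ * x"] cong: if_cong)
  then have "frechet_derivative f (at x) h = frechet_derivative f (at x) (\<Sum>i\<in>UNIV. h $ i *\<^sub>R axis i 1)"
    by simp
  also have "\<dots> = (\<Sum>i\<in>UNIV. h $ i *\<^sub>R partial i f x)"
    by (simp add: linear_sum[OF lin] linear_scale[OF lin] partial_def)
  finally show ?thesis .
qed

lemma has_derivative_grad:
  fixes f :: "real^'n \<Rightarrow> real"
  assumes "smooth_on S f" "open S" "x \<in> S"
  shows "(f has_derivative (\<lambda>h. grad f x \<bullet> h)) (at x)"
proof -
  have "frechet_derivative f (at x) = (\<lambda>h. grad f x \<bullet> h)"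
    using frechet_derivative_eq_sum_partial[OF assms] by (auto simp: fun_eq_iff grad_def inner_vec_def mult.commute)
  then show ?thesis
    using smooth_on_has_derivative[OF assms] by simp
qed

lemma grad_along_line:
  fixes V :: "real^'n \<Rightarrow> real"
  assumes "smooth_on UNIV V"
  shows "((\<lambda>t. V (x + t *\<^sub>R k)) has_real_derivative grad V (x + t *\<^sub>R k) \<bullet> k) (at t)"
    and "((\<lambda>t. grad V (x + t *\<^sub>R k) \<bullet> k) has_real_derivative k \<bullet> (hessian V (x + t *\<^sub>R k) *v k)) (at t)"
proof -
  have gen: "((\<lambda>t. f (x + t *\<^sub>R k)) has_real_derivative grad f (x + t *\<^sub>R k) \<bullet> k) (at t)"
    if "smooth_on UNIV f" for f :: "real^'n \<Rightarrow> real" and t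
  proof -
    have "((\<lambda>t. x + t *\<^sub>R k) has_derivative (\<lambda>h. h *\<^sub>R k)) (at t)"
      by (auto intro!: derivative_eq_intros)
    from has_derivative_compose[OF this has_derivative_grad[OF that open_UNIV UNIV_I]]
    show ?thesis
      by (simp add: has_field_derivative_def mult_commute_abs)
  qed
  show "((\<lambda>t. V (x + t *\<^sub>R k)) has_real_derivative grad V (x + t *\<^sub>R k) \<bullet> k) (at t)"
    by (rule gen[OF assms])
  have "((\<lambda>t. \<Sum>j\<in>UNIV. partial j V (x + t *\<^sub>R k) * k $ j) has_real_derivative
      (\<Sum>j\<in>UNIV. (grad (partial j V) (x + t *\<^sub>R k) \<bullet> k) * k $ j)) (at t)"
    by (intro DERIV_sum DERIV_cmult_right gen smooth_on_partial assms)
  moreover have "(\<Sum>j\<in>UNIV. (grad (partial j V) y \<bullet> k) * k $ j) = k \<bullet> (hessian V y *v k)" for y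
  proof -
    have "(\<Sum>j\<in>UNIV. (grad (partial j V) y \<bullet> k) * k $ j)
        = (\<Sum>j\<in>UNIV. \<Sum>i\<in>UNIV. k $ i * (partial i (partial j V) y * k $ j))"
      by (simp add: grad_def inner_vec_def sum_distrib_left sum_distrib_right mult_ac)
    also have "\<dots> = (\<Sum>i\<in>UNIV. \<Sum>j\<in>UNIV. k $ i * (partial i (partial j V) y * k $ j))"
      by (rule sum.swap)
    also have "\<dots> = k \<bullet> (hessian V y *v k)"
      by (simp add: hessian_def inner_vec_def matrix_vector_mult_def sum_distrib_left)
    finally show ?thesis .
  qed
  ultimately show "((\<lambda>t. grad V (x + t *\<^sub>R k) \<bullet> k) has_real_derivative k \<bullet> (hessian V (x + t *\<^sub>R k) *v k)) (at t)"
    by (simp add: grad_def inner_vec_def)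
qed

text \<open>On the unit sphere the form at \<open>\<sigma>\<close> has a positive minimum
  \<open>\<mu>\<close>. The entrywise distance \<open>D y\<close> of the two Hessians bounds the
  difference of the forms and is below \<open>\<mu>\<close> near \<open>\<sigma>\<close>.\<close>

lemma hessian_nonneg_near:
  fixes V :: "real^'n \<Rightarrow> real"
  assumes "smooth_on UNIV V" "pos_definite (hessian V \<sigma>)"
  shows "\<exists>\<kappa>>0. \<forall>y k. norm (y - \<sigma>) < \<kappa> \<longrightarrow> 0 \<le> k \<bullet> (hessian V y *v k)"
proof -
  define D where "D y = (\<Sum>i\<in>UNIV. \<Sum>j\<in>UNIV. \<bar>hessian V y $ i $ j - hessian V \<sigma> $ i $ j\<bar>)" for y
  have contH: "continuous_on UNIV (\<lambda>y. hessian V y $ i $ j)" for i j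
    unfolding hessian_def using smooth_on_imp_continuous_on[OF smooth_on_partial[OF smooth_on_partial[OF assms(1)]]]
    by simp
  have contD: "continuous_on UNIV D"
    unfolding D_def by (intro continuous_intros contH)
  have compact: "compact (sphere (0::real^'n) 1)" by simp
  have "continuous_on (sphere 0 1) (\<lambda>k. k \<bullet> (hessian V \<sigma> *v k))"
    by (intro continuous_intros)
  moreover have "sphere (0::real^'n) 1 \<noteq> {}" by (simp add: sphere_eq_empty)
  ultimately obtain z where z: "z \<in> sphere 0 1" "\<And>k. k \<in> sphere 0 1 \<Longrightarrow> z \<bullet> (hessian V \<sigma> *v z) \<le> k \<bullet> (hessian V \<sigma> *v k)"
    using continuous_attains_inf[OF compact] by blast
  define \<mu> where "\<mu> = z \<bullet> (hessian V \<sigma> *v z)"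
  have "\<mu> > 0"
  proof -
    have "z \<noteq> 0" using z(1) by auto
    then show ?thesis
      using assms(2) by (simp add: \<mu>_def pos_definite_def)
  qed
  have coer: "\<mu> * (norm k)\<^sup>2 \<le> k \<bullet> (hessian V \<sigma> *v k)" for k
  proof (cases "k = 0")
    case False
    then have "\<mu> \<le> (k /\<^sub>R norm k) \<bullet> (hessian V \<sigma> *v (k /\<^sub>R norm k))"
      unfolding \<mu>_def by (intro z(2)) simp
    also have "\<dots> = (k \<bullet> (hessian V \<sigma> *v k)) / (norm k)\<^sup>2"
      using False by (simp add: matrix_vector_mult_scaleR field_simps power2_eq_square)
    finally show ?thesis using False by (simp add: field_simps)
  qed simp
  have pert: "\<bar>k \<bullet> (hessian V y *v k) - k \<bullet> (hessian V \<sigma> *v k)\<bar> \<le> D y * (norm k)\<^sup>2" for y k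
  proof -
    have "k \<bullet> (hessian V y *v k) - k \<bullet> (hessian V \<sigma> *v k)
        = (\<Sum>i\<in>UNIV. \<Sum>j\<in>UNIV. k $ i * ((hessian V y $ i $ j - hessian V \<sigma> $ i $ j) * k $ j))"
      by (simp add: inner_vec_def matrix_vector_mult_def sum_distrib_left sum_subtractf algebra_simps)
    also have "\<bar>\<dots>\<bar> \<le> (\<Sum>i\<in>UNIV. \<Sum>j\<in>UNIV. \<bar>hessian V y $ i $ j - hessian V \<sigma> $ i $ j\<bar> * (norm k)\<^sup>2)"
    proof (intro order_trans[OF sum_abs] sum_mono)
      fix i j
      have "\<bar>k $ i\<bar> * \<bar>k $ j\<bar> \<le> norm k * norm k"
        by (intro mult_mono component_le_norm_cart) auto
      then have "\<bar>hessian V y $ i $ j - hessian V \<sigma> $ i $ j\<bar> * (\<bar>k $ i\<bar> * \<bar>k $ j\<bar>)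
          \<le> \<bar>hessian V y $ i $ j - hessian V \<sigma> $ i $ j\<bar> * (norm k * norm k)"
        by (intro mult_left_mono) auto
      then show "\<bar>k $ i * ((hessian V y $ i $ j - hessian V \<sigma> $ i $ j) * k $ j)\<bar>
          \<le> \<bar>hessian V y $ i $ j - hessian V \<sigma> $ i $ j\<bar> * (norm k)\<^sup>2"
        by (simp add: abs_mult power2_eq_square mult_ac)
    qed
    finally show ?thesis by (simp add: D_def sum_distrib_right)
  qed
  have "D \<sigma> = 0" by (simp add: D_def)
  then obtain \<kappa> where \<kappa>: "\<kappa> > 0" "\<And>y. dist y \<sigma> < \<kappa> \<Longrightarrow> \<bar>D y\<bar> < \<mu>"
    using contD \<open>\<mu> > 0\<close> unfolding continuous_on_iff by (metis UNIV_I diff_zero dist_real_def)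
  have "0 \<le> k \<bullet> (hessian V y *v k)" if "norm (y - \<sigma>) < \<kappa>" for y k
  proof -
    have "D y * (norm k)\<^sup>2 \<le> \<mu> * (norm k)\<^sup>2"
      using \<kappa>(2)[of y] that by (intro mult_right_mono) (auto simp: dist_norm)
    then show ?thesis
      using pert[of k y] coer[of k] by linarith
  qed
  then show ?thesis using \<kappa>(1) by blast
qed

text \<open>\<open>V\<close> is convex along segments issued from a nearby well, hence lies below its tangents there.\<close>

lemma well_inequality:
  fixes V :: "real^'n \<Rightarrow> real"
  assumes "smooth_on UNIV V" "pos_definite (hessian V \<sigma>)" "V \<sigma> = 0"
  shows "\<exists>\<kappa>>0. \<forall>y. norm (y - \<sigma>) < \<kappa> \<longrightarrow> V y \<le> grad V y \<bullet> (y - \<sigma>)"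
proof -
  obtain \<kappa> where \<kappa>: "\<kappa> > 0" "\<And>y k. norm (y - \<sigma>) < \<kappa> \<Longrightarrow> 0 \<le> k \<bullet> (hessian V y *v k)"
    using hessian_nonneg_near[OF assms(1,2)] by blast
  have "V y \<le> grad V y \<bullet> (y - \<sigma>)" if y: "norm (y - \<sigma>) < \<kappa>" for y
  proof -
    define k where "k = y - \<sigma>"
    note d = grad_along_line[OF assms(1), of \<sigma> k]
    obtain z where z: "0 < z" "z < 1" "V (\<sigma> + 1 *\<^sub>R k) - V (\<sigma> + 0 *\<^sub>R k) = (1 - 0) * (grad V (\<sigma> + z *\<^sub>R k) \<bullet> k)"
      using MVT2[of 0 1 "\<lambda>t. V (\<sigma> + t *\<^sub>R k)" "\<lambda>t. grad V (\<sigma> + t *\<^sub>R k) \<bullet> k"] d(1) by auto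
    have "grad V (\<sigma> + z *\<^sub>R k) \<bullet> k \<le> grad V (\<sigma> + 1 *\<^sub>R k) \<bullet> k"
    proof (rule DERIV_nonneg_imp_nondecreasing[where f="\<lambda>t. grad V (\<sigma> + t *\<^sub>R k) \<bullet> k"])
      fix t assume t: "z \<le> t" "t \<le> 1"
      have "norm (t *\<^sub>R k) \<le> norm k"
        using t z by (simp add: mult_left_le_one_le)
      then have "norm (\<sigma> + t *\<^sub>R k - \<sigma>) < \<kappa>"
        using y by (simp add: k_def)
      then show "\<exists>y. ((\<lambda>t. grad V (\<sigma> + t *\<^sub>R k) \<bullet> k) has_real_derivative y) (at t) \<and> 0 \<le> y"
        using d(2) \<kappa>(2) by blast
    qed (use z in auto)
    then show ?thesis
      using z(3) assms(3) by (simp add: k_def)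
  qed
  then show ?thesis using \<kappa>(1) by blast
qed

text \<open>Each requirement on \<open>\<kappa>0\<close> holds for all small positive values at a
  given well or pair of wells; since the wells are finitely many, the filter
  \<open>at_right 0\<close> combines them into one radius. \<open>R + 1\<close> turns the strict
  condition \<open>norm y > R\<close> into a closed one.\<close>

lemma multiwell_potential_imp_potential:
  fixes V :: "real^'k::finite \<Rightarrow> real"
  assumes "multiwell_potential V"
  obtains \<kappa>0 R0 where "potential V (grad V) {y. V y = 0} \<kappa>0 R0"
proof -
  have smooth: "smooth_on UNIV V" and bdd: "bdd_below (range V)" and inf: "(INF y. V y) = 0"
    and fin: "finite {y. V y = 0}" and hess: "\<And>\<sigma>. V \<sigma> = 0 \<Longrightarrow> pos_definite (hessian V \<sigma>)"
    and coercive: "filterlim V at_top at_infinity"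
    using assms by (auto simp: multiwell_potential_def)
  obtain \<alpha> R where \<alpha>: "\<alpha> > 0" "R > 0" "\<And>y. norm y > R \<Longrightarrow> y \<bullet> grad V y \<ge> \<alpha> * (norm y)\<^sup>2"
    using assms by (auto simp: multiwell_potential_def)
  have "\<forall>\<sigma>\<in>{y. V y = 0}. eventually (\<lambda>\<kappa>. \<forall>y. norm (y - \<sigma>) \<le> \<kappa> \<longrightarrow> V y \<le> grad V y \<bullet> (y - \<sigma>)) (at_right 0)"
  proof
    fix \<sigma> assume "\<sigma> \<in> {y. V y = 0}"
    then obtain \<kappa> where \<kappa>: "\<kappa> > 0" "\<forall>y. norm (y - \<sigma>) < \<kappa> \<longrightarrow> V y \<le> grad V y \<bullet> (y - \<sigma>)"
      using well_inequality[OF smooth hess] by blast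
    have "eventually (\<lambda>k. k < \<kappa>) (at_right 0)"
      using \<kappa>(1) by (auto simp: eventually_at_right)
    then show "eventually (\<lambda>\<kappa>. \<forall>y. norm (y - \<sigma>) \<le> \<kappa> \<longrightarrow> V y \<le> grad V y \<bullet> (y - \<sigma>)) (at_right 0)"
      by eventually_elim (use \<kappa>(2) in auto)
  qed
  then have e1: "eventually (\<lambda>\<kappa>. \<forall>\<sigma>\<in>{y. V y = 0}. \<forall>y. norm (y - \<sigma>) \<le> \<kappa> \<longrightarrow> V y \<le> grad V y \<bullet> (y - \<sigma>)) (at_right 0)"
    by (rule eventually_ball_finite[OF fin])
  have e2: "eventually (\<lambda>\<kappa>::real. \<forall>\<sigma>\<in>{y. V y = 0}. \<forall>\<sigma>'\<in>{y. V y = 0}. \<sigma> \<noteq> \<sigma>' \<longrightarrow> norm (\<sigma> - \<sigma>') > 2 * \<kappa>) (at_right 0)"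
  proof (intro eventually_ball_finite fin ballI)
    fix \<sigma> \<sigma>'
    show "eventually (\<lambda>\<kappa>::real. \<sigma> \<noteq> \<sigma>' \<longrightarrow> norm (\<sigma> - \<sigma>') > 2 * \<kappa>) (at_right 0)"
    proof (cases "\<sigma> = \<sigma>'")
      case False
      then have "eventually (\<lambda>\<kappa>. \<kappa> < norm (\<sigma> - \<sigma>') / 2) (at_right 0)"
        unfolding eventually_at_right_field by (intro exI[of _ "norm (\<sigma> - \<sigma>') / 2"]) auto
      then show ?thesis by eventually_elim auto
    qed auto
  qed
  have e3: "eventually (\<lambda>\<kappa>::real. \<kappa> > 0) (at_right 0)"
    by (rule eventually_at_right_less)
  obtain \<kappa>0 where \<kappa>0: "\<kappa>0 > 0" "\<forall>\<sigma>\<in>{y. V y = 0}. \<forall>y. norm (y - \<sigma>) \<le> \<kappa>0 \<longrightarrow> V y \<le> grad V y \<bullet> (y - \<sigma>)"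
    "\<forall>\<sigma>\<in>{y. V y = 0}. \<forall>\<sigma>'\<in>{y. V y = 0}. \<sigma> \<noteq> \<sigma>' \<longrightarrow> norm (\<sigma> - \<sigma>') > 2 * \<kappa>0"
    using eventually_happens'[OF _ eventually_conj[OF e3 eventually_conj[OF e1 e2]]] by auto
  obtain B where B: "\<forall>\<sigma>\<in>{y. V y = 0}. norm \<sigma> < B"
    using finite_imp_bounded[OF fin] by (auto simp: bounded_pos_less)
  have "potential V (grad V) {y. V y = 0} \<kappa>0 (max B (R + 1))"
  proof
    show "V y \<ge> 0" for y
      using cINF_lower[OF bdd, of y] inf by simp
    show "(V has_derivative (\<bullet>) (grad V y)) (at y)" for y
      by (rule has_derivative_grad[OF smooth open_UNIV UNIV_I])
    show "continuous_on UNIV (grad V)"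
      unfolding grad_def[abs_def]
      by (intro continuous_on_vec_lambda smooth_on_imp_continuous_on smooth_on_partial smooth)
    show "y \<bullet> grad V y > 0" if "norm y \<ge> max B (R + 1)" for y
    proof -
      have "norm y > R" "norm y > 0" using that \<alpha>(2) by auto
      then show ?thesis
        using \<alpha>(3)[of y] \<alpha>(1) by (meson less_le_trans mult_pos_pos zero_less_power)
    qed
  qed (use \<kappa>0 fin coercive B \<alpha>(2) in \<open>auto simp: max_def\<close>)
  then show thesis by (rule that)
qed

section \<open>Symmetry of second derivatives\<close>

text \<open>The second difference \<open>\<Delta>\<close> over a square of side \<open>h\<close>
  equals \<open>h\<^sup>2\<close> times a value of \<open>f12\<close>, and also of
  \<open>f21\<close>, by the mean value theorem in the two orders. Continuity forces both values
  close to those at \<open>(a, b)\<close>.\<close>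

lemma mixed_partials_real:
  fixes f f1 f2 f12 f21 :: "real \<times> real \<Rightarrow> real"
  assumes "r > 0"
    and f1: "\<And>s t. \<bar>s - a\<bar> < r \<Longrightarrow> \<bar>t - b\<bar> < r \<Longrightarrow> ((\<lambda>s. f (s, t)) has_real_derivative f1 (s, t)) (at s)"
    and f2: "\<And>s t. \<bar>s - a\<bar> < r \<Longrightarrow> \<bar>t - b\<bar> < r \<Longrightarrow> ((\<lambda>t. f (s, t)) has_real_derivative f2 (s, t)) (at t)"
    and f12: "\<And>s t. \<bar>s - a\<bar> < r \<Longrightarrow> \<bar>t - b\<bar> < r \<Longrightarrow> ((\<lambda>t. f1 (s, t)) has_real_derivative f12 (s, t)) (at t)"
    and f21: "\<And>s t. \<bar>s - a\<bar> < r \<Longrightarrow> \<bar>t - b\<bar> < r \<Longrightarrow> ((\<lambda>s. f2 (s, t)) has_real_derivative f21 (s, t)) (at s)"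
    and cont: "isCont f12 (a, b)" "isCont f21 (a, b)"
  shows "f12 (a, b) = f21 (a, b)"
proof (rule ccontr)
  assume ne: "f12 (a, b) \<noteq> f21 (a, b)"
  define d where "d = \<bar>f12 (a, b) - f21 (a, b)\<bar> / 2"
  have "d > 0" using ne by (simp add: d_def)
  obtain \<delta>1 where \<delta>1: "\<delta>1 > 0" "\<And>p. dist p (a, b) < \<delta>1 \<Longrightarrow> \<bar>f12 p - f12 (a, b)\<bar> < d"
    using cont(1) \<open>d > 0\<close> unfolding continuous_at_eps_delta dist_real_def by blast
  obtain \<delta>2 where \<delta>2: "\<delta>2 > 0" "\<And>p. dist p (a, b) < \<delta>2 \<Longrightarrow> \<bar>f21 p - f21 (a, b)\<bar> < d"
    using cont(2) \<open>d > 0\<close> unfolding continuous_at_eps_delta dist_real_def by blast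
  define h where "h = min r (min \<delta>1 \<delta>2) / 3"
  have h: "h > 0" "h < r" "2 * h < \<delta>1" "2 * h < \<delta>2"
    using \<open>r > 0\<close> \<delta>1(1) \<delta>2(1) by (auto simp: h_def)
  have near: "dist (s, t) (a, b) \<le> 2 * h" if "a < s" "s < a + h" "b < t" "t < b + h" for s t
    using sqrt_sum_squares_le_sum_abs[of "s - a" "t - b"] that by (simp add: dist_prod_def dist_real_def)
  define \<Delta> where "\<Delta> = f (a + h, b + h) - f (a + h, b) - (f (a, b + h) - f (a, b))"
  obtain s t where st: "a < s" "s < a + h" "b < t" "t < b + h" "\<Delta> = h * (h * f12 (s, t))"
  proof -
    have "\<exists>z. a < z \<and> z < a + h \<and> (f (a + h, b + h) - f (a + h, b)) - (f (a, b + h) - f (a, b))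
        = (a + h - a) * (f1 (z, b + h) - f1 (z, b))"
      using h by (intro MVT2 DERIV_diff f1) auto
    then obtain s where s: "a < s" "s < a + h" "\<Delta> = h * (f1 (s, b + h) - f1 (s, b))"
      by (auto simp: \<Delta>_def)
    have "\<exists>z. b < z \<and> z < b + h \<and> f1 (s, b + h) - f1 (s, b) = (b + h - b) * f12 (s, z)"
      using h s by (intro MVT2 f12) auto
    then show thesis using s that by auto
  qed
  obtain s' t' where st': "a < s'" "s' < a + h" "b < t'" "t' < b + h" "\<Delta> = h * (h * f21 (s', t'))"
  proof -
    have "\<exists>z. b < z \<and> z < b + h \<and> (f (a + h, b + h) - f (a, b + h)) - (f (a + h, b) - f (a, b))
        = (b + h - b) * (f2 (a + h, z) - f2 (a, z))"
      using h by (intro MVT2 DERIV_diff f2) auto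
    then obtain t where t: "b < t" "t < b + h" "\<Delta> = h * (f2 (a + h, t) - f2 (a, t))"
      by (auto simp: \<Delta>_def algebra_simps)
    have "\<exists>z. a < z \<and> z < a + h \<and> f2 (a + h, t) - f2 (a, t) = (a + h - a) * f21 (z, t)"
      using h t by (intro MVT2 f21) auto
    then show thesis using t that by auto
  qed
  have "f12 (s, t) = f21 (s', t')"
    using st(5) st'(5) h(1) by simp
  moreover have "\<bar>f12 (s, t) - f12 (a, b)\<bar> < d"
    using near[OF st(1-4)] h by (intro \<delta>1(2)) auto
  moreover have "\<bar>f21 (s', t') - f21 (a, b)\<bar> < d"
    using near[OF st'(1-4)] h by (intro \<delta>2(2)) auto
  ultimately show False
    unfolding d_def by (smt (verit) field_sum_of_halves)
qed

section \<open>Product coordinates on the plane\<close>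

text \<open>Coordinates centred at \<open>c\<close>. The estimates live on
  \<open>real \<times> real\<close>, where Fubini for integrals over \<open>cbox\<close> applies;
  every centre becomes the origin there.\<close>

definition plane_point :: "real^2 \<Rightarrow> real \<times> real \<Rightarrow> real^2" where
  "plane_point c p = c + fst p *\<^sub>R axis 1 1 + snd p *\<^sub>R axis 2 1"

definition square :: "real^2 \<Rightarrow> real \<Rightarrow> (real^2) set" where
  "square c r = {x. \<bar>x $ 1 - c $ 1\<bar> \<le> r \<and> \<bar>x $ 2 - c $ 2\<bar> \<le> r}"

lemma plane_point_nth [simp]:
  "plane_point c p $ 1 = c $ 1 + fst p" "plane_point c p $ 2 = c $ 2 + snd p"
  by (simp_all add: plane_point_def axis_def)

lemma plane_point_in_square: "plane_point c p \<in> square c r \<longleftrightarrow> p \<in> cbox (-r, -r) (r, r)"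
  by (cases p) (auto simp: square_def cbox_Pair_eq abs_le_iff)

lemma continuous_on_plane_point: "continuous_on S (plane_point c)"
  unfolding plane_point_def[abs_def] by (intro continuous_intros)

lemma plane_point_has_derivative:
  "((\<lambda>t. plane_point c (t, b)) has_derivative (\<lambda>h. h *\<^sub>R axis 1 1)) (at a)"
  "((\<lambda>t. plane_point c (a, t)) has_derivative (\<lambda>h. h *\<^sub>R axis 2 1)) (at b)"
  unfolding plane_point_def by (auto intro!: derivative_eq_intros)

lemma partial_along_plane:
  fixes f :: "real^2 \<Rightarrow> 'b::real_normed_vector"
  assumes "smooth_on \<Omega> f" "open \<Omega>" "plane_point c (a, b) \<in> \<Omega>"
  shows "((\<lambda>t. f (plane_point c (t, b))) has_vector_derivative partial 1 f (plane_point c (a, b))) (at a)"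
    and "((\<lambda>t. f (plane_point c (a, t))) has_vector_derivative partial 2 f (plane_point c (a, b))) (at b)"
proof -
  note d = smooth_on_has_derivative[OF assms]
  have lin: "linear (frechet_derivative f (at (plane_point c (a, b))))"
    using d by (rule has_derivative_linear)
  show "((\<lambda>t. f (plane_point c (t, b))) has_vector_derivative partial 1 f (plane_point c (a, b))) (at a)"
    using has_derivative_compose[OF plane_point_has_derivative(1) d]
    by (simp add: has_vector_derivative_def partial_def linear_scale[OF lin])
  show "((\<lambda>t. f (plane_point c (a, t))) has_vector_derivative partial 2 f (plane_point c (a, b))) (at b)"
    using has_derivative_compose[OF plane_point_has_derivative(2) d]
    by (simp add: has_vector_derivative_def partial_def linear_scale[OF lin])
qed

text \<open>Pairing with the difference \<open>v\<close> of the two mixed derivatives reduces to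
  real-valued functions and yields \<open>v \<bullet> v = 0\<close>.\<close>

lemma mixed_partials:
  fixes f :: "real^2 \<Rightarrow> 'b::real_inner"
  assumes "smooth_on \<Omega> f" "open \<Omega>" "x \<in> \<Omega>"
  shows "partial 2 (partial 1 f) x = partial 1 (partial 2 f) x"
proof -
  define v where "v = partial 2 (partial 1 f) x - partial 1 (partial 2 f) x"
  obtain r where r: "r > 0" "ball x r \<subseteq> \<Omega>"
    using assms(2,3) open_contains_ball by blast
  have in_\<Omega>: "plane_point x (s, t) \<in> \<Omega>" if "\<bar>s - 0\<bar> < r / 2" "\<bar>t - 0\<bar> < r / 2" for s t
  proof -
    have "norm (plane_point x (s, t) - x) \<le> \<bar>s\<bar> + \<bar>t\<bar>"
      unfolding plane_point_def using norm_triangle_ineq[of "s *\<^sub>R axis 1 1" "t *\<^sub>R axis (2::2) (1::real)"] by simp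
    then show ?thesis
      using that r(2) by (auto simp: dist_norm norm_minus_commute)
  qed
  have der: "((\<lambda>t. g (plane_point x (t, b)) \<bullet> v) has_real_derivative partial 1 g (plane_point x (a, b)) \<bullet> v) (at a)"
    "((\<lambda>t. g (plane_point x (a, t)) \<bullet> v) has_real_derivative partial 2 g (plane_point x (a, b)) \<bullet> v) (at b)"
    if "smooth_on \<Omega> g" "\<bar>a - 0\<bar> < r / 2" "\<bar>b - 0\<bar> < r / 2" for g :: "real^2 \<Rightarrow> 'b" and a b
    using partial_along_plane[OF that(1) assms(2) in_\<Omega>[OF that(2,3)]]
    by (auto simp: has_real_derivative_iff_has_vector_derivative
        intro!: bounded_linear.has_vector_derivative[OF bounded_linear_inner_left])
  have cont: "isCont (\<lambda>p. g (plane_point x p) \<bullet> v) (0, 0)" if "smooth_on \<Omega> g" for g :: "real^2 \<Rightarrow> 'b"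
  proof -
    have "continuous (at (plane_point x (0, 0))) g"
      using smooth_on_imp_continuous_on[OF that] assms(2) in_\<Omega>[of 0 0] r(1)
      by (simp add: continuous_on_eq_continuous_at)
    moreover have "isCont (plane_point x) (0, 0)"
      using continuous_on_plane_point[of UNIV x] by (simp add: continuous_on_eq_continuous_at)
    ultimately have "isCont (\<lambda>p. g (plane_point x p)) (0, 0)"
      by (rule isCont_o2[rotated])
    then show ?thesis
      by (intro continuous_inner continuous_const)
  qed
  have "(\<lambda>p. partial 2 (partial 1 f) (plane_point x p) \<bullet> v) (0, 0)
      = (\<lambda>p. partial 1 (partial 2 f) (plane_point x p) \<bullet> v) (0, 0)"
    by (rule mixed_partials_real[where r="r / 2" and f="\<lambda>p. f (plane_point x p) \<bullet> v"
          and ?f1.0="\<lambda>p. partial 1 f (plane_point x p) \<bullet> v" and ?f2.0="\<lambda>p. partial 2 f (plane_point x p) \<bullet> v"];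
        rule der cont half_gt_zero; (rule smooth_on_partial assms(1) r(1) | assumption)+)
  then have "v \<bullet> v = 0"
    by (simp add: v_def plane_point_def inner_diff_left)
  then show ?thesis by (simp add: v_def)
qed

lemma solution_on_imp_planar_solution:
  fixes u :: "real^2 \<Rightarrow> real^'k::finite"
  assumes pot: "potential V (grad V) W \<kappa>0 R0" and sol: "solution_on V \<Omega> \<epsilon> u" and "open \<Omega>"
    and sub: "square c R \<subseteq> \<Omega>" and pos: "R > 0" "\<epsilon> > 0"
  defines "U \<equiv> \<lambda>f p. f (plane_point c p)"
  shows "planar_solution V (grad V) W \<kappa>0 R0 \<epsilon> R (U u) (U (partial 1 u)) (U (partial 2 u))
      (U (partial 1 (partial 1 u))) (U (partial 2 (partial 1 u))) (U (partial 2 (partial 2 u)))"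
proof -
  have smooth: "smooth_on \<Omega> u" using sol by (simp add: solution_on_def)
  have in_\<Omega>: "plane_point c (a, b) \<in> \<Omega>" if "a \<in> {-R..R}" "b \<in> {-R..R}" for a b
    using sub that plane_point_in_square[of c "(a, b)" R] by (auto simp: cbox_Pair_eq)
  have der: "((\<lambda>t. U f (t, b)) has_vector_derivative U (partial 1 f) (a, b)) (at a)"
    "((\<lambda>t. U f (a, t)) has_vector_derivative U (partial 2 f) (a, b)) (at b)"
    if "smooth_on \<Omega> f" "a \<in> {-R..R}" "b \<in> {-R..R}" for f :: "real^2 \<Rightarrow> real^'k" and a b
    unfolding U_def using partial_along_plane[OF that(1) \<open>open \<Omega>\<close> in_\<Omega>[OF that(2,3)]] .
  have cont: "continuous_on (cbox (-R, -R) (R, R)) (U f)" if "smooth_on \<Omega> f" for f :: "real^2 \<Rightarrow> real^'k"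
    unfolding U_def
    by (rule continuous_on_compose2[OF smooth_on_imp_continuous_on[OF that] continuous_on_plane_point])
       (use in_\<Omega> in \<open>auto simp: cbox_Pair_eq\<close>)
  have mixed: "U (partial 2 (partial 1 u)) (a, b) = U (partial 1 (partial 2 u)) (a, b)"
    if "a \<in> {-R..R}" "b \<in> {-R..R}" for a b
    unfolding U_def by (rule mixed_partials[OF smooth \<open>open \<Omega>\<close> in_\<Omega>[OF that]])
  interpret potential V "grad V" W \<kappa>0 R0 by (rule pot)
  show ?thesis
  proof
    fix a b assume ab: "a \<in> {-R..R}" "b \<in> {-R..R}"
    show "((\<lambda>t. U (partial 2 u) (t, b)) has_vector_derivative U (partial 2 (partial 1 u)) (a, b)) (at a)"
      unfolding mixed[OF ab] by (intro der smooth_on_partial smooth ab)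
    have "laplacian u (plane_point c (a, b)) = (1 / \<epsilon>\<^sup>2) *\<^sub>R grad V (u (plane_point c (a, b)))"
      using sol in_\<Omega>[OF ab] by (auto simp: solution_on_def)
    then show "U (partial 1 (partial 1 u)) (a, b) + U (partial 2 (partial 2 u)) (a, b)
        = (1 / \<epsilon>\<^sup>2) *\<^sub>R grad V (U u (a, b))"
      by (simp add: laplacian_def sum_2 U_def)
  qed (use pos in \<open>auto intro!: der cont smooth_on_partial smooth\<close>)
qed

lemma planar_energy_density:
  assumes "planar_solution V G W \<kappa>0 R0 \<epsilon> R (\<lambda>p. u (plane_point c p)) (\<lambda>p. partial 1 u (plane_point c p))
      (\<lambda>p. partial 2 u (plane_point c p)) U11 U12 U22"
  shows "planar_solution.e V \<epsilon> (\<lambda>p. u (plane_point c p)) (\<lambda>p. partial 1 u (plane_point c p))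
      (\<lambda>p. partial 2 u (plane_point c p)) = (\<lambda>p. energy_density V \<epsilon> u (plane_point c p))"
proof
  fix p
  interpret planar_solution V G W \<kappa>0 R0 \<epsilon> R "\<lambda>p. u (plane_point c p)" "\<lambda>p. partial 1 u (plane_point c p)"
      "\<lambda>p. partial 2 u (plane_point c p)" U11 U12 U22
    by (rule assms)
  show "e p = energy_density V \<epsilon> u (plane_point c p)"
    by (simp add: e_def energy_density_def sum_2)
qed

section \<open>Integrals over squares in the plane\<close>

text \<open>Lebesgue measure is determined by the volume of boxes, and the preimage of a box is a
  box with the same side lengths.\<close>

lemma lborel_plane_point: "(lborel :: (real^2) measure) = distr lborel borel (plane_point c)"
proof (rule lborel_eqI)
  have m: "plane_point c \<in> borel_measurable lborel"
    using borel_measurable_continuous_onI[OF continuous_on_plane_point] by simp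
  fix l u :: "real^2"
  assume le: "\<And>b. b \<in> Basis \<Longrightarrow> l \<bullet> b \<le> u \<bullet> b"
  then have le': "l $ i \<le> u $ i" for i
    using le[of "axis i 1"] by (simp add: inner_axis axis_in_Basis_iff)
  have B: "(Basis :: (real \<times> real) set) = {(1, 0), (0, 1)}"
    by (auto simp: Basis_prod_def)
  have "plane_point c -` box l u = box (l $ 1 - c $ 1, l $ 2 - c $ 2) (u $ 1 - c $ 1, u $ 2 - c $ 2)"
  proof (rule set_eqI)
    fix p :: "real \<times> real"
    have "p \<in> box (l $ 1 - c $ 1, l $ 2 - c $ 2) (u $ 1 - c $ 1, u $ 2 - c $ 2) \<longleftrightarrow>
        l $ 1 - c $ 1 < fst p \<and> fst p < u $ 1 - c $ 1 \<and> l $ 2 - c $ 2 < snd p \<and> snd p < u $ 2 - c $ 2"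
      by (cases p) (auto simp: mem_box B)
    also have "\<dots> \<longleftrightarrow> plane_point c p \<in> box l u"
      by (auto simp: mem_box_cart forall_2)
    finally show "p \<in> plane_point c -` box l u \<longleftrightarrow>
        p \<in> box (l $ 1 - c $ 1, l $ 2 - c $ 2) (u $ 1 - c $ 1, u $ 2 - c $ 2)"
      by simp
  qed
  then have "emeasure (distr lborel borel (plane_point c)) (box l u)
      = emeasure lborel (box (l $ 1 - c $ 1, l $ 2 - c $ 2) (u $ 1 - c $ 1, u $ 2 - c $ 2))"
    using m by (simp add: emeasure_distr)
  also have "\<dots> = ennreal ((u $ 1 - l $ 1) * (u $ 2 - l $ 2))"
    using le'[of 1] le'[of 2] by (simp add: emeasure_lborel_box_eq B)
  also have "(u $ 1 - l $ 1) * (u $ 2 - l $ 2) = (\<Prod>b\<in>Basis. (u - l) \<bullet> b)"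
  proof -
    have "(\<Prod>b\<in>Basis. (u - l) \<bullet> b) = (\<Prod>i\<in>UNIV. (u - l) $ i)"
      unfolding Basis_vec_def
      by (subst prod.UNION_disjoint) (auto simp: inner_axis axis_eq_axis)
    then show ?thesis by (simp add: UNIV_2)
  qed
  finally show "emeasure (distr lborel borel (plane_point c)) (box l u) = (\<Prod>b\<in>Basis. (u - l) \<bullet> b)" .
qed simp

lemma closed_square: "closed (square c r)"
  unfolding square_def by (intro closed_Collect_conj closed_Collect_le continuous_intros)

lemma square_subset_cball: "square c r \<subseteq> cball c (2 * r)"
proof
  fix x assume "x \<in> square c r"
  moreover have "norm (x - c) \<le> \<bar>(x - c) $ 1\<bar> + \<bar>(x - c) $ 2\<bar>"
    using norm_le_l1_cart[of "x - c"] by (simp add: sum_2)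
  ultimately show "x \<in> cball c (2 * r)"
    by (auto simp: square_def dist_norm norm_minus_commute)
qed

lemma compact_square: "compact (square c r)"
  using closed_square bounded_subset[OF bounded_cball square_subset_cball] by (simp add: compact_eq_bounded_closed)

lemma nn_integral_square:
  fixes f :: "real^2 \<Rightarrow> real"
  assumes cont: "continuous_on (square c r) f" and nonneg: "\<And>x. f x \<ge> 0"
  shows "(\<integral>\<^sup>+x. ennreal (f x) * indicator (square c r) x \<partial>lborel)
    = ennreal (integral (cbox (-r, -r) (r, r)) (\<lambda>p. f (plane_point c p)))"
proof -
  have m: "plane_point c \<in> borel_measurable lborel"
    using borel_measurable_continuous_onI[OF continuous_on_plane_point] by simp
  have "(\<lambda>x. indicator (square c r) x *\<^sub>R f x) \<in> borel_measurable borel"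
    using cont closed_square by (intro borel_measurable_continuous_on_indicator) auto
  then have "(\<lambda>x. ennreal (indicator (square c r) x *\<^sub>R f x)) \<in> borel_measurable borel"
    by measurable
  also have "(\<lambda>x. ennreal (indicator (square c r) x *\<^sub>R f x)) = (\<lambda>x. ennreal (f x) * indicator (square c r) x)"
    by (auto simp: fun_eq_iff indicator_def)
  finally have mf: "(\<lambda>x. ennreal (f x) * indicator (square c r) x) \<in> borel_measurable borel" .
  have "continuous_on (cbox (-r, -r) (r, r)) (\<lambda>p. f (plane_point c p))"
    by (rule continuous_on_compose2[OF cont continuous_on_plane_point]) (auto simp: plane_point_in_square)
  then have int: "((\<lambda>p. f (plane_point c p)) has_integral integral (cbox (-r, -r) (r, r)) (\<lambda>p. f (plane_point c p)))
      (cbox (-r, -r) (r, r))"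
    by (intro integrable_integral integrable_continuous)
  have "(\<integral>\<^sup>+x. ennreal (f x) * indicator (square c r) x \<partial>lborel)
      = (\<integral>\<^sup>+x. ennreal (f x) * indicator (square c r) x \<partial>distr lborel borel (plane_point c))"
    by (simp flip: lborel_plane_point)
  also have "\<dots> = (\<integral>\<^sup>+p. ennreal (f (plane_point c p)) * indicator (square c r) (plane_point c p) \<partial>lborel)"
    using m mf by (intro nn_integral_distr) auto
  also have "\<dots> = (\<integral>\<^sup>+p. ennreal (f (plane_point c p)) * indicator (cbox (-r, -r) (r, r)) p \<partial>lborel)"
    by (simp add: indicator_def plane_point_in_square)
  also have "\<dots> = ennreal (integral (cbox (-r, -r) (r, r)) (\<lambda>p. f (plane_point c p)))"
    using nonneg int by (intro nn_integral_has_integral_lebesgue')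
  finally show ?thesis .
qed

section \<open>The limit measure\<close>

text \<open>Piecewise linear in the maximum-norm distance to \<open>c\<close>. Convergence of
  measures sees only continuous test functions, so measures of squares are compared through this
  function, at the price of changing the radius.\<close>

definition square_cutoff :: "real^2 \<Rightarrow> real \<Rightarrow> real \<Rightarrow> real^2 \<Rightarrow> real" where
  "square_cutoff c r r' x = max 0 (min 1 ((r' - max \<bar>x $ 1 - c $ 1\<bar> \<bar>x $ 2 - c $ 2\<bar>) / (r' - r)))"

lemma continuous_on_square_cutoff: "r < r' \<Longrightarrow> continuous_on S (square_cutoff c r r')"
  unfolding square_cutoff_def[abs_def] by (intro continuous_intros) auto

lemma square_cutoff_nonneg: "0 \<le> square_cutoff c r r' x"
  by (simp add: square_cutoff_def)

lemma square_cutoff_bounds: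
  assumes "r < r'"
  shows "indicator (square c r) x \<le> square_cutoff c r r' x"
    and "square_cutoff c r r' x \<le> indicator (square c r') x"
proof -
  show "indicator (square c r) x \<le> square_cutoff c r r' x"
  proof (cases "x \<in> square c r")
    case True
    then have "r' - r \<le> r' - max \<bar>x $ 1 - c $ 1\<bar> \<bar>x $ 2 - c $ 2\<bar>"
      by (auto simp: square_def)
    then have "1 \<le> (r' - max \<bar>x $ 1 - c $ 1\<bar> \<bar>x $ 2 - c $ 2\<bar>) / (r' - r)"
      using assms by (simp add: le_divide_eq)
    then show ?thesis
      by (simp add: square_cutoff_def)
  qed (simp add: square_cutoff_nonneg)
  show "square_cutoff c r r' x \<le> indicator (square c r') x"
  proof (cases "x \<in> square c r'")
    case False
    then have "r' - max \<bar>x $ 1 - c $ 1\<bar> \<bar>x $ 2 - c $ 2\<bar> \<le> 0"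
      by (auto simp: square_def)
    then show ?thesis
      using assms False by (simp add: square_cutoff_def divide_nonpos_pos)
  qed (simp add: square_cutoff_def)
qed

lemma test_function_square_cutoff:
  assumes "r < r'" "square c r' \<subseteq> \<Omega>"
  shows "test_function_on \<Omega> (square_cutoff c r r')"
proof -
  have "{x. square_cutoff c r r' x \<noteq> 0} \<subseteq> square c r'"
  proof
    fix x assume "x \<in> {x. square_cutoff c r r' x \<noteq> 0}"
    then show "x \<in> square c r'"
      using square_cutoff_bounds(2)[OF assms(1), of c x] square_cutoff_nonneg[of c r r' x]
      by (cases "x \<in> square c r'") auto
  qed
  then have "closure {x. square_cutoff c r r' x \<noteq> 0} \<subseteq> square c r'"
    by (rule closure_minimal[OF _ closed_square])
  then show ?thesis
    unfolding test_function_on_def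
    using assms continuous_on_square_cutoff[OF assms(1)] compact_square[of c r'] closed_closure
      compact_Int_closed[OF compact_square[of c r'], of "closure {x. square_cutoff c r r' x \<noteq> 0}"]
    by (auto simp: Int_absorb1)
qed

text \<open>The upper bound makes \<open>I\<close> finite, so \<open>enn2real\<close>, which sends
  infinity to 0, loses nothing.\<close>

lemma enn2real_between:
  assumes "ennreal a \<le> I" "I \<le> ennreal b" "0 \<le> a" "0 \<le> b"
  shows "a \<le> enn2real I" "enn2real I \<le> b"
proof -
  have "I < top" using assms(2) by (rule le_less_trans) simp
  then have "ennreal (enn2real I) = I" by simp
  then show "a \<le> enn2real I" "enn2real I \<le> b"
    using assms by (metis ennreal_le_iff enn2real_nonneg)+
qed

text \<open>The cutoff lies between two indicators and the density is nonnegative, so the comparison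
  is made with nonnegative integrals; the Bochner integral in which convergence is stated is
  recovered at the end.\<close>

lemma energy_measure_cutoff:
  fixes V :: "real^'k::finite \<Rightarrow> real"
  assumes "open \<Omega>" "\<epsilon> > 0" "solution_on V \<Omega> \<epsilon> u" "continuous_on UNIV V" "\<And>y. V y \<ge> 0"
    and r: "r < r'" "square c r' \<subseteq> \<Omega>"
  defines "E \<equiv> \<lambda>r. integral (cbox (-r, -r) (r, r)) (\<lambda>p. energy_density V \<epsilon> u (plane_point c p))"
  shows "E r \<le> integral\<^sup>L (energy_measure V \<Omega> \<epsilon> u) (square_cutoff c r r')"
    and "integral\<^sup>L (energy_measure V \<Omega> \<epsilon> u) (square_cutoff c r r') \<le> E r'"
proof -
  define ed where "ed = energy_density V \<epsilon> u"
  define \<phi> where "\<phi> = square_cutoff c r r'"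
  have smooth: "smooth_on \<Omega> u" using assms(3) by (simp add: solution_on_def)
  have cont: "continuous_on \<Omega> ed"
    unfolding ed_def energy_density_def[abs_def]
    by (intro continuous_intros smooth_on_imp_continuous_on smooth_on_partial smooth
        continuous_on_compose2[OF assms(4) smooth_on_imp_continuous_on[OF smooth]]) auto
  have nonneg: "ed x \<ge> 0" for x
    using assms(2,5) by (auto simp: ed_def energy_density_def sum_nonneg)
  have \<Omega>: "\<Omega> \<in> sets borel" using assms(1) by simp
  have sub: "square c r \<subseteq> square c r'" using r(1) by (auto simp: square_def)
  have [measurable]: "ed \<in> borel_measurable (restrict_space lborel \<Omega>)"
    using borel_measurable_continuous_on_restrict[OF cont] by (simp cong: measurable_cong_sets sets_restrict_space_cong)
  have "\<phi> \<in> borel_measurable borel"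
    unfolding \<phi>_def by (intro borel_measurable_continuous_onI continuous_on_square_cutoff r)
  then have [measurable]: "\<phi> \<in> borel_measurable (restrict_space lborel \<Omega>)"
    by (intro measurable_restrict_space1) simp
  define I where "I = (\<integral>\<^sup>+x. ennreal (\<phi> x) \<partial>energy_measure V \<Omega> \<epsilon> u)"
  have I: "I = (\<integral>\<^sup>+x. ennreal (ed x) * ennreal (\<phi> x) * indicator \<Omega> x \<partial>lborel)"
  proof -
    have "I = (\<integral>\<^sup>+x. ennreal (ed x) * ennreal (\<phi> x) \<partial>restrict_space lborel \<Omega>)"
      unfolding I_def energy_measure_def ed_def[symmetric] by (intro nn_integral_density) measurable
    also have "\<dots> = (\<integral>\<^sup>+x. ennreal (ed x) * ennreal (\<phi> x) * indicator \<Omega> x \<partial>lborel)"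
      using \<Omega> by (intro nn_integral_restrict_space) simp
    finally show ?thesis .
  qed
  have E: "ennreal (E s) = (\<integral>\<^sup>+x. ennreal (ed x) * indicator (square c s) x \<partial>lborel)"
    if "square c s \<subseteq> \<Omega>" for s
    unfolding E_def ed_def[symmetric]
    by (intro nn_integral_square[symmetric] continuous_on_subset[OF cont that] nonneg)
  have E0: "E s \<ge> 0" if "square c s \<subseteq> \<Omega>" for s
  proof -
    have "continuous_on (cbox (-s, -s) (s, s)) (\<lambda>p. ed (plane_point c p))"
      using that plane_point_in_square
      by (intro continuous_on_compose2[OF cont continuous_on_plane_point]) blast
    then show ?thesis
      unfolding E_def ed_def[symmetric] using nonneg by (intro integral_nonneg integrable_continuous) auto
  qed
  have lo: "ennreal (E r) \<le> I"
  proof -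
    have "ennreal (ed x) * indicator (square c r) x \<le> ennreal (ed x) * ennreal (\<phi> x) * indicator \<Omega> x" for x
    proof (cases "x \<in> square c r")
      case True
      then have "1 \<le> ennreal (\<phi> x)" "x \<in> \<Omega>"
        using square_cutoff_bounds(1)[OF r(1), of c x] sub r(2) unfolding \<phi>_def by auto
      then show ?thesis
        using True mult_left_mono[of 1 "ennreal (\<phi> x)" "ennreal (ed x)"] by simp
    qed simp
    then show ?thesis
      unfolding I E[OF order_trans[OF sub r(2)]] by (intro nn_integral_mono)
  qed
  have hi: "I \<le> ennreal (E r')"
  proof -
    have "ennreal (ed x) * ennreal (\<phi> x) * indicator \<Omega> x \<le> ennreal (ed x) * indicator (square c r') x" for x
    proof -
      have "ennreal (\<phi> x) \<le> indicator (square c r') x"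
        using square_cutoff_bounds(2)[OF r(1), of c x] unfolding \<phi>_def
        by (cases "x \<in> square c r'") (auto simp: ennreal_le_1 ennreal_neg)
      then have "ennreal (ed x) * ennreal (\<phi> x) \<le> ennreal (ed x) * indicator (square c r') x"
        by (intro mult_left_mono) auto
      then show ?thesis
        by (cases "x \<in> \<Omega>") auto
    qed
    then show ?thesis
      unfolding I E[OF r(2)] by (intro nn_integral_mono)
  qed
  have "integral\<^sup>L (energy_measure V \<Omega> \<epsilon> u) \<phi> = enn2real I"
    unfolding I_def
  proof (rule integral_eq_nn_integral)
    show "\<phi> \<in> borel_measurable (energy_measure V \<Omega> \<epsilon> u)"
      unfolding energy_measure_def by simp
    show "AE x in energy_measure V \<Omega> \<epsilon> u. 0 \<le> \<phi> x"
      by (simp add: \<phi>_def square_cutoff_nonneg)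
  qed
  then show "E r \<le> integral\<^sup>L (energy_measure V \<Omega> \<epsilon> u) (square_cutoff c r r')"
    and "integral\<^sup>L (energy_measure V \<Omega> \<epsilon> u) (square_cutoff c r r') \<le> E r'"
    using enn2real_between[OF lo hi] E0 sub r(2) by (auto simp: \<phi>_def)
qed

lemma square_in_sets:
  assumes "radon_measure_on \<Omega> \<nu>" "square c r \<subseteq> \<Omega>" "open \<Omega>"
  shows "square c r \<in> sets \<nu>" "emeasure \<nu> (square c r) < \<infinity>"
  using assms closed_square[of c r] compact_square[of c r]
  by (auto simp: radon_measure_on_def sets_restrict_space_iff)

lemma radon_measure_cutoff:
  assumes "radon_measure_on \<Omega> \<nu>" "open \<Omega>" and r: "r < r'" "square c r' \<subseteq> \<Omega>"
  shows "measure \<nu> (square c r) \<le> integral\<^sup>L \<nu> (square_cutoff c r r')"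
    and "integral\<^sup>L \<nu> (square_cutoff c r r') \<le> measure \<nu> (square c r')"
proof -
  define \<phi> where "\<phi> = square_cutoff c r r'"
  have sub: "square c r \<subseteq> \<Omega>" using r by (auto simp: square_def)
  note sq = square_in_sets[OF assms(1) sub assms(2)] square_in_sets[OF assms(1) r(2) assms(2)]
  have "\<phi> \<in> borel_measurable borel"
    unfolding \<phi>_def by (intro borel_measurable_continuous_onI continuous_on_square_cutoff r)
  then have "\<phi> \<in> borel_measurable (restrict_space borel \<Omega>)"
    by (intro measurable_restrict_space1)
  then have m: "\<phi> \<in> borel_measurable \<nu>"
    using assms(1) by (simp add: radon_measure_on_def cong: measurable_cong_sets)
  have "emeasure \<nu> (square c r) = (\<integral>\<^sup>+x. indicator (square c r) x \<partial>\<nu>)"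
    using sq by simp
  also have "\<dots> \<le> (\<integral>\<^sup>+x. ennreal (\<phi> x) \<partial>\<nu>)"
  proof (rule nn_integral_mono)
    show "indicator (square c r) x \<le> ennreal (\<phi> x)" for x
      using square_cutoff_bounds(1)[OF r(1), of c x] unfolding \<phi>_def
      by (cases "x \<in> square c r") auto
  qed
  finally have lo: "ennreal (measure \<nu> (square c r)) \<le> (\<integral>\<^sup>+x. ennreal (\<phi> x) \<partial>\<nu>)"
    using sq by (simp add: emeasure_eq_ennreal_measure)
  have "(\<integral>\<^sup>+x. ennreal (\<phi> x) \<partial>\<nu>) \<le> (\<integral>\<^sup>+x. indicator (square c r') x \<partial>\<nu>)"
  proof (rule nn_integral_mono)
    show "ennreal (\<phi> x) \<le> indicator (square c r') x" for x
      using square_cutoff_bounds(2)[OF r(1), of c x] unfolding \<phi>_def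
      by (cases "x \<in> square c r'") (auto simp: ennreal_le_1 ennreal_neg)
  qed
  also have "\<dots> = emeasure \<nu> (square c r')"
    using sq by simp
  finally have hi: "(\<integral>\<^sup>+x. ennreal (\<phi> x) \<partial>\<nu>) \<le> ennreal (measure \<nu> (square c r'))"
    using sq by (simp add: emeasure_eq_ennreal_measure)
  have "integral\<^sup>L \<nu> \<phi> = enn2real (\<integral>\<^sup>+x. ennreal (\<phi> x) \<partial>\<nu>)"
    by (rule integral_eq_nn_integral[OF m]) (simp add: \<phi>_def square_cutoff_nonneg)
  then show "measure \<nu> (square c r) \<le> integral\<^sup>L \<nu> (square_cutoff c r r')"
    and "integral\<^sup>L \<nu> (square_cutoff c r r') \<le> measure \<nu> (square c r')"
    using enn2real_between[OF lo hi] by (auto simp: \<phi>_def)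
qed

definition limit_of_solutions ::
  "(real^'k::finite \<Rightarrow> real) \<Rightarrow> (real^2) set \<Rightarrow> (nat \<Rightarrow> real) \<Rightarrow> (nat \<Rightarrow> real^2 \<Rightarrow> real^'k) \<Rightarrow> (real^2) measure \<Rightarrow> bool"
  where "limit_of_solutions V \<Omega> \<epsilon> u \<nu> \<longleftrightarrow>
    open \<Omega> \<and> (\<forall>n. 0 < \<epsilon> n) \<and> \<epsilon> \<longlonglongrightarrow> 0 \<and> (\<forall>n. solution_on V \<Omega> (\<epsilon> n) (u n)) \<and>
    radon_measure_on \<Omega> \<nu> \<and> converges_as_measures_on \<Omega> (\<lambda>n. energy_measure V \<Omega> (\<epsilon> n) (u n)) \<nu>"

text \<open>The radius drops by 8 in three halvings: from \<open>2 * r\<close> to \<open>r\<close>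
  by the outer cutoff, to \<open>r / 2\<close> by the energy decay, to \<open>r / 4\<close> by the
  inner cutoff.\<close>

lemma limit_measure_decay:
  fixes V :: "real^'k::finite \<Rightarrow> real"
  assumes "multiwell_potential V" "\<theta> > 0"
  obtains \<eta> where "\<eta> > 0"
    "\<And>\<Omega> \<epsilon> (u :: nat \<Rightarrow> real^2 \<Rightarrow> real^'k) \<nu> c r. limit_of_solutions V \<Omega> \<epsilon> u \<nu> \<Longrightarrow> r > 0 \<Longrightarrow> square c (2 * r) \<subseteq> \<Omega> \<Longrightarrow>
      measure \<nu> (square c (2 * r)) < \<eta> * r \<Longrightarrow>
      measure \<nu> (square c (r / 4)) \<le> \<theta> * measure \<nu> (square c (2 * r))"
proof -
  obtain \<kappa>0 R0 where pot: "potential V (grad V) {y. V y = 0} \<kappa>0 R0"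
    using multiwell_potential_imp_potential[OF assms(1)] by blast
  interpret potential V "grad V" "{y. V y = 0}" \<kappa>0 R0 by (rule pot)
  obtain \<eta> where \<eta>: "\<eta> > 0"
    "\<And>R s. R > 0 \<Longrightarrow> s > 0 \<Longrightarrow> \<exists>\<epsilon>0>0. \<forall>\<epsilon> U U1 U2 U11 U12 U22.
      planar_solution V (grad V) {y. V y = 0} \<kappa>0 R0 \<epsilon> R U U1 U2 U11 U12 U22 \<longrightarrow> \<epsilon> < \<epsilon>0 \<longrightarrow>
      integral (cbox (-R, -R) (R, R)) (planar_solution.e V \<epsilon> U U1 U2) \<le> \<eta> * R \<longrightarrow>
      integral (cbox (- (R / 2), - (R / 2)) (R / 2, R / 2)) (planar_solution.e V \<epsilon> U U1 U2)
        \<le> \<theta> * integral (cbox (-R, -R) (R, R)) (planar_solution.e V \<epsilon> U U1 U2) + s"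
    using energy_decay[OF assms(2)] by blast
  show thesis
  proof (rule that[OF \<eta>(1)])
    fix \<Omega> \<epsilon> and u :: "nat \<Rightarrow> real^2 \<Rightarrow> real^'k" and \<nu> c r
    assume lim: "limit_of_solutions V \<Omega> \<epsilon> u \<nu>" and r: "r > 0" and sub: "square c (2 * r) \<subseteq> \<Omega>"
      and small: "measure \<nu> (square c (2 * r)) < \<eta> * r"
    have \<Omega>: "open \<Omega>" and \<epsilon>: "\<And>n. 0 < \<epsilon> n" "\<epsilon> \<longlonglongrightarrow> 0" and sol: "\<And>n. solution_on V \<Omega> (\<epsilon> n) (u n)"
      and radon: "radon_measure_on \<Omega> \<nu>"
      and conv: "\<And>\<phi>. test_function_on \<Omega> \<phi> \<Longrightarrow>
        (\<lambda>n. integral\<^sup>L (energy_measure V \<Omega> (\<epsilon> n) (u n)) \<phi>) \<longlonglongrightarrow> integral\<^sup>L \<nu> \<phi>"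
      using lim by (auto simp: limit_of_solutions_def converges_as_measures_on_def)
    have sub1: "square c r \<subseteq> \<Omega>" and sub2: "square c (r / 2) \<subseteq> \<Omega>"
      using sub r by (auto simp: square_def subset_iff)
    define E where "E n s = integral (cbox (-s, -s) (s, s)) (\<lambda>p. energy_density V (\<epsilon> n) (u n) (plane_point c p))" for n s
    define \<alpha> where "\<alpha> n = integral\<^sup>L (energy_measure V \<Omega> (\<epsilon> n) (u n)) (square_cutoff c r (2 * r))" for n
    define \<beta> where "\<beta> n = integral\<^sup>L (energy_measure V \<Omega> (\<epsilon> n) (u n)) (square_cutoff c (r / 4) (r / 2))" for n
    have \<alpha>: "\<alpha> \<longlonglongrightarrow> integral\<^sup>L \<nu> (square_cutoff c r (2 * r))"
      unfolding \<alpha>_def using r sub by (intro conv test_function_square_cutoff) auto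
    have \<beta>: "\<beta> \<longlonglongrightarrow> integral\<^sup>L \<nu> (square_cutoff c (r / 4) (r / 2))"
      unfolding \<beta>_def using r sub2 by (intro conv test_function_square_cutoff) auto
    have E\<alpha>: "E n r \<le> \<alpha> n" for n
      unfolding E_def \<alpha>_def using r by (intro energy_measure_cutoff \<Omega> \<epsilon> sol cont_V V_nonneg sub) auto
    have E\<beta>: "\<beta> n \<le> E n (r / 2)" for n
      unfolding E_def \<beta>_def using r by (intro energy_measure_cutoff \<Omega> \<epsilon> sol cont_V V_nonneg sub2) auto
    have \<nu>\<alpha>: "integral\<^sup>L \<nu> (square_cutoff c r (2 * r)) \<le> measure \<nu> (square c (2 * r))"
      using r by (intro radon_measure_cutoff(2)[OF radon \<Omega> _ sub]) auto
    have \<nu>\<beta>: "measure \<nu> (square c (r / 4)) \<le> integral\<^sup>L \<nu> (square_cutoff c (r / 4) (r / 2))"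
      using r by (intro radon_measure_cutoff(1)[OF radon \<Omega> _ sub2]) auto
    have "integral\<^sup>L \<nu> (square_cutoff c (r / 4) (r / 2)) \<le> \<theta> * integral\<^sup>L \<nu> (square_cutoff c r (2 * r)) + s"
      if s: "s > 0" for s
    proof -
      obtain \<epsilon>0 where \<epsilon>0: "\<epsilon>0 > 0" "\<And>\<epsilon> U U1 U2 U11 U12 U22.
          planar_solution V (grad V) {y. V y = 0} \<kappa>0 R0 \<epsilon> r U U1 U2 U11 U12 U22 \<Longrightarrow> \<epsilon> < \<epsilon>0 \<Longrightarrow>
          integral (cbox (-r, -r) (r, r)) (planar_solution.e V \<epsilon> U U1 U2) \<le> \<eta> * r \<Longrightarrow>
          integral (cbox (- (r / 2), - (r / 2)) (r / 2, r / 2)) (planar_solution.e V \<epsilon> U U1 U2)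
            \<le> \<theta> * integral (cbox (-r, -r) (r, r)) (planar_solution.e V \<epsilon> U U1 U2) + s"
        using \<eta>(2)[OF r s] by blast
      have "eventually (\<lambda>n. \<epsilon> n < \<epsilon>0) sequentially"
        using order_tendstoD(2)[OF \<epsilon>(2) \<epsilon>0(1)] .
      \<comment> \<open>The strict smallness of the limit measure passes to the approximating
        energies for large \<open>n\<close>; this is where strictness matters.\<close>
      moreover have "eventually (\<lambda>n. \<alpha> n < \<eta> * r) sequentially"
        using order_tendstoD(2)[OF \<alpha>, of "\<eta> * r"] \<nu>\<alpha> small by linarith
      ultimately have "eventually (\<lambda>n. \<beta> n \<le> \<theta> * \<alpha> n + s) sequentially"
      proof eventually_elim
        fix n assume n: "\<epsilon> n < \<epsilon>0" "\<alpha> n < \<eta> * r"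
        note planar = solution_on_imp_planar_solution[OF pot sol \<Omega> sub1 r \<epsilon>(1), of n]
        have "E n (r / 2) \<le> \<theta> * E n r + s"
          using \<epsilon>0(2)[OF planar n(1)] n(2) E\<alpha>[of n] by (simp add: planar_energy_density[OF planar] E_def)
        also have "\<dots> \<le> \<theta> * \<alpha> n + s"
          using E\<alpha>[of n] assms(2) by simp
        finally show "\<beta> n \<le> \<theta> * \<alpha> n + s"
          using E\<beta>[of n] by linarith
      qed
      then show ?thesis
        by (intro tendsto_le[OF _ _ \<beta>, of "\<lambda>n. \<theta> * \<alpha> n + s"] tendsto_intros \<alpha>) auto
    qed
    then have "integral\<^sup>L \<nu> (square_cutoff c (r / 4) (r / 2)) \<le> \<theta> * integral\<^sup>L \<nu> (square_cutoff c r (2 * r))"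
      by (rule field_le_epsilon)
    also have "\<dots> \<le> \<theta> * measure \<nu> (square c (2 * r))"
      using \<nu>\<alpha> assms(2) by simp
    finally show "measure \<nu> (square c (r / 4)) \<le> \<theta> * measure \<nu> (square c (2 * r))"
      using \<nu>\<beta> by linarith
  qed
qed

section \<open>Covering argument and conclusion\<close>

text \<open>Each coordinate is rounded down to a multiple of \<open>s\<close>. Squares of half side
  \<open>s\<close> at spacing \<open>s\<close> overlap, which an upper bound for the measure can
  afford.\<close>

lemma cball_subset_grid:
  fixes x0 :: "real^2"
  assumes "s > 0" "\<rho> \<le> real N * s"
  shows "cball x0 \<rho> \<subseteq> (\<Union>(i, k)\<in>{- int N..int N} \<times> {- int N..int N}.
    square (plane_point x0 (of_int i * s, of_int k * s)) s)"
proof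
  fix x assume x: "x \<in> cball x0 \<rho>"
  define t where "t i = (x $ i - x0 $ i) / s" for i
  have t: "\<bar>t i\<bar> \<le> real N" for i
  proof -
    have "\<bar>x $ i - x0 $ i\<bar> \<le> norm (x - x0)"
      using component_le_norm_cart[of "x - x0" i] by simp
    also have "\<dots> \<le> real N * s"
      using x assms by (simp add: dist_norm norm_minus_commute)
    finally show ?thesis
      using assms(1) by (simp add: t_def abs_divide pos_divide_le_eq)
  qed
  have fl: "\<lfloor>t i\<rfloor> \<in> {- int N..int N}" for i
    using t[of i] by (auto simp: abs_le_iff le_floor_iff floor_le_iff)
  have close: "\<bar>x $ i - (x0 $ i + of_int \<lfloor>t i\<rfloor> * s)\<bar> \<le> s" for i
  proof -
    have "x $ i - (x0 $ i + of_int \<lfloor>t i\<rfloor> * s) = (t i - of_int \<lfloor>t i\<rfloor>) * s"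
    proof -
      have "t i * s = x $ i - x0 $ i"
        using assms(1) by (simp add: t_def)
      then show ?thesis by (simp add: left_diff_distrib)
    qed
    moreover have "\<bar>t i - of_int \<lfloor>t i\<rfloor>\<bar> \<le> 1" by linarith
    ultimately show ?thesis
      using assms(1) by (simp add: abs_mult mult_left_le_one_le)
  qed
  have "x \<in> square (plane_point x0 (of_int \<lfloor>t 1\<rfloor> * s, of_int \<lfloor>t 2\<rfloor> * s)) s"
    using close[of 1] close[of 2] by (simp add: square_def)
  then show "x \<in> (\<Union>(i, k)\<in>{- int N..int N} \<times> {- int N..int N}.
      square (plane_point x0 (of_int i * s, of_int k * s)) s)"
    using fl[of 1] fl[of 2] by blast
qed

theorem theorem2:
  fixes V :: "real^'k::finite \<Rightarrow> real"
  assumes "multiwell_potential V"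
  shows "\<exists>\<eta>\<^sub>0::real. \<eta>\<^sub>0 > 0 \<and>
    (\<forall>(\<Omega> :: (real^2) set) (M\<^sub>0 :: real) (\<epsilon> :: nat \<Rightarrow> real) (u :: nat \<Rightarrow> real^2 \<Rightarrow> real^'k)
        (\<nu> :: (real^2) measure) (x\<^sub>0 :: real^2) (r :: real).
      smooth_bounded_domain \<Omega> \<and> M\<^sub>0 > 0 \<and>
      (\<forall>n. 0 < \<epsilon> n \<and> \<epsilon> n \<le> 1) \<and> decseq \<epsilon> \<and> \<epsilon> \<longlonglongrightarrow> 0 \<and>
      (\<forall>n. solution_on V \<Omega> (\<epsilon> n) (u n)) \<and>
      (\<forall>n. (\<integral>\<^sup>+x\<in>\<Omega>. ennreal (energy_density V (\<epsilon> n) (u n) x) \<partial>lborel) \<le> ennreal M\<^sub>0) \<and>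
      radon_measure_on \<Omega> \<nu> \<and>
      converges_as_measures_on \<Omega> (\<lambda>n. energy_measure V \<Omega> (\<epsilon> n) (u n)) \<nu> \<and>
      x\<^sub>0 \<in> \<Omega> \<and> r > 0 \<and> ball x\<^sub>0 r \<subseteq> \<Omega> \<and>
      emeasure \<nu> (cball x\<^sub>0 r \<inter> \<Omega>) / ennreal r < ennreal \<eta>\<^sub>0
      \<longrightarrow> emeasure \<nu> (cball x\<^sub>0 (r / 2) \<inter> \<Omega>) = 0)"
proof -
  obtain \<eta> where \<eta>: "\<eta> > 0"
    "\<And>\<Omega> \<epsilon> (u :: nat \<Rightarrow> real^2 \<Rightarrow> real^'k) \<nu> c r. limit_of_solutions V \<Omega> \<epsilon> u \<nu> \<Longrightarrow> r > 0 \<Longrightarrow> square c (2 * r) \<subseteq> \<Omega> \<Longrightarrow>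
      measure \<nu> (square c (2 * r)) < \<eta> * r \<Longrightarrow>
      measure \<nu> (square c (r / 4)) \<le> 1 / 128 * measure \<nu> (square c (2 * r))"
    using limit_measure_decay[OF assms, of "1 / 128"] by auto
  have main: "emeasure \<nu> (cball x0 (r / 2) \<inter> \<Omega>) = 0"
    if lim: "limit_of_solutions V \<Omega> \<epsilon> u \<nu>" and r: "r > 0" "ball x0 r \<subseteq> \<Omega>"
      and small: "emeasure \<nu> (cball x0 r \<inter> \<Omega>) / ennreal r < ennreal (\<eta> / 32)"
    for \<Omega> \<epsilon> and u :: "nat \<Rightarrow> real^2 \<Rightarrow> real^'k" and \<nu> x0 r
  proof -
    have \<Omega>: "open \<Omega>" and radon: "radon_measure_on \<Omega> \<nu>"
      using lim by (auto simp: limit_of_solutions_def)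
    \<comment> \<open>Squares meeting the half disc have centres within
      \<open>8 * \<rho> + 2 * \<rho>\<close> of \<open>x0\<close>, and a square of half side
      \<open>\<rho>\<close> lies in the disc of radius \<open>2 * \<rho>\<close> about its centre;
      the total \<open>12 * \<rho>\<close> is less than \<open>r\<close>.\<close>
    define \<rho> where "\<rho> = r / 16"
    have \<rho>: "\<rho> > 0" using r by (simp add: \<rho>_def)
    have sets_\<nu>: "A \<inter> \<Omega> \<in> sets \<nu>" if "closed A" for A
      using radon that \<Omega> by (auto simp: radon_measure_on_def sets_restrict_space_iff)
    define m where "m = emeasure \<nu> (cball x0 r \<inter> \<Omega>)"
    have m: "m < ennreal (\<eta> / 32 * r)"
    proof -
      have "m = m / ennreal r * ennreal r"
        using r by (simp add: ennreal_divide_times ennreal_mult_divide_eq)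
      also have "\<dots> < ennreal (\<eta> / 32) * ennreal r"
        using small r by (intro ennreal_mult_strict_right_mono) (auto simp: m_def)
      also have "\<dots> = ennreal (\<eta> / 32 * r)"
        using \<eta>(1) r by (subst ennreal_mult[symmetric]) auto
      finally show ?thesis .
    qed
    \<comment> \<open>Finiteness is recorded because \<open>measure\<close> and
      \<open>enn2real\<close> turn an infinite value into 0.\<close>
    have m_top: "m < top"
      by (rule less_trans[OF m ennreal_less_top])
    define M where "M = enn2real m"
    \<comment> \<open>As \<open>\<rho> = r / 16\<close>, the threshold \<open>\<eta> / 32\<close> is
      exactly the smallness asked by the decay on a square of half side
      \<open>\<rho> = 2 * (\<rho> / 2)\<close>.\<close>
    have M: "M < \<eta> / 2 * \<rho>" "M \<ge> 0"
    proof -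
      have "ennreal M = m"
        unfolding M_def by (rule ennreal_enn2real[OF m_top])
      then have "ennreal M < ennreal (\<eta> / 32 * r)" using m by simp
      then show "M < \<eta> / 2 * \<rho>" by (simp add: ennreal_less_iff M_def \<rho>_def)
    qed (simp add: M_def)
    have decay: "square c (\<rho> / 8 ^ j) \<subseteq> \<Omega> \<and> measure \<nu> (square c (\<rho> / 8 ^ j)) \<le> M / 128 ^ j"
      if c: "c \<in> cball x0 (10 * \<rho>)" for c j
    proof (induction j)
      case 0
      have sub: "square c \<rho> \<subseteq> ball x0 r"
      proof
        fix y assume "y \<in> square c \<rho>"
        then have "dist c y \<le> 2 * \<rho>" using square_subset_cball by fastforce
        then show "y \<in> ball x0 r"
          using c \<rho> dist_triangle[of x0 y c] by (simp add: \<rho>_def)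
      qed
      then have "square c \<rho> \<subseteq> \<Omega>" using r by blast
      moreover have "emeasure \<nu> (square c \<rho>) \<le> m"
        unfolding m_def using sub r by (intro emeasure_mono sets_\<nu>) auto
      then have "measure \<nu> (square c \<rho>) \<le> M"
        unfolding M_def measure_def by (intro enn2real_mono m_top)
      ultimately show ?case by simp
    next
      case (Suc j)
      define \<sigma> where "\<sigma> = \<rho> / 8 ^ j"
      have \<sigma>: "\<sigma> > 0" using \<rho> by (simp add: \<sigma>_def)
      have IH: "square c (2 * (\<sigma> / 2)) \<subseteq> \<Omega>" "measure \<nu> (square c (2 * (\<sigma> / 2))) \<le> M / 128 ^ j"
        using Suc by (simp_all add: \<sigma>_def)
      \<comment> \<open>The measure bound shrinks by 128 while the radius shrinks by 8, so the
        smallness relative to the radius survives and the decay can be iterated.\<close>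
      have "M / 128 ^ j \<le> M / 8 ^ j"
        using M by (intro divide_left_mono power_mono) auto
      also have "\<dots> < \<eta> / 2 * \<rho> / 8 ^ j"
        using M by (intro divide_strict_right_mono) auto
      finally have "M / 128 ^ j < \<eta> * (\<sigma> / 2)"
        by (simp add: \<sigma>_def)
      then have "measure \<nu> (square c (\<sigma> / 2 / 4)) \<le> 1 / 128 * measure \<nu> (square c (2 * (\<sigma> / 2)))"
        using \<sigma> IH by (intro \<eta>(2)[OF lim] le_less_trans[OF IH(2)]) auto
      then have "measure \<nu> (square c (\<sigma> / 8)) \<le> M / 128 ^ Suc j"
        using IH by simp
      moreover have "square c (\<sigma> / 8) \<subseteq> \<Omega>"
        using IH(1) \<sigma> by (auto simp: square_def subset_iff)
      moreover have "\<sigma> / 8 = \<rho> / 8 ^ Suc j" by (simp add: \<sigma>_def)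
      ultimately show ?case by simp
    qed
    have bound: "emeasure \<nu> (cball x0 (r / 2) \<inter> \<Omega>) \<le> ennreal (289 * M * (1 / 2) ^ j)" for j
    proof -
      define s where "s = \<rho> / 8 ^ j"
      have s: "s > 0" "s \<le> \<rho>" using \<rho> by (auto simp: s_def field_simps)
      \<comment> \<open>Chosen so that \<open>N * s = 8 * \<rho> = r / 2\<close>: the grid just
        reaches the edge of the half disc.\<close>
      define N where "N = 8 * (8::nat) ^ j"
      \<comment> \<open>Corner cells of the grid can have centres too far from \<open>x0\<close> for
        the decay; only cells with admissible centres are kept, and they still cover the half
        disc.\<close>
      define J where "J = {ik \<in> {- int N..int N} \<times> {- int N..int N}.
        plane_point x0 (of_int (fst ik) * s, of_int (snd ik) * s) \<in> cball x0 (10 * \<rho>)}"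
      define Q where "Q ik = square (plane_point x0 (of_int (fst ik) * s, of_int (snd ik) * s)) s" for ik :: "int \<times> int"
      have fin: "finite J" by (simp add: J_def)
      have "r / 2 \<le> real N * s"
        using \<rho> by (simp add: N_def s_def \<rho>_def)
      note grid = cball_subset_grid[OF s(1) this, of x0]
      have cover: "cball x0 (r / 2) \<subseteq> (\<Union>ik\<in>J. Q ik)"
      proof
        fix x assume x: "x \<in> cball x0 (r / 2)"
        with grid obtain i k where ik: "(i, k) \<in> {- int N..int N} \<times> {- int N..int N}"
          "x \<in> square (plane_point x0 (of_int i * s, of_int k * s)) s"
          by blast
        define c where "c = plane_point x0 (of_int i * s, of_int k * s)"
        have "dist c x \<le> 2 * s"
          using ik(2) square_subset_cball[of c s] by (auto simp: c_def)
        moreover have "dist x0 x \<le> 8 * \<rho>" using x by (simp add: \<rho>_def)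
        ultimately have "dist x0 c \<le> 10 * \<rho>"
          using dist_triangle[of x0 c x] s(2) by (simp add: dist_commute)
        then have "(i, k) \<in> J" using ik(1) by (simp add: J_def c_def)
        moreover have "x \<in> Q (i, k)" using ik(2) by (simp add: Q_def)
        ultimately show "x \<in> (\<Union>ik\<in>J. Q ik)" by blast
      qed
      have Qb: "Q ik \<in> sets \<nu>" "emeasure \<nu> (Q ik) \<le> ennreal (M / 128 ^ j)" if "ik \<in> J" for ik
      proof -
        have d: "Q ik \<subseteq> \<Omega>" "measure \<nu> (Q ik) \<le> M / 128 ^ j"
          using decay that by (auto simp: J_def Q_def s_def)
        from square_in_sets[OF radon d(1)[unfolded Q_def] \<Omega>]
        have sq: "Q ik \<in> sets \<nu>" "emeasure \<nu> (Q ik) < \<infinity>"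
          by (simp_all add: Q_def)
        then show "Q ik \<in> sets \<nu>" "emeasure \<nu> (Q ik) \<le> ennreal (M / 128 ^ j)"
          using d(2) by (simp_all add: emeasure_eq_ennreal_measure ennreal_leI)
      qed
      have "emeasure \<nu> (cball x0 (r / 2) \<inter> \<Omega>) \<le> emeasure \<nu> (\<Union>ik\<in>J. Q ik)"
        using cover Qb(1) fin by (intro emeasure_mono sets.finite_UN) auto
      also have "\<dots> \<le> (\<Sum>ik\<in>J. emeasure \<nu> (Q ik))"
        using fin Qb(1) by (intro emeasure_subadditive_finite) auto
      also have "\<dots> \<le> (\<Sum>ik\<in>J. ennreal (M / 128 ^ j))"
        by (intro sum_mono Qb)
      also have "\<dots> = ennreal (real (card J) * (M / 128 ^ j))"
        using M by (subst ennreal_mult) (auto simp: ennreal_of_nat_eq_real_of_nat)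
      \<comment> \<open>At most \<open>(2 * N + 1)\<^sup>2 \<le> (17 * 8 ^ j)\<^sup>2 = 289 * 64 ^
        j\<close> cells, each of measure at most \<open>M / 128 ^ j\<close>: the ratio 64/128 sends
        the total to 0.\<close>
      also have "\<dots> \<le> ennreal (289 * M * (1 / 2) ^ j)"
      proof (rule ennreal_leI)
        have "card J \<le> card ({- int N..int N} \<times> {- int N..int N})"
          by (intro card_mono) (auto simp: J_def)
        also have "\<dots> = (2 * N + 1) * (2 * N + 1)"
          by (simp add: card_cartesian_product nat_add_distrib nat_mult_distrib)
        also have "\<dots> \<le> (17 * 8 ^ j) * (17 * 8 ^ j)"
          by (intro mult_mono) (auto simp: N_def)
        finally have "real (card J) \<le> real ((17 * 8 ^ j) * (17 * 8 ^ j))"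
          by (simp only: of_nat_le_iff)
        also have "\<dots> = 289 * 64 ^ j"
          by (simp add: power_mult_distrib[symmetric])
        finally have "real (card J) * (M / 128 ^ j) \<le> 289 * 64 ^ j * (M / 128 ^ j)"
          using M by (intro mult_right_mono) auto
        also have "\<dots> = 289 * M * (64 / 128) ^ j"
          by (simp only: power_divide) simp
        finally show "real (card J) * (M / 128 ^ j) \<le> 289 * M * (1 / 2) ^ j" by simp
      qed
      finally show ?thesis .
    qed
    have "(\<lambda>j. ennreal (289 * M * (1 / 2) ^ j)) \<longlonglongrightarrow> ennreal (289 * M * 0)"
      by (intro tendsto_ennrealI tendsto_intros LIMSEQ_realpow_zero) auto
    then have "emeasure \<nu> (cball x0 (r / 2) \<inter> \<Omega>) \<le> ennreal (289 * M * 0)"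
      by (rule LIMSEQ_le_const) (use bound in auto)
    then show ?thesis by simp
  qed
  show ?thesis
  proof (rule exI[of _ "\<eta> / 32"], intro conjI allI impI)
    show "\<eta> / 32 > 0" using \<eta>(1) by simp
  next
    fix \<Omega> M\<^sub>0 \<epsilon> and u :: "nat \<Rightarrow> real^2 \<Rightarrow> real^'k" and \<nu> x\<^sub>0 r
    assume H: "smooth_bounded_domain \<Omega> \<and> M\<^sub>0 > 0 \<and>
      (\<forall>n. 0 < \<epsilon> n \<and> \<epsilon> n \<le> 1) \<and> decseq \<epsilon> \<and> \<epsilon> \<longlonglongrightarrow> 0 \<and>
      (\<forall>n. solution_on V \<Omega> (\<epsilon> n) (u n)) \<and>
      (\<forall>n. (\<integral>\<^sup>+x\<in>\<Omega>. ennreal (energy_density V (\<epsilon> n) (u n) x) \<partial>lborel) \<le> ennreal M\<^sub>0) \<and>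
      radon_measure_on \<Omega> \<nu> \<and>
      converges_as_measures_on \<Omega> (\<lambda>n. energy_measure V \<Omega> (\<epsilon> n) (u n)) \<nu> \<and>
      x\<^sub>0 \<in> \<Omega> \<and> r > 0 \<and> ball x\<^sub>0 r \<subseteq> \<Omega> \<and>
      emeasure \<nu> (cball x\<^sub>0 r \<inter> \<Omega>) / ennreal r < ennreal (\<eta> / 32)"
    then have "limit_of_solutions V \<Omega> \<epsilon> u \<nu>"
      unfolding limit_of_solutions_def smooth_bounded_domain_def by blast
    from main[OF this] H show "emeasure \<nu> (cball x\<^sub>0 (r / 2) \<inter> \<Omega>) = 0"
      by blast
  qed
qed

end
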